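(* Let $p\neq2$ be a prime number and let $G$ be a profinite group of Galois relation type (relative to $p$). Then $G^{(3)}$ is the intersection of all normal open subgroups $N$ of $G$ with $G/N$ isomorphic to one of $1$, $\mathbb{Z}/p^2$, $M_{p^3}$.
   Context: $G^{(1)}=G$ and $G^{(i+1)}=(G^{(i)})^p[G^{(i)},G]$ is the closed subgroup of $G$ generated by all $h^p$ and $[h,g]=h^{-1}g^{-1}hg$, $h\in G^{(i)}$, $g\in G$. $H^i(G)=H^i(G,\mathbb{Z}/p)$ is continuous cohomology with trivial action. The Bockstein map $\beta_G\colon H^1(G)\to H^2(G)$ is the connecting homomorphism of $0\to\mathbb{Z}/p\to\mathbb{Z}/p^2\to\mathbb{Z}/p\to0$. $G$ has Galois relation type (relative to $p$) if: (i) the kernel of the cup product homomorphism $H^1(G)\otimes_{\mathbb{Z}}H^1(G)\to H^2(G)$ is generated by elements of the form $\psi\otimes\psi'$ with $\psi,\psi'\in H^1(G)$; and (ii) there exists $\xi\in H^1(G)$ such that $\psi\cup\xi+\beta_G(\psi)=0$ for every $\psi\in H^1(G)$. (The paper's third condition, for $q=p^d$, that $H^1(G,\mathbb{Z}/q)\to H^1(G,\mathbb{Z}/p^i)$ is surjective for $1\le i\le d$, is vacuous for $q=p$.) $M_{p^3}=\langle r,s\mid r^{p^2}=s^p=1,\ [r,s]=r^p\rangle$ is the nonabelian group of order $p^3$ and exponent $p^2$. *)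

theory Defs
  imports "HOL-Analysis.Analysis" "HOL-Algebra.Product_Groups" "HOL-Algebra.Free_Abelian_Groups"
    "HOL-Number_Theory.Cong"
begin

section \<open>Profinite groups and the descending \<open>p\<close>-central series\<close>

locale profinite_group = group G for G :: "('a, 'b) monoid_scheme" (structure) +
  fixes T :: "'a topology"
  assumes topspace_eq: "topspace T = carrier G"
    and continuous_mult: "continuous_map (prod_topology T T) T (\<lambda>(x, y). x \<otimes> y)"
    and continuous_inv: "continuous_map T T (\<lambda>x. inv x)"
    and compact: "compact_space T"
    and Hausdorff: "Hausdorff_space T"
    and totally_disconnected: "\<And>C x y. \<lbrakk>connectedin T C; x \<in> C; y \<in> C\<rbrakk> \<Longrightarrow> x = y"

definition closed_generate :: "('a, 'b) monoid_scheme \<Rightarrow> 'a topology \<Rightarrow> 'a set \<Rightarrow> 'a set"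
  where "closed_generate G T S = \<Inter>{K. subgroup K G \<and> closedin T K \<and> S \<subseteq> K}"

definition grp_commutator :: "('a, 'b) monoid_scheme \<Rightarrow> 'a \<Rightarrow> 'a \<Rightarrow> 'a"
  where "grp_commutator G h g = inv\<^bsub>G\<^esub> h \<otimes>\<^bsub>G\<^esub> inv\<^bsub>G\<^esub> g \<otimes>\<^bsub>G\<^esub> h \<otimes>\<^bsub>G\<^esub> g"

definition p_central_step ::
    "('a, 'b) monoid_scheme \<Rightarrow> 'a topology \<Rightarrow> nat \<Rightarrow> 'a set \<Rightarrow> 'a set"
  where "p_central_step G T p H = closed_generate G T
    ({h [^]\<^bsub>G\<^esub> p | h. h \<in> H} \<union> {grp_commutator G h g | h g. h \<in> H \<and> g \<in> carrier G})"

(* The series is indexed from 1; index 0 is junk (it also gives the whole group). *)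
definition p_central_series ::
    "('a, 'b) monoid_scheme \<Rightarrow> 'a topology \<Rightarrow> nat \<Rightarrow> nat \<Rightarrow> 'a set"
  where "p_central_series G T p i = (p_central_step G T p ^^ (i - 1)) (carrier G)"


section \<open>Continuous cohomology in degrees 1 and 2\<close>

(* Inhomogeneous continuous cochains with values in a discrete abelian group A on which G acts
   trivially; A is written multiplicatively, as everywhere in HOL-Algebra. *)

definition cochains1 ::
    "('a, 'b) monoid_scheme \<Rightarrow> 'a topology \<Rightarrow> ('c, 'd) monoid_scheme \<Rightarrow> ('a \<Rightarrow> 'c) set"
  where "cochains1 G T A = {f \<in> carrier G \<rightarrow>\<^sub>E carrier A.
    continuous_map T (discrete_topology (carrier A)) f}"

definition cochains2 ::
    "('a, 'b) monoid_scheme \<Rightarrow> 'a topology \<Rightarrow> ('c, 'd) monoid_scheme \<Rightarrow> ('a \<times> 'a \<Rightarrow> 'c) set"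
  where "cochains2 G T A = {c \<in> carrier G \<times> carrier G \<rightarrow>\<^sub>E carrier A.
    continuous_map (prod_topology T T) (discrete_topology (carrier A)) c}"

definition coboundary1 ::
    "('a, 'b) monoid_scheme \<Rightarrow> ('c, 'd) monoid_scheme \<Rightarrow> ('a \<Rightarrow> 'c) \<Rightarrow> 'a \<times> 'a \<Rightarrow> 'c"
  where "coboundary1 G A f = (\<lambda>(g, h) \<in> carrier G \<times> carrier G.
    f h \<otimes>\<^bsub>A\<^esub> inv\<^bsub>A\<^esub> f (g \<otimes>\<^bsub>G\<^esub> h) \<otimes>\<^bsub>A\<^esub> f g)"

definition coboundary2 ::
    "('a, 'b) monoid_scheme \<Rightarrow> ('c, 'd) monoid_scheme \<Rightarrow> ('a \<times> 'a \<Rightarrow> 'c) \<Rightarrow> 'a \<times> 'a \<times> 'a \<Rightarrow> 'c"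
  where "coboundary2 G A c = (\<lambda>(g, h, k) \<in> carrier G \<times> carrier G \<times> carrier G.
    c (h, k) \<otimes>\<^bsub>A\<^esub> inv\<^bsub>A\<^esub> c (g \<otimes>\<^bsub>G\<^esub> h, k) \<otimes>\<^bsub>A\<^esub> c (g, h \<otimes>\<^bsub>G\<^esub> k) \<otimes>\<^bsub>A\<^esub> inv\<^bsub>A\<^esub> c (g, h))"

definition cocycles1 ::
    "('a, 'b) monoid_scheme \<Rightarrow> 'a topology \<Rightarrow> ('c, 'd) monoid_scheme \<Rightarrow> ('a \<Rightarrow> 'c) set"
  where "cocycles1 G T A =
    {f \<in> cochains1 G T A. \<forall>x \<in> carrier G \<times> carrier G. coboundary1 G A f x = \<one>\<^bsub>A\<^esub>}"

definition cocycles2 ::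
    "('a, 'b) monoid_scheme \<Rightarrow> 'a topology \<Rightarrow> ('c, 'd) monoid_scheme \<Rightarrow> ('a \<times> 'a \<Rightarrow> 'c) set"
  where "cocycles2 G T A = {c \<in> cochains2 G T A.
    \<forall>x \<in> carrier G \<times> carrier G \<times> carrier G. coboundary2 G A c x = \<one>\<^bsub>A\<^esub>}"

definition coboundaries2 ::
    "('a, 'b) monoid_scheme \<Rightarrow> 'a topology \<Rightarrow> ('c, 'd) monoid_scheme \<Rightarrow> ('a \<times> 'a \<Rightarrow> 'c) set"
  where "coboundaries2 G T A = coboundary1 G A ` cochains1 G T A"

(* The action is trivial, so the coboundary of a 0-cochain vanishes and there are no nonzero
   1-coboundaries: a class of degree 1 is the same thing as a 1-cocycle. *)
definition H1 ::
    "('a, 'b) monoid_scheme \<Rightarrow> 'a topology \<Rightarrow> ('c, 'd) monoid_scheme \<Rightarrow> ('a \<Rightarrow> 'c) monoid"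
  where "H1 G T A = (product_group (carrier G) (\<lambda>_. A)) \<lparr>carrier := cocycles1 G T A\<rparr>"

definition cocycle2_group ::
    "('a, 'b) monoid_scheme \<Rightarrow> 'a topology \<Rightarrow> ('c, 'd) monoid_scheme \<Rightarrow> ('a \<times> 'a \<Rightarrow> 'c) monoid"
  where "cocycle2_group G T A =
    (product_group (carrier G \<times> carrier G) (\<lambda>_. A)) \<lparr>carrier := cocycles2 G T A\<rparr>"

definition H2 ::
    "('a, 'b) monoid_scheme \<Rightarrow> 'a topology \<Rightarrow> ('c, 'd) monoid_scheme \<Rightarrow> ('a \<times> 'a \<Rightarrow> 'c) set monoid"
  where "H2 G T A = cocycle2_group G T A Mod coboundaries2 G T A"

definition class2 ::
    "('a, 'b) monoid_scheme \<Rightarrow> 'a topology \<Rightarrow> ('c, 'd) monoid_scheme \<Rightarrow> ('a \<times> 'a \<Rightarrow> 'c)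
      \<Rightarrow> ('a \<times> 'a \<Rightarrow> 'c) set"
  where "class2 G T A c = coboundaries2 G T A #>\<^bsub>cocycle2_group G T A\<^esub> c"


section \<open>Cup product and Bockstein map for \<open>\<int>/p\<close>\<close>

definition cup ::
    "('a, 'b) monoid_scheme \<Rightarrow> 'a topology \<Rightarrow> nat \<Rightarrow> ('a \<Rightarrow> int) \<Rightarrow> ('a \<Rightarrow> int)
      \<Rightarrow> ('a \<times> 'a \<Rightarrow> int) set"
  where "cup G T p \<psi> \<psi>' = class2 G T (integer_mod_group p)
    (\<lambda>(g, h) \<in> carrier G \<times> carrier G. (\<psi> g * \<psi>' h) mod int p)"

(* Connecting homomorphism of 0 \<rightarrow> Z/p \<rightarrow> Z/p^2 \<rightarrow> Z/p \<rightarrow> 0, the first map being multiplication by p: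
   lift \<psi> to a 1-cochain \<phi> with values in Z/p^2; its coboundary is p times a 2-cocycle c with
   values in Z/p. Such \<phi> and c exist (bockstein_exists) and the class of c does not depend on
   the choices (bockstein_eqI). *)
definition bockstein ::
    "('a, 'b) monoid_scheme \<Rightarrow> 'a topology \<Rightarrow> nat \<Rightarrow> ('a \<Rightarrow> int) \<Rightarrow> ('a \<times> 'a \<Rightarrow> int) set"
  where "bockstein G T p \<psi> = (THE x.
    \<exists>\<phi> \<in> cochains1 G T (integer_mod_group (p\<^sup>2)). \<exists>c \<in> cocycles2 G T (integer_mod_group p).
      (\<forall>g \<in> carrier G. \<phi> g mod int p = \<psi> g) \<and>
      (\<forall>x \<in> carrier G \<times> carrier G. coboundary1 G (integer_mod_group (p\<^sup>2)) \<phi> x = int p * c x) \<and>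
      x = class2 G T (integer_mod_group p) c)"


section \<open>Tensor products of abelian groups\<close>

definition tensor_relations ::
    "('a, 'c) monoid_scheme \<Rightarrow> ('b, 'd) monoid_scheme \<Rightarrow> ('a \<times> 'b \<Rightarrow>\<^sub>0 int) set"
  where "tensor_relations A B =
    {frag_of (a \<otimes>\<^bsub>A\<^esub> a', b) - frag_of (a, b) - frag_of (a', b) | a a' b.
       a \<in> carrier A \<and> a' \<in> carrier A \<and> b \<in> carrier B} \<union>
    {frag_of (a, b \<otimes>\<^bsub>B\<^esub> b') - frag_of (a, b) - frag_of (a, b') | a b b'.
       a \<in> carrier A \<and> b \<in> carrier B \<and> b' \<in> carrier B}"

abbreviation tensor_kernel ::
    "('a, 'c) monoid_scheme \<Rightarrow> ('b, 'd) monoid_scheme \<Rightarrow> ('a \<times> 'b \<Rightarrow>\<^sub>0 int) set"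
  where "tensor_kernel A B \<equiv>
    generate (free_Abelian_group (carrier A \<times> carrier B)) (tensor_relations A B)"

definition tensor_group ::
    "('a, 'c) monoid_scheme \<Rightarrow> ('b, 'd) monoid_scheme \<Rightarrow> ('a \<times> 'b \<Rightarrow>\<^sub>0 int) set monoid"
  where "tensor_group A B = free_Abelian_group (carrier A \<times> carrier B) Mod tensor_kernel A B"

definition pure_tensor ::
    "('a, 'c) monoid_scheme \<Rightarrow> ('b, 'd) monoid_scheme \<Rightarrow> 'a \<Rightarrow> 'b \<Rightarrow> ('a \<times> 'b \<Rightarrow>\<^sub>0 int) set"
  where "pure_tensor A B a b =
    tensor_kernel A B #>\<^bsub>free_Abelian_group (carrier A \<times> carrier B)\<^esub> frag_of (a, b)"

(* The homomorphism induced by a bilinear map f; it exists and is unique by tensor_lift_ex1 below. *)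
definition tensor_lift ::
    "('a, 'c) monoid_scheme \<Rightarrow> ('b, 'd) monoid_scheme \<Rightarrow> ('e, 'f) monoid_scheme
      \<Rightarrow> ('a \<Rightarrow> 'b \<Rightarrow> 'e) \<Rightarrow> ('a \<times> 'b \<Rightarrow>\<^sub>0 int) set \<Rightarrow> 'e"
  where "tensor_lift A B C f = (THE h.
    h \<in> hom (tensor_group A B) C \<and> h \<in> extensional (carrier (tensor_group A B)) \<and>
    (\<forall>a \<in> carrier A. \<forall>b \<in> carrier B. h (pure_tensor A B a b) = f a b))"


section \<open>Galois relation type\<close>

definition galois_relation_type ::
    "('a, 'b) monoid_scheme \<Rightarrow> 'a topology \<Rightarrow> nat \<Rightarrow> bool"
  where "galois_relation_type G T p \<longleftrightarrow>
    (let A = integer_mod_group p; H = H1 G T A in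
      (\<exists>S \<subseteq> {pure_tensor H H \<psi> \<psi>' | \<psi> \<psi>'. \<psi> \<in> carrier H \<and> \<psi>' \<in> carrier H}.
         kernel (tensor_group H H) (H2 G T A) (tensor_lift H H (H2 G T A) (cup G T p))
           = generate (tensor_group H H) S) \<and>
      (\<exists>\<xi> \<in> carrier H. \<forall>\<psi> \<in> carrier H.
         cup G T p \<psi> \<xi> \<otimes>\<^bsub>H2 G T A\<^esub> bockstein G T p \<psi> = \<one>\<^bsub>H2 G T A\<^esub>))"


section \<open>The group \<open>M\<^bsub>p^3\<^esub>\<close>\<close>

(* Words over generators and their formal inverses: (x, True) stands for x, (x, False) for the
   inverse of x. A pair (l, r) in R is the relation l = r. *)
inductive word_eq ::
    "(('x \<times> bool) list \<times> ('x \<times> bool) list) set \<Rightarrow> ('x \<times> bool) list \<Rightarrow> ('x \<times> bool) list \<Rightarrow> bool"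
  for R where
    word_refl: "word_eq R u u"
  | word_sym: "word_eq R u v \<Longrightarrow> word_eq R v u"
  | word_trans: "word_eq R u v \<Longrightarrow> word_eq R v w \<Longrightarrow> word_eq R u w"
  | word_cancel: "word_eq R (u @ [(x, e), (x, \<not> e)] @ v) (u @ v)"
  | word_relation: "(l, r) \<in> R \<Longrightarrow> word_eq R (u @ l @ v) (u @ r @ v)"

definition word_class ::
    "(('x \<times> bool) list \<times> ('x \<times> bool) list) set \<Rightarrow> ('x \<times> bool) list \<Rightarrow> ('x \<times> bool) list set"
  where "word_class R u = {v. word_eq R u v}"

definition presented_group ::
    "(('x \<times> bool) list \<times> ('x \<times> bool) list) set \<Rightarrow> ('x \<times> bool) list set monoid"
  where "presented_group R =
    \<lparr>carrier = range (word_class R),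
     monoid.mult = (\<lambda>X Y. \<Union>u\<in>X. \<Union>v\<in>Y. word_class R (u @ v)),
     one = word_class R []\<rparr>"

datatype gen_rs = gen_r | gen_s

definition M_p3 :: "nat \<Rightarrow> (gen_rs \<times> bool) list set monoid"
  where "M_p3 p = presented_group
    {(replicate (p\<^sup>2) (gen_r, True), []),
     (replicate p (gen_s, True), []),
     ([(gen_r, False), (gen_s, False), (gen_r, True), (gen_s, True)], replicate p (gen_r, True))}"


section \<open>Well-definedness\<close>

subsection \<open>Presented groups\<close>
lemma word_eq_append_left: "word_eq R u v \<Longrightarrow> word_eq R (w @ u) (w @ v)"
proof (induction rule: word_eq.induct)
  case (word_cancel u x e v) show ?case using word_eq.word_cancel[of R "w @ u" x e v] by simp
next
  case (word_relation l r u v) then show ?case using word_eq.word_relation[of l r R "w @ u"] by simp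
qed (rule word_refl, erule word_sym, erule (1) word_trans)

lemma word_eq_append_right: "word_eq R u v \<Longrightarrow> word_eq R (u @ w) (v @ w)"
proof (induction rule: word_eq.induct)
  case (word_cancel u x e v) show ?case using word_eq.word_cancel[of R u x e "v @ w"] by simp
next
  case (word_relation l r u v) then show ?case using word_eq.word_relation[of l r R u "v @ w"] by simp
qed (rule word_refl, erule word_sym, erule (1) word_trans)

lemma word_class_eq_iff: "word_class R u = word_class R v \<longleftrightarrow> word_eq R u v"
  unfolding word_class_def set_eq_iff mem_Collect_eq by (meson word_refl word_sym word_trans)

lemma presented_group_mult:
  "word_class R u \<otimes>\<^bsub>presented_group R\<^esub> word_class R v = word_class R (u @ v)"
proof -
  have "word_class R (u' @ v') = word_class R (u @ v)" if "u' \<in> word_class R u" "v' \<in> word_class R v" for u' v'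
  proof -
    have "word_eq R u u'" "word_eq R v v'" using that by (auto simp: word_class_def)
    then have "word_eq R (u @ v) (u' @ v')"
      by (meson word_trans word_eq_append_left word_eq_append_right)
    then show ?thesis unfolding word_class_eq_iff by (rule word_sym)
  qed
  moreover have "u \<in> word_class R u" "v \<in> word_class R v" by (simp_all add: word_class_def word_refl)
  ultimately have "(\<Union>u'\<in>word_class R u. \<Union>v'\<in>word_class R v. word_class R (u' @ v')) = word_class R (u @ v)"
    by blast
  then show ?thesis by (simp add: presented_group_def)
qed

lemma presented_group_carrier: "carrier (presented_group R) = range (word_class R)"
  by (simp add: presented_group_def)

lemma presented_group_one: "\<one>\<^bsub>presented_group R\<^esub> = word_class R []"
  by (simp add: presented_group_def)

lemma group_presented_group: "group (presented_group R)"
proof (rule groupI)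
  have inv: "word_eq R (rev (map (\<lambda>(x, e). (x, \<not> e)) u) @ u) []" for u
  proof (induction u)
    case Nil show ?case by (simp add: word_refl)
  next
    case (Cons a u)
    obtain x e where a: "a = (x, e)" by force
    have "word_eq R (rev (map (\<lambda>(x, e). (x, \<not> e)) u) @ [(x, \<not> e), (x, \<not> \<not> e)] @ u)
       (rev (map (\<lambda>(x, e). (x, \<not> e)) u) @ u)" by (rule word_cancel)
    from word_trans[OF this Cons] show ?case by (simp add: a)
  qed
  show "\<exists>y\<in>carrier (presented_group R). y \<otimes>\<^bsub>presented_group R\<^esub> x = \<one>\<^bsub>presented_group R\<^esub>"
    if x: "x \<in> carrier (presented_group R)" for x
  proof -
    obtain u where "x = word_class R u" using x unfolding presented_group_carrier by blast
    then have "word_class R (rev (map (\<lambda>(x, e). (x, \<not> e)) u)) \<otimes>\<^bsub>presented_group R\<^esub> x = word_class R []"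
      by (simp add: presented_group_mult word_class_eq_iff inv)
    then show ?thesis
      by (intro bexI[of _ "word_class R (rev (map (\<lambda>(x, e). (x, \<not> e)) u))"])
        (simp_all add: presented_group_carrier presented_group_one)
  qed
  show "x \<otimes>\<^bsub>presented_group R\<^esub> y \<in> carrier (presented_group R)"
    if x: "x \<in> carrier (presented_group R)" "y \<in> carrier (presented_group R)" for x y
  proof -
    obtain u v where "x = word_class R u" "y = word_class R v" using x unfolding presented_group_carrier by blast
    then show ?thesis by (simp add: presented_group_mult presented_group_carrier)
  qed
  show "\<one>\<^bsub>presented_group R\<^esub> \<in> carrier (presented_group R)" by (simp add: presented_group_carrier presented_group_one)
  show "\<one>\<^bsub>presented_group R\<^esub> \<otimes>\<^bsub>presented_group R\<^esub> x = x"
    if x: "x \<in> carrier (presented_group R)" for x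
  proof -
    obtain u where "x = word_class R u" using x unfolding presented_group_carrier by blast
    then have "word_class R [] \<otimes>\<^bsub>presented_group R\<^esub> x = x" by (simp add: presented_group_mult)
    then show ?thesis by (simp add: presented_group_carrier presented_group_one)
  qed
  show "x \<otimes>\<^bsub>presented_group R\<^esub> y \<otimes>\<^bsub>presented_group R\<^esub> z = x \<otimes>\<^bsub>presented_group R\<^esub> (y \<otimes>\<^bsub>presented_group R\<^esub> z)"
    if x: "x \<in> carrier (presented_group R)" "y \<in> carrier (presented_group R)" "z \<in> carrier (presented_group R)" for x y z
  proof -
    obtain u v w where "x = word_class R u" "y = word_class R v" "z = word_class R w"
      using x unfolding presented_group_carrier by blast
    then show ?thesis by (simp add: presented_group_mult)
  qed
qed

subsection \<open>Tensor products\<close>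

lemma tensor_relations_subset:
  assumes "group A" "group B"
  shows "tensor_relations A B \<subseteq> carrier (free_Abelian_group (carrier A \<times> carrier B))"
proof -
  interpret A: group A by fact
  interpret B: group B by fact
  have "x - y - z \<in> carrier (free_Abelian_group S)"
    if "x \<in> carrier (free_Abelian_group S)" "y \<in> carrier (free_Abelian_group S)" "z \<in> carrier (free_Abelian_group S)"
    for x y z :: "'a \<times> 'c \<Rightarrow>\<^sub>0 int" and S
    using that keys_diff[of "x - y" z] keys_diff[of x y] unfolding carrier_free_Abelian_group_iff by blast
  note D = this
  show ?thesis unfolding tensor_relations_def
    by (intro Un_least subsetI; elim CollectE exE conjE; hypsubst; intro D) simp_all 
qed

lemma normal_tensor_kernel:
  assumes "group A" "group B"
  shows "tensor_kernel A B \<lhd> free_Abelian_group (carrier A \<times> carrier B)"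
  by (intro comm_group.subgroup_imp_normal abelian_free_Abelian_group group.generate_is_subgroup
      group_free_Abelian_group tensor_relations_subset assms)

lemma tensor_lift_ex1:
  assumes "group A" "group B" "comm_group C"
    and f: "\<And>a b. \<lbrakk>a \<in> carrier A; b \<in> carrier B\<rbrakk> \<Longrightarrow> f a b \<in> carrier C"
    and left: "\<And>a a' b. \<lbrakk>a \<in> carrier A; a' \<in> carrier A; b \<in> carrier B\<rbrakk>
      \<Longrightarrow> f (a \<otimes>\<^bsub>A\<^esub> a') b = f a b \<otimes>\<^bsub>C\<^esub> f a' b"
    and right: "\<And>a b b'. \<lbrakk>a \<in> carrier A; b \<in> carrier B; b' \<in> carrier B\<rbrakk>
      \<Longrightarrow> f a (b \<otimes>\<^bsub>B\<^esub> b') = f a b \<otimes>\<^bsub>C\<^esub> f a b'"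
  shows "\<exists>!h. h \<in> hom (tensor_group A B) C \<and> h \<in> extensional (carrier (tensor_group A B)) \<and>
    (\<forall>a \<in> carrier A. \<forall>b \<in> carrier B. h (pure_tensor A B a b) = f a b)"
proof -
  interpret A: group A by fact
  interpret B: group B by fact
  interpret C: comm_group C by fact
  let ?S = "carrier A \<times> carrier B"
  let ?F = "free_Abelian_group ?S"
  interpret F: group ?F by simp
  interpret N: normal "tensor_kernel A B" ?F
    by (rule normal_tensor_kernel) fact+
  have T: "group (tensor_group A B)"
    unfolding tensor_group_def by (rule N.factorgroup_is_group)
  obtain h0 where h0: "h0 \<in> hom ?F C" and h0f: "\<And>x. x \<in> ?S \<Longrightarrow> h0 (frag_of x) = case_prod f x"
    by (rule C.free_Abelian_group_universal[of "case_prod f" ?S]) (use f in auto)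
  interpret h0: group_hom ?F C h0
    by unfold_locales (rule h0)
  have h0_diff: "h0 (x - y) = h0 x \<otimes>\<^bsub>C\<^esub> inv\<^bsub>C\<^esub> h0 y"
    if "x \<in> carrier ?F" "y \<in> carrier ?F" for x y
  proof -
    have "x - y = x \<otimes>\<^bsub>?F\<^esub> inv\<^bsub>?F\<^esub> y" using that by simp
    then show ?thesis using that by (simp only: h0.hom_mult h0.hom_inv F.inv_closed)
  qed
  have fr: "frag_of x - frag_of y \<in> carrier ?F" if "x \<in> ?S" "y \<in> ?S" for x y
    using that keys_diff[of "frag_of x" "frag_of y"] by auto
  have fro: "frag_of x \<in> carrier ?F" if "x \<in> ?S" for x using that by simp
  have key: "h0 (frag_of x - frag_of y - frag_of z) = \<one>\<^bsub>C\<^esub>"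
    if "x \<in> ?S" "y \<in> ?S" "z \<in> ?S" "case_prod f x = case_prod f y \<otimes>\<^bsub>C\<^esub> case_prod f z" for x y z
  proof -
    have fy: "case_prod f y \<in> carrier C" and fz: "case_prod f z \<in> carrier C" using f that by auto
    have "h0 (frag_of x - frag_of y - frag_of z)
      = case_prod f y \<otimes>\<^bsub>C\<^esub> case_prod f z \<otimes>\<^bsub>C\<^esub> inv\<^bsub>C\<^esub> case_prod f y \<otimes>\<^bsub>C\<^esub> inv\<^bsub>C\<^esub> case_prod f z"
      by (simp only: h0_diff[OF fr[OF that(1,2)] fro[OF that(3)]] h0_diff[OF fro[OF that(1)] fro[OF that(2)]]
          h0f[OF that(1)] h0f[OF that(2)] h0f[OF that(3)] that(4))
    also have "\<dots> = case_prod f z \<otimes>\<^bsub>C\<^esub> (case_prod f y \<otimes>\<^bsub>C\<^esub> inv\<^bsub>C\<^esub> case_prod f y) \<otimes>\<^bsub>C\<^esub> inv\<^bsub>C\<^esub> case_prod f z"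
      using fy fz by (simp only: C.m_ac C.inv_closed C.m_closed)
    also have "\<dots> = \<one>\<^bsub>C\<^esub>" using fy fz by (simp add: C.m_assoc)
    finally show ?thesis .
  qed
  have "h0 r = \<one>\<^bsub>C\<^esub>" if "r \<in> tensor_relations A B" for r
    using that unfolding tensor_relations_def
    by (elim UnE CollectE exE conjE; hypsubst) (rule key; simp add: left right)+
  then have "tensor_relations A B \<subseteq> kernel ?F C h0"
    using tensor_relations_subset[OF assms(1,2)] unfolding kernel_def by blast
  then have "tensor_kernel A B \<subseteq> kernel ?F C h0"
    by (intro F.generate_subgroup_incl h0.subgroup_kernel)
  from h0.FactGroup_universal_kernel[OF N.normal_axioms this]
  obtain g where g: "g \<in> hom (tensor_group A B) C" "\<And>x. x \<in> carrier ?F \<Longrightarrow> g (tensor_kernel A B #>\<^bsub>?F\<^esub> x) = h0 x"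
    unfolding tensor_group_def by blast
  show ?thesis
  proof (rule ex1I)
    let ?g = "restrict g (carrier (tensor_group A B))"
    have "pure_tensor A B a b \<in> carrier (tensor_group A B)" if "a \<in> carrier A" "b \<in> carrier B" for a b
      using that by (auto simp: pure_tensor_def tensor_group_def carrier_FactGroup)
    moreover have "g (pure_tensor A B a b) = f a b" if "a \<in> carrier A" "b \<in> carrier B" for a b
      using that by (simp add: pure_tensor_def g h0f)
    moreover have "?g \<in> hom (tensor_group A B) C"
      using g(1) T by (auto simp: hom_def group.is_monoid monoid.m_closed)
    ultimately show "?g \<in> hom (tensor_group A B) C \<and> ?g \<in> extensional (carrier (tensor_group A B)) \<and>
      (\<forall>a \<in> carrier A. \<forall>b \<in> carrier B. ?g (pure_tensor A B a b) = f a b)"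
      by simp
    fix h assume h: "h \<in> hom (tensor_group A B) C \<and> h \<in> extensional (carrier (tensor_group A B)) \<and>
      (\<forall>a \<in> carrier A. \<forall>b \<in> carrier B. h (pure_tensor A B a b) = f a b)"
    let ?\<pi> = "\<lambda>x. tensor_kernel A B #>\<^bsub>?F\<^esub> x"
    have "?\<pi> \<in> hom ?F (tensor_group A B)"
      unfolding tensor_group_def by (rule N.r_coset_hom_Mod)
    with h have "h \<circ> ?\<pi> \<in> hom ?F C" by (auto intro: hom_compose)
    then interpret h: group_hom ?F C "h \<circ> ?\<pi>"
      by unfold_locales
    have "(h \<circ> ?\<pi>) x = h0 x \<and> x \<in> carrier ?F" if "x \<in> carrier ?F" for x
      using that unfolding carrier_free_Abelian_group_iff
    proof (induction x rule: frag_induction)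
      case zero
      show ?case using h.hom_one h0.hom_one by simp
    next
      case (one x)
      then show ?case using h h0f[of x] by (auto simp: pure_tensor_def)
    next
      case (diff a b)
      then have ab: "a \<in> carrier ?F" "b \<in> carrier ?F" by auto
      have "a - b = a \<otimes>\<^bsub>?F\<^esub> inv\<^bsub>?F\<^esub> b" using ab by simp
      moreover have "a \<otimes>\<^bsub>?F\<^esub> inv\<^bsub>?F\<^esub> b \<in> carrier ?F" using ab by (intro F.m_closed F.inv_closed)
      moreover have "(h \<circ> ?\<pi>) (a \<otimes>\<^bsub>?F\<^esub> inv\<^bsub>?F\<^esub> b) = h0 (a \<otimes>\<^bsub>?F\<^esub> inv\<^bsub>?F\<^esub> b)"
        using ab diff by (simp only: h.hom_mult h.hom_inv h0.hom_mult h0.hom_inv F.inv_closed)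
      ultimately show ?case by (metis carrier_free_Abelian_group_iff)
    qed
    then show "h = ?g"
      using h by (intro extensionalityI[of _ "carrier (tensor_group A B)"])
        (auto simp: g tensor_group_def carrier_FactGroup simp del: carrier_free_Abelian_group_iff)
  qed
qed


subsection \<open>Cohomology groups\<close>

lemma (in comm_group) continuous_map_discrete_mult:
  assumes "continuous_map X (discrete_topology (carrier G)) f"
    and "continuous_map X (discrete_topology (carrier G)) g"
  shows "continuous_map X (discrete_topology (carrier G)) (\<lambda>x. f x \<otimes> g x)"
proof -
  have "continuous_map X (discrete_topology (carrier G \<times> carrier G)) (\<lambda>x. (f x, g x))"
    using assms unfolding prod_topology_discrete_topology by (simp add: continuous_map_paired)
  moreover have "continuous_map (discrete_topology (carrier G \<times> carrier G))
      (discrete_topology (carrier G)) (\<lambda>(x, y). x \<otimes> y)"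
    by (auto simp: continuous_map_from_discrete_topology)
  ultimately have "continuous_map X (discrete_topology (carrier G)) ((\<lambda>(x, y). x \<otimes> y) \<circ> (\<lambda>x. (f x, g x)))"
    by (rule continuous_map_compose)
  then show ?thesis
    by (simp add: o_def)
qed

lemma (in comm_group) continuous_map_discrete_inv:
  assumes "continuous_map X (discrete_topology (carrier G)) f"
  shows "continuous_map X (discrete_topology (carrier G)) (\<lambda>x. inv (f x))"
proof -
  have "continuous_map (discrete_topology (carrier G))
      (discrete_topology (carrier G)) (\<lambda>x. inv x)"
    by (auto simp: continuous_map_from_discrete_topology)
  from continuous_map_compose[OF assms this] show ?thesis
    by (simp add: o_def)
qed

lemma (in comm_group) cocycle_aux:
  assumes [simp]: "a \<in> carrier G" "b \<in> carrier G" "c \<in> carrier G" "d \<in> carrier G" "e \<in> carrier G" "f \<in> carrier G"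
  shows "(a \<otimes> inv b \<otimes> c) \<otimes> inv (a \<otimes> inv d \<otimes> e) \<otimes> (b \<otimes> inv d \<otimes> f) \<otimes> inv (c \<otimes> inv e \<otimes> f) = \<one>"
proof -
  have "(a \<otimes> inv b \<otimes> c) \<otimes> inv (a \<otimes> inv d \<otimes> e) \<otimes> (b \<otimes> inv d \<otimes> f) \<otimes> inv (c \<otimes> inv e \<otimes> f)
    = (a \<otimes> inv a) \<otimes> ((b \<otimes> inv b) \<otimes> ((c \<otimes> inv c) \<otimes> ((d \<otimes> inv d) \<otimes> ((e \<otimes> inv e) \<otimes> (f \<otimes> inv f)))))"
    by (simp only: assms inv_mult inv_inv m_ac m_closed inv_closed)
  then show ?thesis by simp
qed

context profinite_group begin

context
  fixes A :: "('c, 'd) monoid_scheme"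
  assumes A: "comm_group A"
begin

interpretation A: comm_group A by (rule A)

lemma cochains2_closed:
  assumes "c \<in> cochains2 G T A" "d \<in> cochains2 G T A"
  shows "(\<lambda>x\<in>carrier G \<times> carrier G. c x \<otimes>\<^bsub>A\<^esub> d x) \<in> cochains2 G T A"
  using assms A.continuous_map_discrete_mult[of "prod_topology T T" c d]
  by (auto simp: cochains2_def topspace_eq Pi_iff intro: continuous_map_eq)

lemma cochains2_inv:
  assumes "c \<in> cochains2 G T A"
  shows "(\<lambda>x\<in>carrier G \<times> carrier G. inv\<^bsub>A\<^esub> c x) \<in> cochains2 G T A"
  using assms A.continuous_map_discrete_inv[of "prod_topology T T" c]
  by (auto simp: cochains2_def topspace_eq Pi_iff intro: continuous_map_eq)

lemma cochains1_closed:
  assumes "c \<in> cochains1 G T A" "d \<in> cochains1 G T A"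
  shows "(\<lambda>x\<in>carrier G. c x \<otimes>\<^bsub>A\<^esub> d x) \<in> cochains1 G T A"
  using assms A.continuous_map_discrete_mult[of T c d]
  by (auto simp: cochains1_def topspace_eq Pi_iff intro: continuous_map_eq)

lemma cochains1_inv:
  assumes "c \<in> cochains1 G T A"
  shows "(\<lambda>x\<in>carrier G. inv\<^bsub>A\<^esub> c x) \<in> cochains1 G T A"
  using assms A.continuous_map_discrete_inv[of T c]
  by (auto simp: cochains1_def topspace_eq Pi_iff intro: continuous_map_eq)

lemma cochains1_const: "(\<lambda>x\<in>carrier G. \<one>\<^bsub>A\<^esub>) \<in> cochains1 G T A"
  by (auto simp: cochains1_def) (rule continuous_map_eq[where f="\<lambda>_. \<one>\<^bsub>A\<^esub>"], auto simp: topspace_eq)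

lemma cochains2_const: "(\<lambda>x\<in>carrier G \<times> carrier G. \<one>\<^bsub>A\<^esub>) \<in> cochains2 G T A"
  by (auto simp: cochains2_def) (rule continuous_map_eq[where f="\<lambda>_. \<one>\<^bsub>A\<^esub>"], auto simp: topspace_eq)

lemma coboundary1_cochain:
  assumes "f \<in> cochains1 G T A"
  shows "coboundary1 G A f \<in> cochains2 G T A"
proof -
  have f: "continuous_map T (discrete_topology (carrier A)) f" and fc: "\<And>x. x \<in> carrier G \<Longrightarrow> f x \<in> carrier A"
    using assms by (auto simp: cochains1_def)
  have 1: "continuous_map (prod_topology T T) (discrete_topology (carrier A)) (\<lambda>x. f (fst x))"
    "continuous_map (prod_topology T T) (discrete_topology (carrier A)) (\<lambda>x. f (snd x))"
    "continuous_map (prod_topology T T) (discrete_topology (carrier A)) (\<lambda>x. f ((\<lambda>(x, y). x \<otimes> y) x))"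
    using continuous_map_compose[OF continuous_map_fst f] continuous_map_compose[OF continuous_map_snd f]
      continuous_map_compose[OF continuous_mult f] by (auto simp: o_def)
  have "continuous_map (prod_topology T T) (discrete_topology (carrier A))
     (\<lambda>x. f (snd x) \<otimes>\<^bsub>A\<^esub> inv\<^bsub>A\<^esub> f ((\<lambda>(x, y). x \<otimes> y) x) \<otimes>\<^bsub>A\<^esub> f (fst x))"
    by (intro A.continuous_map_discrete_mult A.continuous_map_discrete_inv 1)
  then have "continuous_map (prod_topology T T) (discrete_topology (carrier A)) (coboundary1 G A f)"
    by (rule continuous_map_eq) (auto simp: topspace_eq coboundary1_def)
  then show ?thesis using fc
    by (auto simp: cochains2_def coboundary1_def)
qed

lemma coboundaries2_subset: "coboundaries2 G T A \<subseteq> cocycles2 G T A"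
proof -
  have "coboundary2 G A (coboundary1 G A f) (g, h, k) = \<one>\<^bsub>A\<^esub>"
    if f: "f \<in> cochains1 G T A" and "g \<in> carrier G" "h \<in> carrier G" "k \<in> carrier G" for f g h k
  proof -
    have "\<And>x. x \<in> carrier G \<Longrightarrow> f x \<in> carrier A"
      using f by (auto simp: cochains1_def)
    with that show ?thesis
      by (simp add: coboundary2_def coboundary1_def m_assoc A.cocycle_aux)
  qed
  then show ?thesis
    using coboundary1_cochain by (auto simp: coboundaries2_def cocycles2_def)
qed

lemma cochains2_in: "c \<in> cochains2 G T A \<Longrightarrow> g \<in> carrier G \<Longrightarrow> h \<in> carrier G \<Longrightarrow> c (g, h) \<in> carrier A"
  by (auto simp: cochains2_def)

lemma cochains1_in: "c \<in> cochains1 G T A \<Longrightarrow> g \<in> carrier G \<Longrightarrow> c g \<in> carrier A"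
  by (auto simp: cochains1_def)

lemma product_group_G2: "group (product_group (carrier G \<times> carrier G) (\<lambda>_. A))"
  by (rule product_group) simp

lemma subgroup_cocycles2:
  "subgroup (cocycles2 G T A) (product_group (carrier G \<times> carrier G) (\<lambda>_. A))"
proof (rule group.subgroupI[OF product_group_G2])
  show "cocycles2 G T A \<subseteq> carrier (product_group (carrier G \<times> carrier G) (\<lambda>_. A))"
    by (auto simp: cocycles2_def cochains2_def)
  show "cocycles2 G T A \<noteq> {}"
    using coboundaries2_subset cochains1_const by (auto simp: coboundaries2_def)
next
  fix c assume c: "c \<in> cocycles2 G T A"
  then have c': "c \<in> cochains2 G T A" by (simp add: cocycles2_def)
  have "coboundary2 G A (\<lambda>x\<in>carrier G \<times> carrier G. inv\<^bsub>A\<^esub> c x) (g, h, k) = inv\<^bsub>A\<^esub> coboundary2 G A c (g, h, k)"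
    if "g \<in> carrier G" "h \<in> carrier G" "k \<in> carrier G" for g h k
    using that by (simp add: coboundary2_def cochains2_in[OF c'] A.inv_mult A.m_ac)
  then have "(\<lambda>x\<in>carrier G \<times> carrier G. inv\<^bsub>A\<^esub> c x) \<in> cocycles2 G T A"
    using c cochains2_inv[OF c'] by (auto simp: cocycles2_def)
  moreover have "inv\<^bsub>product_group (carrier G \<times> carrier G) (\<lambda>_. A)\<^esub> c = (\<lambda>x\<in>carrier G \<times> carrier G. inv\<^bsub>A\<^esub> c x)"
    using c' by (intro inv_product_group) (auto simp: cochains2_def)
  ultimately show "inv\<^bsub>product_group (carrier G \<times> carrier G) (\<lambda>_. A)\<^esub> c \<in> cocycles2 G T A" by simp
next
  fix c d assume c: "c \<in> cocycles2 G T A" and d: "d \<in> cocycles2 G T A"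
  then have c': "c \<in> cochains2 G T A" and d': "d \<in> cochains2 G T A" by (auto simp: cocycles2_def)
  have "coboundary2 G A (\<lambda>x\<in>carrier G \<times> carrier G. c x \<otimes>\<^bsub>A\<^esub> d x) (g, h, k) = coboundary2 G A c (g, h, k) \<otimes>\<^bsub>A\<^esub> coboundary2 G A d (g, h, k)"
    if "g \<in> carrier G" "h \<in> carrier G" "k \<in> carrier G" for g h k
    using that by (simp add: coboundary2_def cochains2_in[OF c'] cochains2_in[OF d'] A.inv_mult A.m_ac)
  then show "c \<otimes>\<^bsub>product_group (carrier G \<times> carrier G) (\<lambda>_. A)\<^esub> d \<in> cocycles2 G T A"
    using c d cochains2_closed[OF c' d'] by (auto simp: cocycles2_def)
qed

lemma comm_group_cocycle2_group: "comm_group (cocycle2_group G T A)"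
proof (rule group.group_comm_groupI)
  show "group (cocycle2_group G T A)"
    unfolding cocycle2_group_def
    by (rule group.subgroup_imp_group[OF product_group_G2 subgroup_cocycles2])
  show "x \<otimes>\<^bsub>cocycle2_group G T A\<^esub> y = y \<otimes>\<^bsub>cocycle2_group G T A\<^esub> x"
    if "x \<in> carrier (cocycle2_group G T A)" "y \<in> carrier (cocycle2_group G T A)" for x y
    using that by (auto simp: cocycle2_group_def cocycles2_def cochains2_in intro!: restrict_ext A.m_comm)
qed

lemma coboundary1_mult:
  assumes "f \<in> cochains1 G T A" "f' \<in> cochains1 G T A"
  shows "coboundary1 G A (\<lambda>x\<in>carrier G. f x \<otimes>\<^bsub>A\<^esub> f' x)
    = coboundary1 G A f \<otimes>\<^bsub>cocycle2_group G T A\<^esub> coboundary1 G A f'"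
  by (auto simp: cocycle2_group_def coboundary1_def cochains1_in[OF assms(1)] cochains1_in[OF assms(2)] A.inv_mult A.m_ac)

lemma coboundary1_inv:
  assumes "f \<in> cochains1 G T A"
  shows "coboundary1 G A (\<lambda>x\<in>carrier G. inv\<^bsub>A\<^esub> f x) = inv\<^bsub>cocycle2_group G T A\<^esub> coboundary1 G A f"
proof -
  have "inv\<^bsub>cocycle2_group G T A\<^esub> coboundary1 G A f = inv\<^bsub>product_group (carrier G \<times> carrier G) (\<lambda>_. A)\<^esub> coboundary1 G A f"
    unfolding cocycle2_group_def using coboundaries2_subset assms
    by (intro group.m_inv_consistent[OF product_group_G2 subgroup_cocycles2]) (auto simp: coboundaries2_def)
  also have "\<dots> = (\<lambda>x\<in>carrier G \<times> carrier G. inv\<^bsub>A\<^esub> coboundary1 G A f x)"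
    using coboundary1_cochain[OF assms] by (intro inv_product_group) (auto simp: cochains2_def)
  finally show ?thesis
    by (auto simp: coboundary1_def cochains1_in[OF assms] A.inv_mult A.m_ac)
qed

lemma subgroup_coboundaries2: "subgroup (coboundaries2 G T A) (cocycle2_group G T A)"
proof (rule group.subgroupI)
  show "group (cocycle2_group G T A)" using comm_group_cocycle2_group by (simp add: comm_group_def)
  show "coboundaries2 G T A \<subseteq> carrier (cocycle2_group G T A)"
    using coboundaries2_subset by (simp add: cocycle2_group_def)
  show "coboundaries2 G T A \<noteq> {}" using cochains1_const by (auto simp: coboundaries2_def)
qed (auto simp: coboundaries2_def simp flip: coboundary1_inv coboundary1_mult
      intro!: imageI cochains1_inv cochains1_closed)

lemma normal_coboundaries2: "coboundaries2 G T A \<lhd> cocycle2_group G T A"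
  using comm_group.subgroup_imp_normal[OF comm_group_cocycle2_group subgroup_coboundaries2] .

lemma comm_group_H2: "comm_group (H2 G T A)"
  unfolding H2_def
  using comm_group.abelian_FactGroup[OF comm_group_cocycle2_group subgroup_coboundaries2] .

lemma group_H1: "group (H1 G T A)"
  unfolding H1_def
proof (rule group.subgroup_imp_group)
  show G: "group (product_group (carrier G) (\<lambda>_. A))" by (rule product_group) simp
  show "subgroup (cocycles1 G T A) (product_group (carrier G) (\<lambda>_. A))"
  proof (rule group.subgroupI[OF G])
    show "cocycles1 G T A \<subseteq> carrier (product_group (carrier G) (\<lambda>_. A))"
      by (auto simp: cocycles1_def cochains1_def)
    show "cocycles1 G T A \<noteq> {}"
      using cochains1_const by (auto simp: cocycles1_def coboundary1_def intro!: exI[of _ "\<lambda>x\<in>carrier G. \<one>\<^bsub>A\<^esub>"])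
  next
    fix c assume c: "c \<in> cocycles1 G T A"
    then have c': "c \<in> cochains1 G T A" by (simp add: cocycles1_def)
    have "coboundary1 G A (\<lambda>x\<in>carrier G. inv\<^bsub>A\<^esub> c x) (g, h) = inv\<^bsub>A\<^esub> coboundary1 G A c (g, h)"
      if "g \<in> carrier G" "h \<in> carrier G" for g h
      using that by (simp add: coboundary1_def cochains1_in[OF c'] A.inv_mult A.m_ac)
    then have "(\<lambda>x\<in>carrier G. inv\<^bsub>A\<^esub> c x) \<in> cocycles1 G T A"
      using c cochains1_inv[OF c'] by (auto simp: cocycles1_def)
    moreover have "inv\<^bsub>product_group (carrier G) (\<lambda>_. A)\<^esub> c = (\<lambda>x\<in>carrier G. inv\<^bsub>A\<^esub> c x)"
      using c' by (intro inv_product_group) (auto simp: cochains1_def)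
    ultimately show "inv\<^bsub>product_group (carrier G) (\<lambda>_. A)\<^esub> c \<in> cocycles1 G T A" by simp
  next
    fix c d assume c: "c \<in> cocycles1 G T A" and d: "d \<in> cocycles1 G T A"
    then have c': "c \<in> cochains1 G T A" and d': "d \<in> cochains1 G T A" by (auto simp: cocycles1_def)
    have "coboundary1 G A (\<lambda>x\<in>carrier G. c x \<otimes>\<^bsub>A\<^esub> d x) (g, h) = coboundary1 G A c (g, h) \<otimes>\<^bsub>A\<^esub> coboundary1 G A d (g, h)"
      if "g \<in> carrier G" "h \<in> carrier G" for g h
      using that by (simp add: coboundary1_def cochains1_in[OF c'] cochains1_in[OF d'] A.inv_mult A.m_ac)
    then show "c \<otimes>\<^bsub>product_group (carrier G) (\<lambda>_. A)\<^esub> d \<in> cocycles1 G T A"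
      using c d cochains1_closed[OF c' d'] by (auto simp: cocycles1_def)
  qed
qed

end
end


subsection \<open>Bockstein map and cup product\<close>

context profinite_group begin

lemma mod_aux: "(a + (- b) mod n + c) mod n = (a - b + c) mod (n::int)"
  by (metis add_uminus_conv_diff mod_add_left_eq mod_add_right_eq)

lemma mod_aux3: "(a mod n - b mod n + c mod n) mod n = (a - b + c) mod (n::int)"
proof -
  have "(a mod n - b mod n + c mod n) mod n = (((a mod n - b mod n) mod n) + c) mod n"
    by (simp only: mod_add_right_eq mod_add_left_eq)
  then show ?thesis by (simp only: mod_diff_eq mod_add_left_eq)
qed

lemma mod_aux2: "(a + (- b) mod n + c - d) mod n = (a - b + c - d) mod (n::int)"
  using mod_aux[of a b n "c - d"] by (simp only: add_diff_eq)

lemma coboundary1_mod: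
  assumes "0 < n" "f \<in> cochains1 G T (integer_mod_group n)" "g \<in> carrier G" "h \<in> carrier G"
  shows "coboundary1 G (integer_mod_group n) f (g, h) = (f h - f (g \<otimes> h) + f g) mod int n"
proof -
  have "f (g \<otimes> h) \<in> carrier (integer_mod_group n)" using assms by (auto simp: cochains1_def)
  with assms show ?thesis
    by (simp add: coboundary1_def mod_simps mod_aux)
qed

lemma coboundary2_mod:
  assumes "0 < n" "c \<in> cochains2 G T (integer_mod_group n)" "g \<in> carrier G" "h \<in> carrier G" "k \<in> carrier G"
  shows "coboundary2 G (integer_mod_group n) c (g, h, k) =
    (c (h, k) - c (g \<otimes> h, k) + c (g, h \<otimes> k) - c (g, h)) mod int n"
proof -
  have "c (g \<otimes> h, k) \<in> carrier (integer_mod_group n)" "c (g, h) \<in> carrier (integer_mod_group n)"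
    using assms by (auto simp: cochains2_def)
  with assms show ?thesis
    by (simp add: coboundary2_def mod_simps mod_aux2)
qed

lemma continuous_map_discrete_post:
  assumes "continuous_map X (discrete_topology U) f" "\<And>x. x \<in> U \<Longrightarrow> k x \<in> V"
  shows "continuous_map X (discrete_topology V) (\<lambda>x. k (f x))"
proof -
  have "continuous_map (discrete_topology U) (discrete_topology V) k"
    using assms by (auto simp: continuous_map_from_discrete_topology)
  from continuous_map_compose[OF assms(1) this] show ?thesis by (simp add: o_def)
qed

lemma mod_imgI: "0 < n \<Longrightarrow> x mod int n \<in> carrier (integer_mod_group n)"
  by (simp add: carrier_integer_mod_group)

lemma bockstein_exists:
  assumes p: "0 < p" and \<psi>: "\<psi> \<in> cocycles1 G T (integer_mod_group p)"
  shows "\<exists>\<phi> \<in> cochains1 G T (integer_mod_group (p\<^sup>2)). \<exists>c \<in> cocycles2 G T (integer_mod_group p).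
      (\<forall>g \<in> carrier G. \<phi> g mod int p = \<psi> g) \<and>
      (\<forall>x \<in> carrier G \<times> carrier G. coboundary1 G (integer_mod_group (p\<^sup>2)) \<phi> x = int p * c x)"
proof -
  let ?Z = "integer_mod_group p" and ?Y = "integer_mod_group (p\<^sup>2)"
  have \<psi>': "\<psi> \<in> cochains1 G T ?Z" using \<psi> by (simp add: cocycles1_def)
  have r: "0 \<le> \<psi> g \<and> \<psi> g < int p" if "g \<in> carrier G" for g
    using \<psi>' that p by (fastforce simp: cochains1_def carrier_integer_mod_group PiE_iff)
  have le: "int p \<le> (int p)\<^sup>2" using p by (simp add: power2_eq_square)
  have \<phi>: "\<psi> \<in> cochains1 G T ?Y"
  proof -
    have sub: "x \<in> carrier ?Y" if "x \<in> carrier ?Z" for x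
      using that p order_less_le_trans[OF _ le, of x] by (simp add: carrier_integer_mod_group)
    show ?thesis
      using \<psi>' sub continuous_map_discrete_post[of T "carrier ?Z" \<psi> "\<lambda>x. x" "carrier ?Y"]
      unfolding cochains1_def PiE_iff by blast
  qed
  define d where "d = coboundary1 G ?Y \<psi>"
  have d: "d \<in> cochains2 G T ?Y"
    unfolding d_def by (rule coboundary1_cochain[OF _ \<phi>]) simp
  have dd: "d \<in> cocycles2 G T ?Y"
    using coboundaries2_subset[of ?Y] \<phi> by (auto simp: d_def coboundaries2_def)
  have dvd: "int p dvd d (g, h)" if "g \<in> carrier G" "h \<in> carrier G" for g h
  proof -
    have "(\<psi> h - \<psi> (g \<otimes> h) + \<psi> g) mod int p = 0"
      using \<psi> that coboundary1_mod[OF p \<psi>' that] by (auto simp: cocycles1_def)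
    then have "int p dvd (\<psi> h - \<psi> (g \<otimes> h) + \<psi> g) mod int (p\<^sup>2)"
      by (subst dvd_mod_iff) (auto simp: power2_eq_square mod_eq_0_iff_dvd)
    then show ?thesis using coboundary1_mod[OF _ \<phi> that] p by (simp add: d_def)
  qed
  define c where "c = (\<lambda>x\<in>carrier G \<times> carrier G. d x div int p)"
  have cd: "int p * c (g, h) = d (g, h)" if "g \<in> carrier G" "h \<in> carrier G" for g h
    using dvd[OF that] that by (simp add: c_def)
  have dr: "x div int p \<in> carrier ?Z" if "x \<in> carrier ?Y" for x
  proof -
    have x: "0 \<le> x" "x < int p * int p" using that p by (auto simp: carrier_integer_mod_group power2_eq_square)
    have "x div int p < int p"
    proof (rule ccontr)
      assume "\<not> x div int p < int p"
      then have "int p * int p \<le> int p * (x div int p)" by (simp add: mult_left_mono)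
      also have "\<dots> \<le> x" using mult_div_mod_eq[of "int p" x] pos_mod_sign[of "int p" x] p by linarith
      finally show False using x by simp
    qed
    then show ?thesis using x p by (simp add: carrier_integer_mod_group pos_imp_zdiv_nonneg_iff)
  qed
  have c: "c \<in> cochains2 G T ?Z"
  proof -
    have "continuous_map (prod_topology T T) (discrete_topology (carrier ?Z)) (\<lambda>x. d x div int p)"
      using d dr by (intro continuous_map_discrete_post[of _ "carrier ?Y" d "\<lambda>x. x div int p" "carrier ?Z"]) (simp_all add: cochains2_def)
    then have "continuous_map (prod_topology T T) (discrete_topology (carrier ?Z)) c"
      by (rule continuous_map_eq) (auto simp: c_def topspace_eq)
    then show ?thesis using d dr by (auto simp: cochains2_def c_def PiE_iff)
  qed
  have "coboundary2 G ?Z c (g, h, k) = 0" if g: "g \<in> carrier G" "h \<in> carrier G" "k \<in> carrier G" for g h k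
  proof -
    have "int (p\<^sup>2) dvd d (h, k) - d (g \<otimes> h, k) + d (g, h \<otimes> k) - d (g, h)"
      using dd coboundary2_mod[OF _ d g] g p by (auto simp: cocycles2_def mod_eq_0_iff_dvd)
    also have "d (h, k) - d (g \<otimes> h, k) + d (g, h \<otimes> k) - d (g, h) =
        int p * (c (h, k) - c (g \<otimes> h, k) + c (g, h \<otimes> k) - c (g, h))"
      using g by (simp add: cd algebra_simps)
    finally have "int p dvd c (h, k) - c (g \<otimes> h, k) + c (g, h \<otimes> k) - c (g, h)"
      using p by (simp add: power2_eq_square)
    then show ?thesis using coboundary2_mod[OF p c g] by (simp add: mod_eq_0_iff_dvd)
  qed
  then have cZ: "c \<in> cocycles2 G T ?Z" using c by (simp add: cocycles2_def split_paired_all)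
  have 1: "\<forall>g \<in> carrier G. \<psi> g mod int p = \<psi> g" using r by simp
  have 2: "\<forall>x \<in> carrier G \<times> carrier G. coboundary1 G ?Y \<psi> x = int p * c x"
    using cd unfolding d_def by (simp add: split_paired_all)
  show ?thesis
    by (rule bexI[of _ \<psi>], rule bexI[of _ c], rule conjI[OF 1 2], rule cZ, rule \<phi>)
qed

lemma bockstein_unique:
  assumes p: "0 < p"
    and \<phi>: "\<phi> \<in> cochains1 G T (integer_mod_group (p\<^sup>2))" "c \<in> cocycles2 G T (integer_mod_group p)"
      "\<And>g. g \<in> carrier G \<Longrightarrow> \<phi> g mod int p = \<psi> g"
      "\<And>x. x \<in> carrier G \<times> carrier G \<Longrightarrow> coboundary1 G (integer_mod_group (p\<^sup>2)) \<phi> x = int p * c x"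
    and \<phi>': "\<phi>' \<in> cochains1 G T (integer_mod_group (p\<^sup>2))" "c' \<in> cocycles2 G T (integer_mod_group p)"
      "\<And>g. g \<in> carrier G \<Longrightarrow> \<phi>' g mod int p = \<psi> g"
      "\<And>x. x \<in> carrier G \<times> carrier G \<Longrightarrow> coboundary1 G (integer_mod_group (p\<^sup>2)) \<phi>' x = int p * c' x"
  shows "class2 G T (integer_mod_group p) c = class2 G T (integer_mod_group p) c'"
proof -
  let ?Z = "integer_mod_group p" and ?Y = "integer_mod_group (p\<^sup>2)"
  have Z: "comm_group ?Z" by simp
  let ?C = "cocycle2_group G T ?Z"
  interpret C: comm_group ?C by (rule comm_group_cocycle2_group[OF Z])
  define e where "e = (\<lambda>g\<in>carrier G. ((\<phi> g - \<phi>' g) div int p) mod int p)"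
  have e: "e \<in> cochains1 G T ?Z"
  proof -
    have "continuous_map T (discrete_topology (carrier ?Y \<times> carrier ?Y)) (\<lambda>g. (\<phi> g, \<phi>' g))"
      using \<phi>(1) \<phi>'(1) unfolding prod_topology_discrete_topology
      by (simp add: continuous_map_paired cochains1_def)
    then have "continuous_map T (discrete_topology (carrier ?Z)) (\<lambda>g. (\<lambda>(x, y). ((x - y) div int p) mod int p) (\<phi> g, \<phi>' g))"
      by (rule continuous_map_discrete_post) (use p in \<open>auto intro: mod_imgI\<close>)
    then have "continuous_map T (discrete_topology (carrier ?Z)) e"
      by (rule continuous_map_eq) (auto simp: e_def topspace_eq)
    then show ?thesis using p by (auto simp: cochains1_def e_def mod_imgI)
  qed
  have dvd: "int p * ((\<phi> g - \<phi>' g) div int p) = \<phi> g - \<phi>' g" if "g \<in> carrier G" for g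
    using \<phi>(3)[OF that] \<phi>'(3)[OF that] mod_eq_dvd_iff[of "\<phi> g" "int p" "\<phi>' g"] by simp
  have cc: "c = coboundary1 G ?Z e \<otimes>\<^bsub>?C\<^esub> c'"
  proof (rule extensionalityI)
    show "c \<in> extensional (carrier G \<times> carrier G)" using \<phi>(2) by (auto simp: cocycles2_def cochains2_def PiE_def)
    show "coboundary1 G ?Z e \<otimes>\<^bsub>?C\<^esub> c' \<in> extensional (carrier G \<times> carrier G)" by (simp add: cocycle2_group_def)
    fix x assume x: "x \<in> carrier G \<times> carrier G"
    then obtain g h where gh: "x = (g, h)" "g \<in> carrier G" "h \<in> carrier G" by auto
    let ?E = "\<lambda>g. (\<phi> g - \<phi>' g) div int p"
    have "(int p * c x - int p * c' x) mod int (p\<^sup>2) = (int p * (?E h - ?E (g \<otimes> h) + ?E g)) mod int (p\<^sup>2)"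
    proof -
      have "(int p * c x - int p * c' x) mod int (p\<^sup>2)
        = ((\<phi> h - \<phi> (g \<otimes> h) + \<phi> g) - (\<phi>' h - \<phi>' (g \<otimes> h) + \<phi>' g)) mod int (p\<^sup>2)"
        using gh p \<phi>(4)[OF x] \<phi>'(4)[OF x] coboundary1_mod[OF _ \<phi>(1) gh(2,3)] coboundary1_mod[OF _ \<phi>'(1) gh(2,3)]
        by (metis mod_diff_eq pos2 zero_less_power)
      also have "(\<phi> h - \<phi> (g \<otimes> h) + \<phi> g) - (\<phi>' h - \<phi>' (g \<otimes> h) + \<phi>' g)
          = int p * (?E h - ?E (g \<otimes> h) + ?E g)"
        using gh by (simp only: distrib_left right_diff_distrib dvd m_closed)
      finally show ?thesis .
    qed
    then have "int p * int p dvd int p * ((c x - c' x) - (?E h - ?E (g \<otimes> h) + ?E g))"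
      by (simp add: mod_eq_dvd_iff power2_eq_square algebra_simps)
    then have *: "(c x - c' x) mod int p = (?E h - ?E (g \<otimes> h) + ?E g) mod int p"
      using p by (simp add: mod_eq_dvd_iff)
    have "coboundary1 G ?Z e x = (?E h - ?E (g \<otimes> h) + ?E g) mod int p"
      unfolding gh(1) coboundary1_mod[OF p e gh(2,3)] using gh
      by (simp add: e_def mod_aux3)
    then have "(coboundary1 G ?Z e \<otimes>\<^bsub>?C\<^esub> c') x = ((c x - c' x) mod int p + c' x) mod int p"
      using gh * by (simp add: cocycle2_group_def)
    also have "\<dots> = c x mod int p" by (simp add: mod_simps)
    also have "\<dots> = c x"
      using \<phi>(2) gh p by (fastforce simp: cocycles2_def cochains2_def carrier_integer_mod_group PiE_iff)
    finally show "c x = (coboundary1 G ?Z e \<otimes>\<^bsub>?C\<^esub> c') x" by simp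
  qed
  have "c \<in> class2 G T ?Z c'"
    unfolding class2_def r_coset_def coboundaries2_def using cc e by blast
  from C.repr_independence[OF this[unfolded class2_def] _ subgroup_coboundaries2[OF Z]]
  show ?thesis
    unfolding class2_def using \<phi>'(2) by (simp add: cocycle2_group_def)
qed

lemma cup_cocycle:
  assumes p: "0 < p" and \<psi>: "\<psi> \<in> cocycles1 G T (integer_mod_group p)" "\<psi>' \<in> cocycles1 G T (integer_mod_group p)"
  shows "(\<lambda>(g, h) \<in> carrier G \<times> carrier G. (\<psi> g * \<psi>' h) mod int p) \<in> cocycles2 G T (integer_mod_group p)"
    (is "?c \<in> _")
proof -
  let ?Z = "integer_mod_group p"
  have \<psi>1: "\<psi> \<in> cochains1 G T ?Z" "\<psi>' \<in> cochains1 G T ?Z" using \<psi> by (auto simp: cocycles1_def)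
  have c: "?c \<in> cochains2 G T ?Z"
  proof -
    have "continuous_map (prod_topology T T) (discrete_topology (carrier ?Z)) (\<lambda>x. \<psi> (fst x))"
      "continuous_map (prod_topology T T) (discrete_topology (carrier ?Z)) (\<lambda>x. \<psi>' (snd x))"
      using \<psi>1 continuous_map_compose[OF continuous_map_fst, of T _ \<psi> T]
        continuous_map_compose[OF continuous_map_snd, of T _ \<psi>' T] by (auto simp: o_def cochains1_def)
    then have "continuous_map (prod_topology T T) (discrete_topology (carrier ?Z \<times> carrier ?Z)) (\<lambda>x. (\<psi> (fst x), \<psi>' (snd x)))"
      unfolding prod_topology_discrete_topology by (simp add: continuous_map_paired)
    then have "continuous_map (prod_topology T T) (discrete_topology (carrier ?Z)) (\<lambda>x. (\<lambda>(a, b). a * b mod int p) (\<psi> (fst x), \<psi>' (snd x)))"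
      by (rule continuous_map_discrete_post) (use p in \<open>auto intro: mod_imgI\<close>)
    then have "continuous_map (prod_topology T T) (discrete_topology (carrier ?Z)) ?c"
      by (rule continuous_map_eq) (auto simp: topspace_eq)
    then show ?thesis using p by (auto simp: cochains2_def mod_imgI)
  qed
  have "coboundary2 G ?Z ?c (g, h, k) = 0" if g: "g \<in> carrier G" "h \<in> carrier G" "k \<in> carrier G" for g h k
  proof -
    have "[\<psi> (g \<otimes> h) = \<psi> g + \<psi> h] (mod int p)" if "g \<in> carrier G" "h \<in> carrier G" and \<psi>: "\<psi> \<in> cocycles1 G T ?Z" for g h \<psi>
    proof -
      have "(\<psi> h - \<psi> (g \<otimes> h) + \<psi> g) mod int p = 0"
        using that coboundary1_mod[OF p, of \<psi> g h] by (auto simp: cocycles1_def)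
      then have "int p dvd - (\<psi> h - \<psi> (g \<otimes> h) + \<psi> g)" by (simp only: mod_eq_0_iff_dvd dvd_minus_iff)
      then show ?thesis by (simp add: cong_iff_dvd_diff algebra_simps)
    qed
    then have "[\<psi> h * \<psi>' k - \<psi> (g \<otimes> h) * \<psi>' k + \<psi> g * \<psi>' (h \<otimes> k) - \<psi> g * \<psi>' h =
        \<psi> h * \<psi>' k - (\<psi> g + \<psi> h) * \<psi>' k + \<psi> g * (\<psi>' h + \<psi>' k) - \<psi> g * \<psi>' h] (mod int p)"
      using g \<psi> by (intro cong_add cong_diff cong_mult cong_refl) auto
    also have "\<psi> h * \<psi>' k - (\<psi> g + \<psi> h) * \<psi>' k + \<psi> g * (\<psi>' h + \<psi>' k) - \<psi> g * \<psi>' h = 0"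
      by (simp add: algebra_simps)
    finally have *: "(\<psi> h * \<psi>' k - \<psi> (g \<otimes> h) * \<psi>' k + \<psi> g * \<psi>' (h \<otimes> k) - \<psi> g * \<psi>' h) mod int p = 0"
      by (simp add: cong_def)
    have "(x mod int p - y mod int p + z mod int p - w mod int p) mod int p = (x - y + z - w) mod int p" for x y z w :: int
    proof -
      have "(x mod int p - y mod int p + z mod int p - w mod int p) mod int p
          = ((x mod int p - y mod int p + z mod int p) mod int p - w mod int p) mod int p"
        by (simp only: mod_diff_left_eq)
      then show ?thesis by (simp only: mod_aux3 mod_diff_eq)
    qed
    with * show ?thesis using g by (simp add: coboundary2_mod[OF p c g])
  qed
  with c show ?thesis by (auto simp: cocycles2_def)
qed

lemma cup_bilinear:
  assumes p: "0 < p"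
    and \<psi>: "\<psi>1 \<in> cocycles1 G T (integer_mod_group p)" "\<psi>2 \<in> cocycles1 G T (integer_mod_group p)" "\<psi>3 \<in> cocycles1 G T (integer_mod_group p)"
  shows "cup G T p (\<psi>1 \<otimes>\<^bsub>H1 G T (integer_mod_group p)\<^esub> \<psi>2) \<psi>3
      = cup G T p \<psi>1 \<psi>3 \<otimes>\<^bsub>H2 G T (integer_mod_group p)\<^esub> cup G T p \<psi>2 \<psi>3"
    and "cup G T p \<psi>3 (\<psi>1 \<otimes>\<^bsub>H1 G T (integer_mod_group p)\<^esub> \<psi>2)
      = cup G T p \<psi>3 \<psi>1 \<otimes>\<^bsub>H2 G T (integer_mod_group p)\<^esub> cup G T p \<psi>3 \<psi>2"
    and "cup G T p \<psi>1 \<psi>2 \<in> carrier (H2 G T (integer_mod_group p))"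
proof -
  let ?Z = "integer_mod_group p"
  have Z: "comm_group ?Z" by simp
  interpret N: normal "coboundaries2 G T ?Z" "cocycle2_group G T ?Z"
    by (rule normal_coboundaries2[OF Z])
  have car: "carrier (cocycle2_group G T ?Z) = cocycles2 G T ?Z" by (simp add: cocycle2_group_def)
  show "cup G T p (\<psi>1 \<otimes>\<^bsub>H1 G T ?Z\<^esub> \<psi>2) \<psi>3 = cup G T p \<psi>1 \<psi>3 \<otimes>\<^bsub>H2 G T ?Z\<^esub> cup G T p \<psi>2 \<psi>3"
    unfolding cup_def class2_def H2_def mult_FactGroup
    by (subst N.rcos_sum) (use \<psi> p in \<open>auto simp: car cup_cocycle cocycle2_group_def H1_def mod_simps distrib_right
        intro!: arg_cong[where f="r_coset _ _"]\<close>)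
  show "cup G T p \<psi>3 (\<psi>1 \<otimes>\<^bsub>H1 G T ?Z\<^esub> \<psi>2) = cup G T p \<psi>3 \<psi>1 \<otimes>\<^bsub>H2 G T ?Z\<^esub> cup G T p \<psi>3 \<psi>2"
    unfolding cup_def class2_def H2_def mult_FactGroup
    by (subst N.rcos_sum) (use \<psi> p in \<open>auto simp: car cup_cocycle cocycle2_group_def H1_def mod_simps distrib_left
        intro!: arg_cong[where f="r_coset _ _"]\<close>)
  show "cup G T p \<psi>1 \<psi>2 \<in> carrier (H2 G T ?Z)"
    using \<psi> p by (auto simp: cup_def class2_def H2_def carrier_FactGroup car cup_cocycle)
qed


lemma bockstein_eqI:
  assumes "0 < p" "\<phi> \<in> cochains1 G T (integer_mod_group (p\<^sup>2))" "c \<in> cocycles2 G T (integer_mod_group p)"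
    "\<And>g. g \<in> carrier G \<Longrightarrow> \<phi> g mod int p = \<psi> g"
    "\<And>x. x \<in> carrier G \<times> carrier G \<Longrightarrow> coboundary1 G (integer_mod_group (p\<^sup>2)) \<phi> x = int p * c x"
  shows "bockstein G T p \<psi> = class2 G T (integer_mod_group p) c"
  unfolding bockstein_def
proof (rule the_equality)
  show "\<exists>\<phi> \<in> cochains1 G T (integer_mod_group (p\<^sup>2)). \<exists>c' \<in> cocycles2 G T (integer_mod_group p).
      (\<forall>g \<in> carrier G. \<phi> g mod int p = \<psi> g) \<and>
      (\<forall>x \<in> carrier G \<times> carrier G. coboundary1 G (integer_mod_group (p\<^sup>2)) \<phi> x = int p * c' x) \<and>
      class2 G T (integer_mod_group p) c = class2 G T (integer_mod_group p) c'"
    by (rule bexI[of _ \<phi>], rule bexI[of _ c], intro conjI ballI refl) (use assms in auto)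
  fix x assume "\<exists>\<phi> \<in> cochains1 G T (integer_mod_group (p\<^sup>2)). \<exists>c' \<in> cocycles2 G T (integer_mod_group p).
      (\<forall>g \<in> carrier G. \<phi> g mod int p = \<psi> g) \<and>
      (\<forall>x \<in> carrier G \<times> carrier G. coboundary1 G (integer_mod_group (p\<^sup>2)) \<phi> x = int p * c' x) \<and>
      x = class2 G T (integer_mod_group p) c'"
  then obtain \<phi>' c' where "\<phi>' \<in> cochains1 G T (integer_mod_group (p\<^sup>2))" "c' \<in> cocycles2 G T (integer_mod_group p)"
    "\<And>g. g \<in> carrier G \<Longrightarrow> \<phi>' g mod int p = \<psi> g"
    "\<And>x. x \<in> carrier G \<times> carrier G \<Longrightarrow> coboundary1 G (integer_mod_group (p\<^sup>2)) \<phi>' x = int p * c' x"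
    "x = class2 G T (integer_mod_group p) c'"
    by auto
  then show "x = class2 G T (integer_mod_group p) c"
    using bockstein_unique[OF assms(1) _ _ _ _ assms(2-5), of \<phi>' c'] by simp
qed

lemma cup_tensor_lift_ex1:
  assumes "0 < p"
  shows "\<exists>!h. h \<in> hom (tensor_group (H1 G T (integer_mod_group p)) (H1 G T (integer_mod_group p)))
        (H2 G T (integer_mod_group p)) \<and>
      h \<in> extensional (carrier (tensor_group (H1 G T (integer_mod_group p)) (H1 G T (integer_mod_group p)))) \<and>
      (\<forall>\<psi> \<in> carrier (H1 G T (integer_mod_group p)). \<forall>\<psi>' \<in> carrier (H1 G T (integer_mod_group p)).
         h (pure_tensor (H1 G T (integer_mod_group p)) (H1 G T (integer_mod_group p)) \<psi> \<psi>') = cup G T p \<psi> \<psi>')"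
proof -
  have Z: "comm_group (integer_mod_group p)" by simp
  have C: "carrier (H1 G T (integer_mod_group p)) = cocycles1 G T (integer_mod_group p)"
    by (simp add: H1_def)
  show ?thesis
    by (rule tensor_lift_ex1[OF group_H1[OF Z] group_H1[OF Z] comm_group_H2[OF Z]])
      (simp_all only: C cup_bilinear[OF assms])
qed

end

end

theory Submission
  imports Defs "HOL-Algebra.SndIsomorphismGrp"
begin

text \<open>
  Write \<open>E\<close> for \<open>M\<^bsub>p^3\<^esub>\<close>, realised as the semidirect product \<open>\<int>/p\<^sup>2 \<rtimes> \<int>/p\<close>. A homomorphism \<open>G \<rightarrow> E\<close>
  is a pair \<open>(F, \<eta>)\<close> of a character \<open>\<eta>\<close> modulo \<open>p\<close> and a map \<open>F\<close> with
  \<open>F(gh) = F(g) + F(h) + p F(g) \<eta>(h)\<close> modulo \<open>p\<^sup>2\<close>. Modulo \<open>p\<close> such an \<open>F\<close> is a character \<open>\<psi>\<close>, and \<open>\<psi>\<close> has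
  such a lift exactly when \<open>\<beta>(\<psi>) + \<psi> \<union> \<eta> = 0\<close> (\<open>twisted_hom_of_bockstein\<close>). If \<open>\<psi> \<noteq> 0\<close>, the pair
  yields a normal subgroup with quotient \<open>E\<close> or \<open>\<int>/p\<^sup>2\<close> on which \<open>F\<close> vanishes modulo \<open>p\<^sup>2\<close>, according
  to whether \<open>\<psi>\<close> and \<open>\<eta>\<close> are independent (\<open>twisted_hom_quotient\<close>).

  All groups in the list embed in \<open>E\<close>, whose third term of the descending \<open>p\<close>-central series is
  trivial; this gives one inclusion. For the other let \<open>\<sigma>\<close> lie in all the subgroups \<open>N\<close>. The second
  condition of Galois relation type supplies \<open>\<xi>\<close> such that every \<open>\<psi>\<close> lifts to some \<open>F\<close> for \<open>(\<psi>, \<xi>)\<close>;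
  so \<open>F(\<sigma>) = 0\<close>, and all characters of order \<open>p\<close> vanish at \<open>\<sigma>\<close>. If \<open>\<psi> \<union> \<psi>' = 0\<close> is the coboundary of
  \<open>f\<close>, then both \<open>F\<close> and \<open>F - p f\<close> are lifts of \<open>\<psi>\<close>, for \<open>\<xi>\<close> and for \<open>\<xi> + \<psi>'\<close>; so \<open>f(\<sigma>) = 0\<close>
  (\<open>cup_trivialization_vanishes\<close>). By the first condition the same holds for every sum of products of
  characters that is a coboundary (\<open>trivialization_vanishes_at\<close>).

  Suppose \<open>\<sigma>\<close> were not in \<open>G\<^bsup>(3)\<^esup>\<close>. Some finite quotient \<open>Q\<close> then maps \<open>\<sigma>\<close> to a nontrivial element of a
  central subgroup of exponent \<open>p\<close> that contains all \<open>p\<close>-th powers and commutators. As \<open>p\<close> is odd,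
  the product of \<open>Q\<close> can be twisted by square roots of commutators into a commutative one (Baer), and
  a character of the resulting abelian group with \<open>F(\<sigma>) = p\<close> satisfies
  \<open>F(xy) = F(x) + F(y) + p b(x, y)\<close> with \<open>b\<close> bilinear (\<open>exists_bilinear_deviation\<close>). A bilinear \<open>b\<close>
  is a sum of products of characters. Subtracting from \<open>F\<close> the lift \<open>F\<^sub>1\<close> of the same character for
  \<open>\<xi>\<close> leaves \<open>p f\<close>, where the coboundary of \<open>f\<close> is a sum of products of characters, but
  \<open>f(\<sigma>) = \<plusminus>1\<close>: a contradiction (\<open>central_quotient_kernel\<close>).
\<close>


section \<open>Open subgroups of profinite groups\<close>

context profinite_group
begin

lemma continuous_translate_right:
  assumes "x \<in> carrier G"
  shows "continuous_map T T (\<lambda>g. g \<otimes> x)"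
proof -
  have "continuous_map T (prod_topology T T) (\<lambda>g. (g, x))"
    using assms by (simp add: continuous_map_pairedI topspace_eq)
  from continuous_map_compose[OF this continuous_mult] show ?thesis by (simp add: o_def)
qed

lemma openin_r_coset:
  assumes "openin T N" "x \<in> carrier G"
  shows "openin T (N #> x)"
proof -
  have N: "N \<subseteq> carrier G" using openin_subset[OF assms(1)] by (simp add: topspace_eq)
  have "N #> x = {g \<in> topspace T. g \<otimes> inv x \<in> N}"
  proof (intro equalityI subsetI)
    fix g assume "g \<in> N #> x"
    then obtain n where "n \<in> N" "g = n \<otimes> x" by (auto simp: r_coset_def)
    then show "g \<in> {g \<in> topspace T. g \<otimes> inv x \<in> N}"
      using N assms(2) by (auto simp: topspace_eq m_assoc)
  next
    fix g assume g: "g \<in> {g \<in> topspace T. g \<otimes> inv x \<in> N}"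
    then have "g = (g \<otimes> inv x) \<otimes> x" using assms(2) by (simp add: topspace_eq m_assoc)
    with g show "g \<in> N #> x" unfolding r_coset_def by blast
  qed
  moreover have "openin T {g \<in> topspace T. g \<otimes> inv x \<in> N}"
    using continuous_translate_right[of "inv x"] assms openin_continuous_map_preimage by blast
  ultimately show ?thesis by simp
qed

lemma continuous_map_constant_on_cosets:
  assumes N: "subgroup N G" "openin T N"
    and f: "\<And>n g. n \<in> N \<Longrightarrow> g \<in> carrier G \<Longrightarrow> f (n \<otimes> g) = f g"
  shows "continuous_map T (discrete_topology UNIV) f"
proof -
  have "openin T {x \<in> topspace T. f x \<in> U}" for U
  proof (subst openin_subopen, intro ballI)
    fix x assume x: "x \<in> {x \<in> topspace T. f x \<in> U}"
    then have xG: "x \<in> carrier G" by (simp add: topspace_eq)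
    have "N #> x \<subseteq> {x \<in> topspace T. f x \<in> U}"
      using x xG f subgroup.subset[OF N(1)] by (auto simp: r_coset_def topspace_eq)
    moreover have "x \<in> N #> x" using xG N(1) by (simp add: rcos_self)
    ultimately show "\<exists>S. openin T S \<and> x \<in> S \<and> S \<subseteq> {x \<in> topspace T. f x \<in> U}"
      using openin_r_coset[OF N(2) xG] by blast
  qed
  then show ?thesis by (simp add: continuous_map_def)
qed

lemma open_subgroup_closedin:
  assumes "subgroup N G" "openin T N"
  shows "closedin T N"
proof -
  have N: "N \<subseteq> carrier G" using assms(1) by (rule subgroup.subset)
  have "(n \<otimes> g \<in> N) = (g \<in> N)" if "n \<in> N" "g \<in> carrier G" for n g
  proof
    assume "n \<otimes> g \<in> N"
    moreover have "g = inv n \<otimes> (n \<otimes> g)" using that N by (simp add: subset_iff flip: m_assoc)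
    ultimately show "g \<in> N" using that assms(1) by (metis subgroup.m_closed subgroup.m_inv_closed)
  qed (use that assms(1) in \<open>simp add: subgroup.m_closed\<close>)
  then have "continuous_map T (discrete_topology UNIV) (\<lambda>g. g \<in> N)"
    by (intro continuous_map_constant_on_cosets[OF assms])
  from closedin_continuous_map_preimage[OF this, of "{True}"]
  have "closedin T {g \<in> topspace T. g \<in> N}" by simp
  moreover have "{g \<in> topspace T. g \<in> N} = N" using N by (auto simp: topspace_eq)
  ultimately show ?thesis by simp
qed

lemma open_subgroup_finite_index:
  assumes "subgroup N G" "openin T N"
  shows "finite (rcosets N)"
proof -
  have "topspace T \<subseteq> \<Union> (rcosets N)"
    using rcosets_part_G[OF assms(1)] by (simp add: topspace_eq)
  moreover have "openin T U" if "U \<in> rcosets N" for U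
    using that openin_r_coset[OF assms(2)] by (auto simp: RCOSETS_def)
  ultimately obtain F where F: "finite F" "F \<subseteq> rcosets N" "topspace T \<subseteq> \<Union>F"
    using compact unfolding compact_space_alt by meson
  have "rcosets N \<subseteq> F"
  proof
    fix U assume U: "U \<in> rcosets N"
    then obtain x where x: "x \<in> carrier G" "U = N #> x" by (auto simp: RCOSETS_def)
    then obtain V where V: "V \<in> F" "x \<in> V" using F(3) by (auto simp: topspace_eq)
    then have "V = U"
      using rcos_disjoint[OF assms(1)] U F(2) rcos_self[OF x(1) assms(1)] x(2)
      unfolding pairwise_def disjnt_def by blast
    with V show "U \<in> F" by simp
  qed
  with F(1) show ?thesis by (rule finite_subset[rotated])
qed

text \<open>
  In a compact totally disconnected space a closed set and a point are separated by a clopen set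
  \<open>C\<close>. The elements that can be inserted into any product without changing its membership in \<open>C\<close> form
  a normal subgroup, and it is open because its complement is the projection of a closed set along a compact factor.
\<close>

lemma open_normal_separation:
  assumes K: "closedin T K" and \<sigma>: "\<sigma> \<in> carrier G" "\<sigma> \<notin> K"
  obtains V where "V \<lhd> G" "openin T V" "\<And>k v. k \<in> K \<Longrightarrow> v \<in> V \<Longrightarrow> k \<otimes> v \<noteq> \<sigma>"
proof -
  have KG: "K \<subseteq> carrier G" using closedin_subset[OF K] by (simp add: topspace_eq)
  have "separated_between T {x} {\<sigma>}" if "x \<in> K" for x
  proof -
    have "quasi_component_of T x = connected_component_of T x"
      using compact Hausdorff by (intro quasi_eq_connected_component_of) auto
    moreover have "\<not> connected_component_of T x \<sigma>"
      using that \<sigma>(2) totally_disconnected unfolding connected_component_of_def by metis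
    ultimately show ?thesis
      using that KG \<sigma>(1) by (auto simp: separated_between_singletons topspace_eq)
  qed
  moreover have "compactin T K" using closedin_compact_space[OF compact K] .
  ultimately have "separated_between T K {\<sigma>}"
    using KG \<sigma>(1) by (simp add: separated_between_pointwise_left topspace_eq)
  then obtain C where C: "openin T C" "closedin T C" "K \<subseteq> C" "\<sigma> \<notin> C"
    unfolding separated_between by (auto simp: disjnt_def)
  define V where "V = {g \<in> carrier G. \<forall>x\<in>carrier G. \<forall>y\<in>carrier G. x \<otimes> g \<otimes> y \<in> C \<longleftrightarrow> x \<otimes> y \<in> C}"
  have one: "\<one> \<in> V" by (simp add: V_def)
  have mult: "a \<otimes> b \<in> V" if "a \<in> V" "b \<in> V" for a b
  proof -
    have "x \<otimes> (a \<otimes> b) \<otimes> y \<in> C \<longleftrightarrow> x \<otimes> y \<in> C" if "x \<in> carrier G" "y \<in> carrier G" for x y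
    proof -
      have "x \<otimes> (a \<otimes> b) \<otimes> y = x \<otimes> a \<otimes> (b \<otimes> y)"
        using that \<open>a \<in> V\<close> \<open>b \<in> V\<close> by (simp add: V_def m_assoc)
      also have "\<dots> \<in> C \<longleftrightarrow> x \<otimes> (b \<otimes> y) \<in> C" using that \<open>a \<in> V\<close> \<open>b \<in> V\<close> by (simp add: V_def)
      also have "x \<otimes> (b \<otimes> y) = x \<otimes> b \<otimes> y" using that \<open>b \<in> V\<close> by (simp add: V_def m_assoc)
      finally show ?thesis using that \<open>b \<in> V\<close> by (simp add: V_def)
    qed
    then show ?thesis using that by (simp add: V_def)
  qed
  have inve: "inv a \<in> V" if "a \<in> V" for a
  proof -
    have "x \<otimes> inv a \<otimes> y \<in> C \<longleftrightarrow> x \<otimes> y \<in> C" if "x \<in> carrier G" "y \<in> carrier G" for x y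
    proof -
      have "x \<otimes> inv a \<otimes> y \<in> C \<longleftrightarrow> x \<otimes> inv a \<otimes> a \<otimes> y \<in> C"
        using that \<open>a \<in> V\<close> by (simp add: V_def)
      also have "x \<otimes> inv a \<otimes> a \<otimes> y = x \<otimes> y" using that \<open>a \<in> V\<close> by (simp add: V_def m_assoc)
      finally show ?thesis .
    qed
    then show ?thesis using that by (simp add: V_def)
  qed
  have sub: "subgroup V G"
    by (rule subgroup.intro) (use one mult inve in \<open>auto simp: V_def\<close>)
  have normal: "V \<lhd> G"
    unfolding normal_inv_iff
  proof (intro conjI ballI sub)
    fix a g assume a: "a \<in> carrier G" and g: "g \<in> V"
    have "x \<otimes> (a \<otimes> g \<otimes> inv a) \<otimes> y \<in> C \<longleftrightarrow> x \<otimes> y \<in> C" if "x \<in> carrier G" "y \<in> carrier G" for x y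
    proof -
      have "x \<otimes> (a \<otimes> g \<otimes> inv a) \<otimes> y = (x \<otimes> a) \<otimes> g \<otimes> (inv a \<otimes> y)"
        using that a g by (simp add: V_def m_assoc)
      also have "\<dots> \<in> C \<longleftrightarrow> (x \<otimes> a) \<otimes> (inv a \<otimes> y) \<in> C" using that a g by (simp add: V_def)
      also have "(x \<otimes> a) \<otimes> (inv a \<otimes> y) = x \<otimes> (a \<otimes> inv a) \<otimes> y"
        using that a by (simp only: m_assoc m_closed inv_closed)
      finally show ?thesis using that a by simp
    qed
    then show "a \<otimes> g \<otimes> inv a \<in> V" using a g by (simp add: V_def)
  qed
  have "openin T V"
  proof -
    let ?P = "prod_topology (prod_topology T T) T"
    let ?f = "\<lambda>q. fst (fst q) \<otimes> snd q \<otimes> snd (fst q)" and ?g = "\<lambda>q. fst (fst q) \<otimes> snd (fst q)"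
    have c1: "continuous_map ?P T (\<lambda>q. fst (fst q))" "continuous_map ?P T (\<lambda>q. snd (fst q))"
      "continuous_map ?P T (\<lambda>q. snd q)"
      by (auto intro: continuous_map_fst_of continuous_map_snd_of simp: continuous_map_snd continuous_map_of_fst continuous_map_of_snd
          intro!: continuous_map_compose[OF continuous_map_fst continuous_map_fst, unfolded o_def]
           continuous_map_compose[OF continuous_map_fst continuous_map_snd, unfolded o_def])
    have mc: "continuous_map ?P T (\<lambda>q. u q \<otimes> v q)" if "continuous_map ?P T u" "continuous_map ?P T v" for u v
      using continuous_map_compose[OF continuous_map_pairedI[OF that] continuous_mult] by (simp add: o_def)
    have f: "continuous_map ?P T ?f" and g: "continuous_map ?P T ?g"
      by (intro mc c1)+
    have clopen: "closedin ?P {q \<in> topspace ?P. u q \<in> C}" "openin ?P {q \<in> topspace ?P. u q \<in> C}"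
      if "continuous_map ?P T u" for u
      using that C closedin_continuous_map_preimage openin_continuous_map_preimage by blast+
    let ?W = "{q \<in> topspace ?P. (?f q \<in> C) \<noteq> (?g q \<in> C)}"
    have "?W = ({q \<in> topspace ?P. ?f q \<in> C} - {q \<in> topspace ?P. ?g q \<in> C}) \<union>
        ({q \<in> topspace ?P. ?g q \<in> C} - {q \<in> topspace ?P. ?f q \<in> C})" by blast
    also have "closedin ?P \<dots>"
      by (intro closedin_Un closedin_diff clopen f g)
    finally have "closedin ?P ?W" .
    moreover have "closed_map ?P T snd"
      by (rule closed_map_snd) (simp add: compact_space_prod_topology compact)
    ultimately have "closedin T (snd ` ?W)"
      unfolding closed_map_def by blast
    also have "snd ` ?W = topspace T - V"
    proof (intro equalityI subsetI)
      fix v assume "v \<in> topspace T - V"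
      then obtain x y where "x \<in> carrier G" "y \<in> carrier G" "v \<in> carrier G"
        "(x \<otimes> v \<otimes> y \<in> C) \<noteq> (x \<otimes> y \<in> C)"
        unfolding V_def topspace_eq by blast
      then have "((x, y), v) \<in> ?W" by (simp add: topspace_eq)
      then show "v \<in> snd ` ?W" by (rule rev_image_eqI) simp
    next
      fix v assume "v \<in> snd ` ?W"
      then obtain x y where "x \<in> carrier G" "y \<in> carrier G" "v \<in> carrier G"
        "(x \<otimes> v \<otimes> y \<in> C) \<noteq> (x \<otimes> y \<in> C)"
        unfolding topspace_prod_topology topspace_eq by fastforce
      then show "v \<in> topspace T - V" unfolding V_def topspace_eq by blast
    qed
    finally show ?thesis
      using sub by (simp add: openin_closedin_eq topspace_eq subgroup.subset)
  qed
  moreover have "k \<otimes> v \<noteq> \<sigma>" if "k \<in> K" "v \<in> V" for k v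
  proof -
    have "k \<otimes> v \<otimes> \<one> \<in> C \<longleftrightarrow> k \<otimes> \<one> \<in> C" using that KG unfolding V_def by blast
    moreover have "k \<in> carrier G" "v \<in> carrier G" "k \<in> C" using that KG C(3) by (auto simp: V_def)
    ultimately have "k \<otimes> v \<in> C" by simp
    then show ?thesis using C(4) by auto
  qed
  ultimately show thesis using that normal by blast
qed

end


section \<open>Characters of finite abelian groups of exponent dividing \<open>p\<^sup>2\<close>\<close>

context group
begin

lemma int_pow_pow_coprime:
  fixes i :: int
  assumes "x \<in> carrier G" "coprime i (int n)" "x [^] n = \<one>"
  obtains j :: int where "(x [^] i) [^] j = x"
proof -
  obtain j k where "i * j + int n * k = 1"
    using assms(2) by (metis coprime_iff_gcd_eq_1 bezout_int mult.commute)
  then have ij: "i * j = 1 - int n * k" by linarith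
  have "(x [^] i) [^] j = x [^] (1 - int n * k)"
    using assms(1) by (simp add: int_pow_pow ij)
  also have "\<dots> = x \<otimes> inv ((x [^] n) [^] k)"
    using assms(1) by (simp add: int_pow_diff int_pow_pow int_pow_int flip: int_pow_int)
  also have "\<dots> = x" using assms by simp
  finally show thesis by (rule that)
qed

end

definition mod_hom :: "('a, 'b) monoid_scheme \<Rightarrow> nat \<Rightarrow> ('a \<Rightarrow> int) \<Rightarrow> bool"
  where "mod_hom G n f \<longleftrightarrow>
    (\<forall>x\<in>carrier G. \<forall>y\<in>carrier G. [f (x \<otimes>\<^bsub>G\<^esub> y) = f x + f y] (mod int n))"

lemma (in comm_group) adjoin_element_subgroup:
  assumes M: "subgroup M G" and x: "x \<in> carrier G"
  shows "subgroup {m \<otimes> x [^] i | m i. m \<in> M \<and> i \<in> (UNIV :: int set)} G"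
proof -
  have "subgroup (M <#> generate G {x}) G"
    using M x by (intro mult_subgroups generate_is_subgroup) auto
  also have "M <#> generate G {x} = {m \<otimes> x [^] i | m i. m \<in> M \<and> i \<in> (UNIV :: int set)}"
    using x by (auto simp: generate_pow set_mult_def)
  finally show ?thesis .
qed

text \<open>
  The assignment \<open>z \<mapsto> p\<close> extends to the whole group because \<open>\<int>/p\<^sup>2\<close> is injective among
  abelian groups of exponent dividing \<open>p\<^sup>2\<close>. Concretely, the quotient by a subgroup \<open>M\<close> that is maximal among those avoiding \<open>z\<close>
  is cyclic, and the character is read off from exponents of a generator.
\<close>

lemma (in comm_group) exists_mod_hom_nontrivial_at:
  assumes fin: "finite (carrier G)" and p: "Factorial_Ring.prime p"
    and exp: "\<And>x. x \<in> carrier G \<Longrightarrow> x [^] p\<^sup>2 = \<one>"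
    and z: "z \<in> carrier G" "z \<noteq> \<one>" "z [^] p = \<one>"
  obtains f where "mod_hom G (p\<^sup>2) f" "[f z = int p] (mod int (p\<^sup>2))"
proof -
  define \<M> where "\<M> = {M. subgroup M G \<and> z \<notin> M}"
  have "{\<one>} \<in> \<M>" using z by (simp add: \<M>_def triv_subgroup)
  moreover have "finite \<M>"
    by (rule finite_subset[of _ "Pow (carrier G)"]) (use fin in \<open>auto simp: \<M>_def dest: subgroup.subset\<close>)
  ultimately obtain M where M: "M \<in> \<M>" "\<And>M'. M' \<in> \<M> \<Longrightarrow> M \<subseteq> M' \<Longrightarrow> M' = M"
    using finite_has_maximal[of \<M>] by blast
  have sM: "subgroup M G" and zM: "z \<notin> M" using M by (auto simp: \<M>_def)
  interpret M: subgroup M G by (rule sM)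
  have pi: "Factorial_Ring.prime (int p)" using p by simp
  have coprimeI: "coprime i (int p)" if "\<not> int p dvd i" for i
    using prime_imp_coprime[OF pi that] by (simp add: coprime_commute)
  have zi: "int p dvd i" if "z [^] i \<in> M" for i :: int
  proof (rule ccontr)
    assume "\<not> int p dvd i"
    then have "coprime i (int p)" by (rule coprimeI)
    then obtain j :: int where "(z [^] i) [^] j = z" using int_pow_pow_coprime[OF z(1) _ z(3)] by blast
    then show False using that zM subgroup_int_pow_closed[OF sM that, of j] by simp
  qed
  have adjoin: "\<exists>m\<in>M. \<exists>i::int. z = m \<otimes> x [^] i" if x: "x \<in> carrier G" "x \<notin> M" for x
  proof (rule ccontr)
    assume no: "\<not> ?thesis"
    let ?A = "{m \<otimes> x [^] i | m i. m \<in> M \<and> i \<in> (UNIV :: int set)}"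
    have "subgroup ?A G" by (rule adjoin_element_subgroup[OF sM x(1)])
    then have "?A \<in> \<M>" using no by (auto simp: \<M>_def)
    moreover have "m = m \<otimes> x [^] (0::int)" if "m \<in> M" for m using that by simp
    then have "M \<subseteq> ?A" by blast
    moreover have "x = \<one> \<otimes> x [^] (1::int)" using x by simp
    then have "x \<in> ?A" using M.one_closed by blast
    ultimately show False using M(2) x(2) by blast
  qed
  \<comment> \<open>Modulo \<open>M\<close> the powers of \<open>z\<close> are the only elements of order dividing \<open>p\<close>.\<close>
  have torsion: "\<exists>m\<in>M. \<exists>i::int. x = m \<otimes> z [^] i" if x: "x \<in> carrier G" "x [^] p \<in> M" for x
  proof (cases "x \<in> M")
    case True
    then have "x = x \<otimes> z [^] (0::int)" using x by simp
    with True show ?thesis by blast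
  next
    case False
    then obtain m i where m: "m \<in> M" "z = m \<otimes> x [^] (i::int)" using adjoin x(1) by blast
    have "coprime i (int p)"
    proof (rule ccontr)
      assume "\<not> coprime i (int p)"
      then have "int p dvd i" using coprimeI by blast
      then obtain l where "i = int p * l" by blast
      then have "x [^] i = (x [^] p) [^] l" using x by (simp add: int_pow_pow flip: int_pow_int)
      then have "m \<otimes> x [^] i \<in> M" using m(1) subgroup_int_pow_closed[OF sM x(2)] by simp
      then show False using zM by (simp flip: m(2))
    qed
    then obtain j k where "i * j + int p * k = 1"
      by (metis coprime_iff_gcd_eq_1 bezout_int mult.commute)
    then have jk: "i * j = 1 - int p * k" by linarith
    have xi: "x [^] i = inv m \<otimes> z"
      by (rule iffD2[OF inv_solve_left m(2)]) (use m(1) x z in simp_all)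
    have "x = x [^] (1 - int p * k) \<otimes> x [^] (int p * k)"
      using x by (simp flip: int_pow_mult)
    also have "\<dots> = (x [^] i) [^] j \<otimes> (x [^] p) [^] k"
      using x by (simp add: int_pow_pow jk flip: int_pow_int)
    also have "\<dots> = (inv m [^] j \<otimes> (x [^] p) [^] k) \<otimes> z [^] j"
      using m(1) x z by (simp add: xi int_pow_distrib m_ac)
    finally have "x = (inv m [^] j \<otimes> (x [^] p) [^] k) \<otimes> z [^] j" .
    moreover have "inv m [^] j \<otimes> (x [^] p) [^] k \<in> M"
      using m(1) x sM by (intro M.m_closed subgroup_int_pow_closed) auto
    ultimately show ?thesis by blast
  qed
  \<comment> \<open>Hence \<open>G/M\<close> is cyclic, of order \<open>p\<close> or \<open>p\<^sup>2\<close>: a generator \<open>w\<close> is \<open>z\<close> or, modulo \<open>M\<close>, a \<open>p\<close>-th root of \<open>z\<close>.\<close>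
  obtain w c where w: "w \<in> carrier G" "\<And>x. x \<in> carrier G \<Longrightarrow> \<exists>m\<in>M. \<exists>i::int. x = m \<otimes> w [^] i"
    and ker: "\<And>i::int. w [^] i \<in> M \<Longrightarrow> int (p\<^sup>2) dvd i * c"
    and wz: "\<And>m i. m \<in> M \<Longrightarrow> z = m \<otimes> w [^] (i::int) \<Longrightarrow> [i * c = int p] (mod int (p\<^sup>2))"
  proof (cases "\<forall>x\<in>carrier G. x [^] p \<in> M")
    case True
    show thesis
    proof (rule that[of z "int p"])
      show "\<exists>m\<in>M. \<exists>i::int. x = m \<otimes> z [^] i" if "x \<in> carrier G" for x using torsion True that by blast
      show *: "int (p\<^sup>2) dvd i * int p" if "z [^] i \<in> M" for i
        using zi[OF that] by (simp add: power2_eq_square)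
      show "[i * int p = int p] (mod int (p\<^sup>2))" if "m \<in> M" "z = m \<otimes> z [^] (i::int)" for m i
      proof -
        have "z [^] i = inv m \<otimes> z"
          by (rule iffD2[OF inv_solve_left that(2)]) (use that(1) z in simp_all)
        then have "z [^] (i - 1) = inv m" using that(1) z by (simp add: int_pow_diff m_assoc)
        then have "z [^] (i - 1) \<in> M" using that(1) by simp
        from *[OF this] show ?thesis by (simp add: cong_iff_dvd_diff algebra_simps)
      qed
    qed (rule z)
  next
    case False
    then obtain x where x: "x \<in> carrier G" "x [^] p \<notin> M" by blast
    have p2: "(y [^] p) [^] p = \<one>" if "y \<in> carrier G" for y
      using exp[OF that] that by (simp add: nat_pow_pow power2_eq_square)
    obtain m i where m: "m \<in> M" "z = m \<otimes> (x [^] p) [^] (i::int)" using adjoin x by blast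
    define w where "w = x [^] i"
    have w: "w \<in> carrier G" using x by (simp add: w_def)
    have "(x [^] p) [^] i = w [^] p" using x by (simp add: w_def int_pow_pow mult.commute flip: int_pow_int)
    with m(2) have zw: "z = m \<otimes> w [^] p" by (simp only:)
    have ker: "int (p\<^sup>2) dvd j" if "w [^] j \<in> M" for j :: int
    proof -
      have zpow: "z [^] l = m [^] l \<otimes> w [^] (int p * l)" for l :: int
        using m(1) w by (subst zw) (simp add: int_pow_distrib int_pow_pow flip: int_pow_int)
      have "z [^] j = m [^] j \<otimes> (w [^] j) [^] (int p)"
        using w by (simp add: zpow int_pow_pow mult.commute)
      also have "\<dots> \<in> M"
        by (rule M.m_closed[OF subgroup_int_pow_closed[OF sM m(1)] subgroup_int_pow_closed[OF sM that]])
      finally obtain l where l: "j = int p * l" using zi by fastforce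
      have "z [^] l \<in> M" using m(1) that l by (simp add: zpow subgroup_int_pow_closed[OF sM])
      with zi have "int p dvd l" by blast
      then show ?thesis using l by (simp add: power2_eq_square)
    qed
    show thesis
    proof (rule that[of w 1])
      show "w \<in> carrier G" by (rule w)
      show "\<exists>m\<in>M. \<exists>i::int. y = m \<otimes> w [^] i" if y: "y \<in> carrier G" for y
      proof -
        obtain m1 i1 where m1: "m1 \<in> M" "y [^] p = m1 \<otimes> z [^] (i1::int)"
          using torsion[of "y [^] p"] p2[OF y] y by auto
        let ?u = "y \<otimes> w [^] (- i1)"
        have "?u [^] p = y [^] p \<otimes> (w [^] p) [^] (- i1)"
          using y w by (simp add: int_pow_distrib int_pow_pow mult.commute flip: int_pow_int)
        also have "\<dots> = m1 \<otimes> (m \<otimes> w [^] p) [^] i1 \<otimes> (w [^] p) [^] (- i1)" by (simp only: m1(2) flip: zw)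
        also have "\<dots> = m1 \<otimes> m [^] i1 \<otimes> ((w [^] p) [^] i1 \<otimes> (w [^] p) [^] (- i1))"
          using m1(1) m(1) w by (simp add: int_pow_distrib m_assoc)
        also have "(w [^] p) [^] i1 \<otimes> (w [^] p) [^] (- i1) = \<one>"
          using w by (simp flip: int_pow_mult)
        finally have "?u [^] p \<in> M" using m1(1) m(1) by (simp add: subgroup_int_pow_closed[OF sM])
        then obtain m2 i2 where m2: "m2 \<in> M" "?u = m2 \<otimes> z [^] (i2::int)"
          using torsion[of ?u] y w by auto
        have "y = ?u \<otimes> w [^] i1"
          using y w by (simp add: m_assoc flip: int_pow_mult)
        also have "\<dots> = m2 \<otimes> (m \<otimes> w [^] p) [^] i2 \<otimes> w [^] i1" by (simp only: m2(2) flip: zw)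
        also have "\<dots> = m2 \<otimes> (m [^] i2 \<otimes> w [^] (int p * i2)) \<otimes> w [^] i1"
          using m(1) w m2(1) by (simp add: int_pow_distrib int_pow_pow flip: int_pow_int)
        also have "\<dots> = (m2 \<otimes> m [^] i2) \<otimes> w [^] (int p * i2 + i1)"
          using m(1) w m2(1) by (simp add: m_assoc int_pow_mult)
        finally have "y = (m2 \<otimes> m [^] i2) \<otimes> w [^] (int p * i2 + i1)" .
        moreover have "m2 \<otimes> m [^] i2 \<in> M"
          by (rule M.m_closed[OF m2(1) subgroup_int_pow_closed[OF sM m(1)]])
        ultimately show ?thesis by blast
      qed
      show "int (p\<^sup>2) dvd i * 1" if "w [^] i \<in> M" for i :: int using ker[OF that] by simp
      show "[j * 1 = int p] (mod int (p\<^sup>2))" if "m' \<in> M" "z = m' \<otimes> w [^] (j::int)" for m' j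
      proof -
        have "w [^] j = inv m' \<otimes> z"
          by (rule iffD2[OF inv_solve_left that(2)]) (use that(1) z w in simp_all)
        also have "\<dots> = inv m' \<otimes> (m \<otimes> w [^] p)" by (simp only: flip: zw)
        finally have "w [^] (j - int p) = inv m' \<otimes> m"
          using that(1) m(1) w by (simp add: int_pow_diff int_pow_int m_assoc)
        then have "w [^] (j - int p) \<in> M" using that(1) m(1) by simp
        from ker[OF this] show ?thesis by (simp add: cong_iff_dvd_diff)
      qed
    qed
  qed
  \<comment> \<open>An exponent of \<open>w\<close> that gives \<open>x\<close> modulo \<open>M\<close>; multiplied by \<open>c\<close> it is unique modulo \<open>p\<^sup>2\<close>.\<close>
  define e where "e x = (SOME i::int. \<exists>m\<in>M. x = m \<otimes> w [^] i)" for x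
  have e: "\<exists>m\<in>M. x = m \<otimes> w [^] e x" if "x \<in> carrier G" for x
    unfolding e_def by (rule someI_ex) (use w(2)[OF that] in blast)
  have "[e (x \<otimes> y) * c = e x * c + e y * c] (mod int (p\<^sup>2))" if xy: "x \<in> carrier G" "y \<in> carrier G" for x y
  proof -
    obtain a b d where abd: "a \<in> M" "x = a \<otimes> w [^] e x" "b \<in> M" "y = b \<otimes> w [^] e y"
      "d \<in> M" "x \<otimes> y = d \<otimes> w [^] e (x \<otimes> y)"
      using e[OF xy(1)] e[OF xy(2)] e[of "x \<otimes> y"] xy by blast
    have "d \<otimes> w [^] e (x \<otimes> y) = (a \<otimes> w [^] e x) \<otimes> (b \<otimes> w [^] e y)"
      using abd(2,4,6) by (simp only: flip: abd(2,4,6))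
    also have "\<dots> = (a \<otimes> b) \<otimes> w [^] (e x + e y)"
      using abd(1,3) w(1) by (simp add: int_pow_mult m_ac)
    finally have "d \<otimes> w [^] e (x \<otimes> y) = a \<otimes> b \<otimes> w [^] (e x + e y)" .
    from iffD2[OF inv_solve_left this[symmetric]] have "w [^] (e (x \<otimes> y)) = inv d \<otimes> (a \<otimes> b \<otimes> w [^] (e x + e y))"
      using abd(1,3,5) w(1) by simp
    then have "w [^] (e (x \<otimes> y) - (e x + e y)) = inv d \<otimes> (a \<otimes> b)"
      using abd(1,3,5) w(1) by (simp add: int_pow_diff m_assoc)
    then have "w [^] (e (x \<otimes> y) - (e x + e y)) \<in> M" using abd(1,3,5) by simp
    from ker[OF this] show ?thesis by (simp add: cong_iff_dvd_diff algebra_simps)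
  qed
  moreover have "[e z * c = int p] (mod int (p\<^sup>2))" using e[OF z(1)] wz by blast
  ultimately show thesis
    by (intro that[of "\<lambda>x. e x * c"]) (simp_all add: mod_hom_def)
qed


section \<open>Central extensions of elementary abelian \<open>p\<close>-groups for odd \<open>p\<close>\<close>

lemma (in group) grp_commutator_eqI:
  assumes "x \<in> carrier G" "y \<in> carrier G" "n \<in> carrier G" "x \<otimes> y = y \<otimes> x \<otimes> n"
  shows "grp_commutator G x y = n"
proof -
  have "grp_commutator G x y = inv x \<otimes> inv y \<otimes> (x \<otimes> y)"
    using assms(1-3) by (simp add: grp_commutator_def m_assoc)
  also have "\<dots> = inv (y \<otimes> x) \<otimes> (y \<otimes> x) \<otimes> n"
    using assms(1-3) by (simp add: assms(4) inv_mult_group m_assoc)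
  finally show ?thesis using assms(1-3) by simp
qed

lemma (in group) grp_commutator_swap:
  assumes "x \<in> carrier G" "y \<in> carrier G"
  shows "x \<otimes> y = y \<otimes> x \<otimes> grp_commutator G x y"
proof -
  have "y \<otimes> x \<otimes> grp_commutator G x y = (y \<otimes> (x \<otimes> inv x) \<otimes> inv y) \<otimes> (x \<otimes> y)"
    using assms by (simp only: grp_commutator_def m_assoc m_closed inv_closed)
  then show ?thesis using assms by simp
qed

lemma (in group) grp_commutator_closed:
  "x \<in> carrier G \<Longrightarrow> y \<in> carrier G \<Longrightarrow> grp_commutator G x y \<in> carrier G"
  by (simp add: grp_commutator_def)

text \<open>
  Here \<open>N\<close> may be larger than the Frattini subgroup: for an elementary abelian group it can be taken to
  be everything, so that one argument covers both steps of the descending \<open>p\<close>-central series.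
\<close>

locale central_class2 = group +
  fixes p :: nat and N
  assumes prime_p: "Factorial_Ring.prime p" and odd_p: "p \<noteq> 2"
    and subgroup_N: "subgroup N G"
    and central: "\<And>n x. n \<in> N \<Longrightarrow> x \<in> carrier G \<Longrightarrow> n \<otimes> x = x \<otimes> n"
    and exponent_N: "\<And>n. n \<in> N \<Longrightarrow> n [^] p = \<one>"
    and pow_in_N: "\<And>x. x \<in> carrier G \<Longrightarrow> x [^] p \<in> N"
    and commutator_in_N: "\<And>x y. x \<in> carrier G \<Longrightarrow> y \<in> carrier G \<Longrightarrow> grp_commutator G x y \<in> N"
begin

sublocale N: subgroup N G by (rule subgroup_N)

abbreviation comm where "comm \<equiv> grp_commutator G"

lemma comm_left:
  assumes "x \<in> carrier G" "y \<in> carrier G" "w \<in> carrier G"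
  shows "comm (x \<otimes> y) w = comm x w \<otimes> comm y w"
proof (rule grp_commutator_eqI)
  have N: "comm x w \<in> N" "comm y w \<in> N" by (intro commutator_in_N assms)+
  then have cl: "comm x w \<in> carrier G" "comm y w \<in> carrier G" by (intro grp_commutator_closed assms)+
  have "x \<otimes> y \<otimes> w = x \<otimes> (y \<otimes> w)" using assms by (simp add: m_assoc)
  also have "\<dots> = x \<otimes> (w \<otimes> y \<otimes> comm y w)"
    by (rule arg_cong[OF grp_commutator_swap[OF assms(2,3)]])
  also have "\<dots> = x \<otimes> w \<otimes> y \<otimes> comm y w" using assms cl by (simp add: m_assoc)
  also have "\<dots> = (w \<otimes> x \<otimes> comm x w) \<otimes> y \<otimes> comm y w"
    by (subst grp_commutator_swap[OF assms(1,3)]) (rule refl)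
  also have "\<dots> = w \<otimes> x \<otimes> (comm x w \<otimes> y) \<otimes> comm y w"
    using assms cl by (simp only: m_assoc m_closed)
  also have "\<dots> = w \<otimes> (x \<otimes> y) \<otimes> (comm x w \<otimes> comm y w)"
    using assms cl by (simp only: central[OF N(1)] m_assoc m_closed)
  finally show "x \<otimes> y \<otimes> w = w \<otimes> (x \<otimes> y) \<otimes> (comm x w \<otimes> comm y w)" .
  show "comm x w \<otimes> comm y w \<in> carrier G" using cl by simp
qed (use assms in auto)

lemma comm_inv:
  assumes "x \<in> carrier G" "y \<in> carrier G"
  shows "comm y x = inv (comm x y)"
  using assms by (simp add: grp_commutator_def inv_mult_group m_assoc)

text \<open>
  The square root of the commutator \<open>[y, x]\<close> in the group \<open>N\<close> of odd exponent \<open>p\<close>: squaring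
  \<open>[y, x]\<^bsup>(p + 1) / 2\<^esup>\<close> gives \<open>[y, x]\<^bsup>p + 1\<^esup> = [y, x]\<close>.
\<close>

definition comm_sqrt where "comm_sqrt x y = comm y x [^] ((p + 1) div 2)"

lemma comm_sqrt_in_N: "x \<in> carrier G \<Longrightarrow> y \<in> carrier G \<Longrightarrow> comm_sqrt x y \<in> N"
  unfolding comm_sqrt_def int_pow_int[symmetric]
  by (intro subgroup_int_pow_closed[OF subgroup_N] commutator_in_N)

lemma comm_sqrt_carrier [simp]: "x \<in> carrier G \<Longrightarrow> y \<in> carrier G \<Longrightarrow> comm_sqrt x y \<in> carrier G"
  by (rule N.mem_carrier[OF comm_sqrt_in_N])

lemma comm_sqrt_square:
  assumes "x \<in> carrier G" "y \<in> carrier G"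
  shows "comm_sqrt x y \<otimes> comm_sqrt x y = comm y x"
proof -
  have N: "comm y x \<in> N" by (intro commutator_in_N assms)
  have "odd p" using prime_p odd_p prime_odd_nat[of p] prime_ge_2_nat[of p] by auto
  then have "(p + 1) div 2 + (p + 1) div 2 = p + 1" by presburger
  then have "comm_sqrt x y \<otimes> comm_sqrt x y = comm y x [^] (p + 1)"
    using N by (simp add: comm_sqrt_def nat_pow_mult del: nat_pow_Suc)
  then show ?thesis using N exponent_N[OF N] by simp
qed

lemma comm_sqrt_left:
  assumes "x \<in> carrier G" "y \<in> carrier G" "w \<in> carrier G"
  shows "comm_sqrt w (x \<otimes> y) = comm_sqrt w x \<otimes> comm_sqrt w y"
  unfolding comm_sqrt_def comm_left[OF assms]
  by (intro pow_mult_distrib central commutator_in_N grp_commutator_closed assms)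

lemma comm_sqrt_inv:
  assumes "x \<in> carrier G" "y \<in> carrier G"
  shows "comm_sqrt x y = inv (comm_sqrt y x)"
  unfolding comm_sqrt_def using assms comm_inv[OF assms] by (simp add: nat_pow_inv grp_commutator_closed)

lemma comm_sqrt_right:
  assumes "x \<in> carrier G" "y \<in> carrier G" "w \<in> carrier G"
  shows "comm_sqrt (x \<otimes> y) w = comm_sqrt x w \<otimes> comm_sqrt y w"
proof -
  have "comm_sqrt (x \<otimes> y) w = inv (comm_sqrt w x \<otimes> comm_sqrt w y)"
    using assms comm_sqrt_inv[of "x \<otimes> y" w] comm_sqrt_left[OF assms] by simp
  also have "\<dots> = inv (comm_sqrt w y) \<otimes> inv (comm_sqrt w x)"
    using assms by (simp add: inv_mult_group)
  also have "\<dots> = comm_sqrt y w \<otimes> comm_sqrt x w" by (simp only: comm_sqrt_inv[OF assms(2,3)] comm_sqrt_inv[OF assms(1,3)])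
  also have "\<dots> = comm_sqrt x w \<otimes> comm_sqrt y w" using assms by (intro central comm_sqrt_in_N) simp_all
  finally show ?thesis .
qed

lemma comm_sqrt_N:
  assumes "n \<in> N" "x \<in> carrier G"
  shows "comm_sqrt n x = \<one>" "comm_sqrt x n = \<one>"
proof -
  have "comm n x = \<one>"
    using assms central[OF assms] by (intro grp_commutator_eqI) simp_all
  then show "comm_sqrt x n = \<one>" by (simp add: comm_sqrt_def)
  then show "comm_sqrt n x = \<one>" using assms comm_sqrt_inv[of n x] by simp
qed

lemma comm_sqrt_self: "x \<in> carrier G \<Longrightarrow> comm_sqrt x x = \<one>"
proof -
  assume "x \<in> carrier G"
  then have "comm x x = \<one>" by (intro grp_commutator_eqI) auto
  then show ?thesis by (simp add: comm_sqrt_def)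
qed

text \<open>
  Baer's trick: \<open>x \<circ> y = x y [y, x]\<^bsup>1/2\<^esup>\<close> is commutative because
  \<open>x y = y x [x, y]\<close> and \<open>[x, y] [y, x]\<^bsup>1/2\<^esup> = [x, y]\<^bsup>1/2\<^esup>\<close>; it has the same powers as the original
  product and agrees with it as soon as one factor lies in \<open>N\<close>.
\<close>

definition baer_group where
  "baer_group = \<lparr>carrier = carrier G, monoid.mult = (\<lambda>x y. x \<otimes> y \<otimes> comm_sqrt x y), one = \<one>\<rparr>"

lemma baer_simps:
  "carrier baer_group = carrier G" "x \<otimes>\<^bsub>baer_group\<^esub> y = x \<otimes> y \<otimes> comm_sqrt x y" "\<one>\<^bsub>baer_group\<^esub> = \<one>"
  by (simp_all add: baer_group_def)

lemma comm_group_baer: "comm_group baer_group"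
proof (rule comm_groupI)
  fix x y assume "x \<in> carrier baer_group" "y \<in> carrier baer_group"
  then have xy: "x \<in> carrier G" "y \<in> carrier G" by (auto simp: baer_simps)
  then show "x \<otimes>\<^bsub>baer_group\<^esub> y \<in> carrier baer_group" by (simp add: baer_simps)
  have "x \<otimes> y \<otimes> comm_sqrt x y = y \<otimes> x \<otimes> (comm x y \<otimes> comm_sqrt x y)"
    using xy by (subst grp_commutator_swap[OF xy]) (simp add: m_assoc grp_commutator_closed)
  also have "comm x y \<otimes> comm_sqrt x y = comm_sqrt y x \<otimes> comm_sqrt y x \<otimes> inv (comm_sqrt y x)"
    by (simp only: comm_sqrt_square[OF xy(2,1)] comm_sqrt_inv[OF xy])
  also have "\<dots> = comm_sqrt y x" using xy by (simp add: m_assoc)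
  finally show "x \<otimes>\<^bsub>baer_group\<^esub> y = y \<otimes>\<^bsub>baer_group\<^esub> x" by (simp add: baer_simps)
next
  fix x y w assume "x \<in> carrier baer_group" "y \<in> carrier baer_group" "w \<in> carrier baer_group"
  then have xy: "x \<in> carrier G" "y \<in> carrier G" "w \<in> carrier G" by (auto simp: baer_simps)
  have "comm_sqrt (x \<otimes> y \<otimes> comm_sqrt x y) w = comm_sqrt x w \<otimes> comm_sqrt y w"
    "comm_sqrt x (y \<otimes> w \<otimes> comm_sqrt y w) = comm_sqrt x y \<otimes> comm_sqrt x w"
    using xy comm_sqrt_in_N[OF xy(1,2)] comm_sqrt_in_N[OF xy(2,3)] by (simp_all add: comm_sqrt_right comm_sqrt_left comm_sqrt_N)
  then have "x \<otimes>\<^bsub>baer_group\<^esub> y \<otimes>\<^bsub>baer_group\<^esub> w = x \<otimes> y \<otimes> (comm_sqrt x y \<otimes> w) \<otimes> (comm_sqrt x w \<otimes> comm_sqrt y w)"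
    "x \<otimes>\<^bsub>baer_group\<^esub> (y \<otimes>\<^bsub>baer_group\<^esub> w) = x \<otimes> y \<otimes> w \<otimes> (comm_sqrt y w \<otimes> (comm_sqrt x y \<otimes> comm_sqrt x w))"
    using xy by (simp_all add: baer_simps m_assoc)
  moreover have "comm_sqrt x y \<otimes> w = w \<otimes> comm_sqrt x y"
    using xy by (intro central comm_sqrt_in_N) simp_all
  moreover have "comm_sqrt y w \<otimes> (comm_sqrt x y \<otimes> comm_sqrt x w) = comm_sqrt x y \<otimes> comm_sqrt x w \<otimes> comm_sqrt y w"
    using xy by (intro central comm_sqrt_in_N) simp_all
  ultimately show "x \<otimes>\<^bsub>baer_group\<^esub> y \<otimes>\<^bsub>baer_group\<^esub> w = x \<otimes>\<^bsub>baer_group\<^esub> (y \<otimes>\<^bsub>baer_group\<^esub> w)"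
    using xy by (simp add: m_assoc)
next
  fix x assume "x \<in> carrier baer_group"
  then have x: "x \<in> carrier G" by (simp add: baer_simps)
  then show "\<one>\<^bsub>baer_group\<^esub> \<otimes>\<^bsub>baer_group\<^esub> x = x" by (simp add: baer_simps comm_sqrt_N)
  have "comm_sqrt (inv x) x = \<one>"
    using x comm_sqrt_right[of "inv x" x x] by (simp add: comm_sqrt_self comm_sqrt_N)
  then show "\<exists>y\<in>carrier baer_group. y \<otimes>\<^bsub>baer_group\<^esub> x = \<one>\<^bsub>baer_group\<^esub>"
    using x by (intro bexI[of _ "inv x"]) (auto simp: baer_simps)
qed (simp add: baer_simps)

lemma comm_sqrt_pow_self: "x \<in> carrier G \<Longrightarrow> comm_sqrt (x [^] (n::nat)) x = \<one>"
proof (induction n)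
  case 0
  then show ?case using comm_sqrt_N(1)[OF N.one_closed] by simp
next
  case (Suc n)
  then show ?case using comm_sqrt_right[of "x [^] n" x x] comm_sqrt_self[of x] by simp
qed

lemma baer_pow: "x \<in> carrier G \<Longrightarrow> x [^]\<^bsub>baer_group\<^esub> (n::nat) = x [^] n"
proof (induction n)
  case 0
  show ?case by (simp add: nat_pow_def) (simp add: baer_simps)
next
  case (Suc n)
  have "x [^]\<^bsub>baer_group\<^esub> Suc n = (x [^]\<^bsub>baer_group\<^esub> n) \<otimes>\<^bsub>baer_group\<^esub> x"
    by (simp add: nat_pow_def)
  also have "\<dots> = x [^] n \<otimes> x \<otimes> comm_sqrt (x [^] n) x" by (simp only: Suc) (simp add: baer_simps)
  finally show ?case using Suc.prems by (simp add: comm_sqrt_pow_self)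
qed

text \<open>
  A character of the abelian group \<open>baer_group\<close> with values in \<open>\<int>/p\<^sup>2\<close> fails to be multiplicative for the
  original product only by its value on the square roots of commutators, which is bilinear.
\<close>

lemma exists_bilinear_deviation:
  assumes fin: "finite (carrier G)" and z: "z \<in> N" "z \<noteq> \<one>"
  obtains F b where "\<And>x y. x \<in> carrier G \<Longrightarrow> y \<in> carrier G \<Longrightarrow>
      [F (x \<otimes> y) = F x + F y + int p * b x y] (mod int (p\<^sup>2))"
    and "\<And>y. y \<in> carrier G \<Longrightarrow> mod_hom G p (\<lambda>x. b x y)"
    and "\<And>x. x \<in> carrier G \<Longrightarrow> mod_hom G p (b x)"
    and "[F z = int p] (mod int (p\<^sup>2))"
proof -
  interpret A: comm_group baer_group by (rule comm_group_baer)
  note carA = baer_simps(1) and oneA = baer_simps(3)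
  have exp: "x [^]\<^bsub>baer_group\<^esub> p\<^sup>2 = \<one>\<^bsub>baer_group\<^esub>" if "x \<in> carrier baer_group" for x
  proof -
    have x: "x \<in> carrier G" using that by (simp only: carA)
    then have "x [^] p\<^sup>2 = (x [^] p) [^] p" by (simp add: power2_eq_square nat_pow_pow)
    then show ?thesis using exponent_N[OF pow_in_N[OF x]] by (simp only: oneA baer_pow[OF x])
  qed
  obtain F where F: "mod_hom baer_group (p\<^sup>2) F" "[F z = int p] (mod int (p\<^sup>2))"
  proof (rule A.exists_mod_hom_nontrivial_at[OF _ prime_p exp])
    show "finite (carrier baer_group)" using fin by (simp only: carA)
    show "z \<in> carrier baer_group" "z \<noteq> \<one>\<^bsub>baer_group\<^esub>" using z by (simp_all only: carA oneA N.mem_carrier) simp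
    show "z [^]\<^bsub>baer_group\<^esub> p = \<one>\<^bsub>baer_group\<^esub>" using z exponent_N[OF z(1)] by (simp only: baer_pow oneA N.mem_carrier)
  qed
  have FN: "[F (x \<otimes> n) = F x + F n] (mod int (p\<^sup>2))" if "x \<in> carrier G" "n \<in> N" for x n
  proof -
    have n: "n \<in> carrier G" by (rule N.mem_carrier[OF that(2)])
    then have "[F (x \<otimes>\<^bsub>baer_group\<^esub> n) = F x + F n] (mod int (p\<^sup>2))"
      using F(1) that(1) by (simp add: mod_hom_def carA)
    then show ?thesis using that n by (simp add: baer_simps comm_sqrt_N)
  qed
  have F1: "[F \<one> = 0] (mod int (p\<^sup>2))"
  proof -
    have "int (p\<^sup>2) dvd F \<one> - (F \<one> + F \<one>)" using FN[of \<one> \<one>] by (simp add: cong_iff_dvd_diff)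
    then show ?thesis by (simp add: cong_iff_dvd_diff)
  qed
  have dvdN: "int p dvd F n" if n: "n \<in> N" for n
  proof -
    have "[F (n [^] k) = int k * F n] (mod int (p\<^sup>2))" for k :: nat
    proof (induction k)
      case (Suc k)
      have "[F (n [^] Suc k) = F (n [^] k) + F n] (mod int (p\<^sup>2))" using FN[of "n [^] k" n] n by simp
      also have "[F (n [^] k) + F n = int k * F n + F n] (mod int (p\<^sup>2))" by (intro cong_add Suc) simp
      finally show ?case by (simp add: algebra_simps)
    qed (use F1 in simp)
    from this[of p] have "[int p * F n = 0] (mod int (p\<^sup>2))"
      using exponent_N[OF n] F1 by (simp, metis cong_sym cong_trans)
    then show ?thesis using prime_gt_0_nat[OF prime_p] by (simp add: cong_0_iff power2_eq_square)
  qed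
  define b where "b x y = F (comm_sqrt y x) div int p" for x y
  have b: "int p * b x y = F (comm_sqrt y x)" if "x \<in> carrier G" "y \<in> carrier G" for x y
    using dvdN[OF comm_sqrt_in_N] that by (simp add: b_def)
  have cancel: "[u = v + w] (mod int p)" if "[int p * u = int p * v + int p * w] (mod int (p\<^sup>2))" for u v w
    using that prime_gt_0_nat[OF prime_p]
    by (simp add: cong_iff_dvd_diff power2_eq_square flip: distrib_left right_diff_distrib)
  show thesis
  proof (rule that[of F b])
    fix x y assume xy: "x \<in> carrier G" "y \<in> carrier G"
    have "x \<otimes> y = x \<otimes>\<^bsub>baer_group\<^esub> y \<otimes> comm_sqrt y x"
      using xy comm_sqrt_inv[of y x] by (simp add: baer_simps m_assoc)
    moreover have "x \<otimes>\<^bsub>baer_group\<^esub> y \<in> carrier G" using xy by (simp add: baer_simps)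
    ultimately have "[F (x \<otimes> y) = F (x \<otimes>\<^bsub>baer_group\<^esub> y) + F (comm_sqrt y x)] (mod int (p\<^sup>2))"
      using FN[of "x \<otimes>\<^bsub>baer_group\<^esub> y" "comm_sqrt y x"] comm_sqrt_in_N[OF xy(2,1)] by simp
    also have "[F (x \<otimes>\<^bsub>baer_group\<^esub> y) + F (comm_sqrt y x) = F x + F y + F (comm_sqrt y x)] (mod int (p\<^sup>2))"
      using F(1) xy by (intro cong_add) (auto simp: mod_hom_def carA)
    finally show "[F (x \<otimes> y) = F x + F y + int p * b x y] (mod int (p\<^sup>2))" by (simp only: b[OF xy])
  next
    fix y assume y: "y \<in> carrier G"
    show "mod_hom G p (\<lambda>x. b x y)"
      unfolding mod_hom_def
    proof (intro ballI cancel)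
      fix x x' assume x: "x \<in> carrier G" "x' \<in> carrier G"
      show "[int p * b (x \<otimes> x') y = int p * b x y + int p * b x' y] (mod int (p\<^sup>2))"
        using x y FN[of "comm_sqrt y x" "comm_sqrt y x'"] comm_sqrt_in_N by (simp add: b comm_sqrt_left)
    qed
  next
    fix x assume x: "x \<in> carrier G"
    show "mod_hom G p (b x)"
      unfolding mod_hom_def
    proof (intro ballI cancel)
      fix y y' assume y: "y \<in> carrier G" "y' \<in> carrier G"
      show "[int p * b x (y \<otimes> y') = int p * b x y + int p * b x y'] (mod int (p\<^sup>2))"
        using x y FN[of "comm_sqrt y x" "comm_sqrt y' x"] comm_sqrt_in_N by (simp add: b comm_sqrt_right)
    qed
  qed (rule F(2))
qed

end

text \<open>
  Subtracting from \<open>b\<close> the product \<open>b(x, y\<^sub>0) b(x\<^sub>0, y) / b(x\<^sub>0, y\<^sub>0)\<close> keeps every element of the left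
  kernel there and adds \<open>x\<^sub>0\<close> to it, so finitely many such steps exhaust \<open>b\<close>.
\<close>

lemma (in group) bilinear_eq_sum_of_products:
  assumes fin: "finite (carrier G)" and p: "Factorial_Ring.prime p"
    and l: "\<And>y. y \<in> carrier G \<Longrightarrow> mod_hom G p (\<lambda>x. b x y)"
    and r: "\<And>x. x \<in> carrier G \<Longrightarrow> mod_hom G p (b x)"
  shows "\<exists>ts. (\<forall>(u, v) \<in> set ts. mod_hom G p u \<and> mod_hom G p v) \<and>
    (\<forall>x\<in>carrier G. \<forall>y\<in>carrier G. [b x y = (\<Sum>(u, v)\<leftarrow>ts. u x * v y)] (mod int p))"
  using l r
proof (induction "card {x \<in> carrier G. \<exists>y\<in>carrier G. \<not> [b x y = 0] (mod int p)}"
    arbitrary: b rule: less_induct)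
  case less
  let ?S = "\<lambda>b. {x \<in> carrier G. \<exists>y\<in>carrier G. \<not> [b x y = 0] (mod int p)}"
  show ?case
  proof (cases "?S b = {}")
    case True
    then show ?thesis by (intro exI[of _ "[]"]) auto
  next
    case False
    then obtain x0 y0 where x0: "x0 \<in> carrier G" "y0 \<in> carrier G" "\<not> [b x0 y0 = 0] (mod int p)" by blast
    have "Factorial_Ring.prime (int p)" using p by simp
    then have "coprime (b x0 y0) (int p)"
      using x0(3) prime_imp_coprime[of "int p" "b x0 y0"] by (simp add: cong_0_iff coprime_commute)
    then obtain t where t: "[b x0 y0 * t = 1] (mod int p)" using cong_solve_coprime_int by blast
    define u where "u x = t * b x y0" for x
    define b' where "b' x y = b x y - u x * b x0 y" for x y
    have u: "mod_hom G p u"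
      using less.prems(1)[OF x0(2)] by (auto simp: mod_hom_def u_def simp flip: distrib_left intro: cong_scalar_left)
    have l': "mod_hom G p (\<lambda>x. b' x y)" if "y \<in> carrier G" for y
      unfolding mod_hom_def
    proof (intro ballI)
      fix x x' assume "x \<in> carrier G" "x' \<in> carrier G"
      then have "[b' (x \<otimes> x') y = (b x y + b x' y) - (u x + u x') * b x0 y] (mod int p)"
        unfolding b'_def using u less.prems(1)[OF that] by (intro cong_diff cong_mult) (auto simp: mod_hom_def)
      then show "[b' (x \<otimes> x') y = b' x y + b' x' y] (mod int p)" by (simp add: b'_def algebra_simps)
    qed
    have r': "mod_hom G p (b' x)" if "x \<in> carrier G" for x
      unfolding mod_hom_def
    proof (intro ballI)
      fix y y' assume "y \<in> carrier G" "y' \<in> carrier G"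
      then have "[b' x (y \<otimes> y') = (b x y + b x y') - u x * (b x0 y + b x0 y')] (mod int p)"
        unfolding b'_def using less.prems(2)[OF that] less.prems(2)[OF x0(1)]
        by (intro cong_diff cong_mult) (auto simp: mod_hom_def)
      then show "[b' x (y \<otimes> y') = b' x y + b' x y'] (mod int p)" by (simp add: b'_def algebra_simps)
    qed
    have "?S b' \<subset> ?S b"
    proof
      show "?S b' \<subseteq> ?S b"
      proof
        fix x assume "x \<in> ?S b'"
        then obtain y where x: "x \<in> carrier G" "y \<in> carrier G" "\<not> [b' x y = 0] (mod int p)" by blast
        show "x \<in> ?S b"
        proof (rule ccontr)
          assume "x \<notin> ?S b"
          then have "[b x y - t * b x y0 * b x0 y = 0 - t * 0 * b x0 y] (mod int p)"
            using x x0 by (intro cong_diff cong_mult) auto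
          with x(3) show False by (simp add: b'_def u_def)
        qed
      qed
      have "[b' x0 y = 0] (mod int p)" for y
      proof -
        have "[b x0 y - b x0 y0 * t * b x0 y = b x0 y - 1 * b x0 y] (mod int p)"
          by (intro cong_diff cong_mult t) auto
        then show ?thesis by (simp add: b'_def u_def mult_ac)
      qed
      then have "x0 \<notin> ?S b'" by simp
      moreover have "x0 \<in> ?S b" using x0 by blast
      ultimately show "?S b' \<noteq> ?S b" by blast
    qed
    then have "card (?S b') < card (?S b)" by (intro psubset_card_mono) (use fin in auto)
    from less.hyps[OF this l' r'] obtain ts where ts: "\<forall>(u, v) \<in> set ts. mod_hom G p u \<and> mod_hom G p v"
      "\<And>x y. x \<in> carrier G \<Longrightarrow> y \<in> carrier G \<Longrightarrow> [b' x y = (\<Sum>(u, v)\<leftarrow>ts. u x * v y)] (mod int p)" by blast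
    have "[b x y = (\<Sum>(u, v)\<leftarrow>(u, b x0) # ts. u x * v y)] (mod int p)" if "x \<in> carrier G" "y \<in> carrier G" for x y
    proof -
      have "[u x * b x0 y + b' x y = u x * b x0 y + (\<Sum>(u, v)\<leftarrow>ts. u x * v y)] (mod int p)"
        by (intro cong_add ts that) simp
      then show ?thesis by (simp add: b'_def)
    qed
    then show ?thesis
      using ts(1) u less.prems(2)[OF x0(1)] by (intro exI[of _ "(u, b x0) # ts"]) auto
  qed
qed


section \<open>A coordinate model of \<open>M\<^bsub>p^3\<^esub>\<close>\<close>

text \<open>Von Dyck's theorem: evaluating words respects the relations as soon as it identifies their two sides.\<close>

lemma presented_group_hom_extension:
  assumes H: "group H" and val: "\<And>x. val x \<in> carrier H"
    and rel: "\<And>l r. (l, r) \<in> R \<Longrightarrow>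
      foldr (\<lambda>(x, e) y. (if e then val x else inv\<^bsub>H\<^esub> val x) \<otimes>\<^bsub>H\<^esub> y) l \<one>\<^bsub>H\<^esub>
      = foldr (\<lambda>(x, e) y. (if e then val x else inv\<^bsub>H\<^esub> val x) \<otimes>\<^bsub>H\<^esub> y) r \<one>\<^bsub>H\<^esub>"
  obtains \<phi> where "\<phi> \<in> hom (presented_group R) H" "\<And>x. \<phi> (word_class R [(x, True)]) = val x"
proof -
  interpret H: group H by (rule H)
  define ev where "ev u = foldr (\<lambda>(x, e) y. (if e then val x else inv\<^bsub>H\<^esub> val x) \<otimes>\<^bsub>H\<^esub> y) u \<one>\<^bsub>H\<^esub>" for u
  have ev_simps: "ev [] = \<one>\<^bsub>H\<^esub>" "ev ((x, e) # u) = (if e then val x else inv\<^bsub>H\<^esub> val x) \<otimes>\<^bsub>H\<^esub> ev u" for x e u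
    by (simp_all add: ev_def)
  have cl: "ev u \<in> carrier H" for u
  proof (induction u)
    case (Cons a u)
    then show ?case using val by (cases a) (simp add: ev_simps)
  qed (simp add: ev_simps)
  have app: "ev (u @ v) = ev u \<otimes>\<^bsub>H\<^esub> ev v" for u v
  proof (induction u)
    case (Cons a u)
    then show ?case using val cl by (cases a) (simp add: ev_simps H.m_assoc)
  qed (simp add: ev_simps cl)
  have inv: "ev u = ev v" if "word_eq R u v" for u v
    using that
  proof (induction rule: word_eq.induct)
    case (word_cancel u x e v)
    have "a \<otimes>\<^bsub>H\<^esub> (inv\<^bsub>H\<^esub> a \<otimes>\<^bsub>H\<^esub> w) = w" "inv\<^bsub>H\<^esub> a \<otimes>\<^bsub>H\<^esub> (a \<otimes>\<^bsub>H\<^esub> w) = w"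
      if "a \<in> carrier H" "w \<in> carrier H" for a w
      using that H.m_assoc[of a "inv\<^bsub>H\<^esub> a" w] H.m_assoc[of "inv\<^bsub>H\<^esub> a" a w] by simp_all
    then show ?case using val cl by (cases e) (simp_all add: app ev_simps)
  next
    case (word_relation l r u v)
    then have "ev l = ev r" using rel by (simp add: ev_def)
    then show ?case by (simp add: app)
  qed auto
  define \<phi> where "\<phi> X = ev (SOME u. X = word_class R u)" for X
  have \<phi>: "\<phi> (word_class R u) = ev u" for u
  proof -
    have "word_class R u = word_class R (SOME v. word_class R u = word_class R v)"
      by (rule someI[where P = "\<lambda>v. word_class R u = word_class R v"]) (rule refl)
    then show ?thesis unfolding \<phi>_def using inv word_class_eq_iff by metis
  qed
  show thesis
  proof (rule that)
    show "\<phi> \<in> hom (presented_group R) H"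
      unfolding hom_def presented_group_carrier by (auto simp: \<phi> cl presented_group_mult app)
    show "\<phi> (word_class R [(x, True)]) = val x" for x
      using val by (simp add: \<phi> ev_simps)
  qed
qed

text \<open>
  The pair \<open>(m, j)\<close> stands for \<open>s\<^sup>j r\<^sup>m\<close>. Moving \<open>r\<^sup>m\<close> past \<open>s\<^bsup>j'\<^esup>\<close> multiplies the exponent \<open>m\<close> by
  \<open>(1 + p)\<^bsup>j'\<^esup>\<close>, which is \<open>1 + p j'\<close> modulo \<open>p\<^sup>2\<close>.
\<close>

definition M_model :: "nat \<Rightarrow> (int \<times> int) monoid"
  where "M_model p = \<lparr>carrier = {0..<int (p\<^sup>2)} \<times> {0..<int p},
    monoid.mult = (\<lambda>(m, j) (m', j'). ((m + m' + int p * m * j') mod int (p\<^sup>2), (j + j') mod int p)),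
    one = (0, 0)\<rparr>"

lemma M_model_simps:
  "carrier (M_model p) = {0..<int (p\<^sup>2)} \<times> {0..<int p}"
  "(m, j) \<otimes>\<^bsub>M_model p\<^esub> (m', j') = ((m + m' + int p * m * j') mod int (p\<^sup>2), (j + j') mod int p)"
  "\<one>\<^bsub>M_model p\<^esub> = (0, 0)"
  by (simp_all add: M_model_def)

lemma cong_mod_left_int: "[a mod n = a] (mod (n::int))"
  by (simp add: cong_def)

lemma cong_mult_p: "[x = y] (mod int p) \<Longrightarrow> [int p * x = int p * y] (mod int (p\<^sup>2))"
  by (auto simp: cong_iff_dvd_diff power2_eq_square simp flip: right_diff_distrib)

lemma cong_p2_imp_p: "[x = y] (mod int (p\<^sup>2)) \<Longrightarrow> [x = y] (mod int p)"
  by (auto simp: cong_iff_dvd_diff power2_eq_square intro: dvd_mult_left)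

lemma cong_mult_p_mod:
  "[a = a'] (mod int p) \<Longrightarrow> [b = b'] (mod int p) \<Longrightarrow> [int p * a * b = int p * a' * b'] (mod int (p\<^sup>2))"
  using cong_mult_p[OF cong_mult[of a a' "int p" b b']] by (simp add: mult.assoc)

lemma group_M_model:
  assumes p: "0 < p"
  shows "group (M_model p)"
proof (rule groupI)
  fix x y z assume "x \<in> carrier (M_model p)" "y \<in> carrier (M_model p)" "z \<in> carrier (M_model p)"
  obtain a b c d e f where xyz: "x = (a, b)" "y = (c, d)" "z = (e, f)" by (metis surj_pair)
  let ?q = "int (p\<^sup>2)"
  have "[(a + c + int p * a * d) mod ?q + e + int p * ((a + c + int p * a * d) mod ?q) * f
      = (a + c + int p * a * d) + e + int p * (a + c) * f] (mod ?q)"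
  proof -
    have "[(a + c + int p * a * d) mod ?q = a + c] (mod int p)"
    proof -
      have "[(a + c + int p * a * d) mod ?q = a + c + int p * a * d] (mod int p)"
        by (rule cong_p2_imp_p[OF cong_mod_left_int])
      also have "[a + c + int p * a * d = a + c] (mod int p)" by (simp add: cong_iff_dvd_diff)
      finally show ?thesis .
    qed
    then show ?thesis by (intro cong_add cong_mod_left_int cong_mult_p_mod) auto
  qed
  also have "[(a + c + int p * a * d) + e + int p * (a + c) * f
      = a + (c + e + int p * c * f) + int p * a * (d + f)] (mod ?q)" by (simp add: algebra_simps)
  also have "[a + (c + e + int p * c * f) + int p * a * (d + f)
      = a + (c + e + int p * c * f) mod ?q + int p * a * ((d + f) mod int p)] (mod ?q)"
    by (intro cong_add cong_mult_p_mod cong_sym[OF cong_mod_left_int] cong_refl)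
  finally show "x \<otimes>\<^bsub>M_model p\<^esub> y \<otimes>\<^bsub>M_model p\<^esub> z = x \<otimes>\<^bsub>M_model p\<^esub> (y \<otimes>\<^bsub>M_model p\<^esub> z)"
    by (simp add: xyz M_model_simps cong_def mod_simps add.assoc)
next
  fix x assume "x \<in> carrier (M_model p)"
  then obtain a b where x: "x = (a, b)" "0 \<le> a" "a < int (p\<^sup>2)" "0 \<le> b" "b < int p"
    by (auto simp: M_model_simps)
  then show "\<one>\<^bsub>M_model p\<^esub> \<otimes>\<^bsub>M_model p\<^esub> x = x" by (simp add: M_model_simps)
  let ?y = "((- a + int p * a * b) mod int (p\<^sup>2), (- b) mod int p)"
  have "[(- a + int p * a * b) mod int (p\<^sup>2) + a + int p * ((- a + int p * a * b) mod int (p\<^sup>2)) * b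
      = (- a + int p * a * b) + a + int p * (- a) * b] (mod int (p\<^sup>2))"
  proof -
    have "[(- a + int p * a * b) mod int (p\<^sup>2) = - a + int p * a * b] (mod int p)"
      by (rule cong_p2_imp_p[OF cong_mod_left_int])
    also have "[- a + int p * a * b = - a] (mod int p)" by (simp add: cong_iff_dvd_diff)
    finally show ?thesis by (intro cong_add cong_mod_left_int cong_mult_p_mod) auto
  qed
  then have "?y \<otimes>\<^bsub>M_model p\<^esub> x = \<one>\<^bsub>M_model p\<^esub>"
    by (simp add: x(1) M_model_simps cong_def mod_simps)
  moreover have "?y \<in> carrier (M_model p)" using p by (simp add: M_model_simps)
  ultimately show "\<exists>y\<in>carrier (M_model p). y \<otimes>\<^bsub>M_model p\<^esub> x = \<one>\<^bsub>M_model p\<^esub>" by blast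
qed (use p in \<open>auto simp: M_model_simps\<close>)

lemma M_model_pow:
  assumes "1 < p"
  shows "(1, 0) [^]\<^bsub>M_model p\<^esub> (n::nat) = (int n mod int (p\<^sup>2), 0)"
    and "(0, 1) [^]\<^bsub>M_model p\<^esub> (n::nat) = (0, int n mod int p)"
  by (induction n) (use assms in \<open>simp_all add: nat_pow_def M_model_simps mod_simps add.commute\<close>)

context
  fixes p :: nat
  assumes p: "1 < p"
begin

definition M_p3_relations where "M_p3_relations = {(replicate (p\<^sup>2) (gen_r, True), []),
     (replicate p (gen_s, True), []),
     ([(gen_r, False), (gen_s, False), (gen_r, True), (gen_s, True)], replicate p (gen_r, True))}"

lemma M_p3_eq: "M_p3 p = presented_group M_p3_relations"
  by (simp add: M_p3_def M_p3_relations_def)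

interpretation P: group "presented_group M_p3_relations"
  by (rule group_presented_group)

text \<open>
  The third relation says \<open>r s = s r\<^bsup>p + 1\<^esup>\<close>, so that in every word the letters \<open>s\<close> can be moved to the
  left; inverses of the generators are positive powers by the first two relations.
\<close>

lemma M_p3_generators:
  obtains r s where "r \<in> carrier (M_p3 p)" "s \<in> carrier (M_p3 p)"
    "r = word_class M_p3_relations [(gen_r, True)]" "s = word_class M_p3_relations [(gen_s, True)]"
    "carrier (M_p3 p) \<subseteq> (\<lambda>(j, i). s [^]\<^bsub>M_p3 p\<^esub> j \<otimes>\<^bsub>M_p3 p\<^esub> r [^]\<^bsub>M_p3 p\<^esub> i) ` ({..<p} \<times> {..<p\<^sup>2})"
proof -
  let ?P = "presented_group M_p3_relations"
  define g where "g x = word_class M_p3_relations [(x, True)]" for x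
  have g [simp]: "g x \<in> carrier ?P" for x by (simp add: g_def presented_group_carrier)
  have pow: "word_class M_p3_relations (replicate n (x, True)) = g x [^]\<^bsub>?P\<^esub> n" for n x
  proof (induction n)
    case (Suc n)
    have "word_class M_p3_relations (replicate (Suc n) (x, True)) = g x [^]\<^bsub>?P\<^esub> n \<otimes>\<^bsub>?P\<^esub> g x"
      by (simp only: replicate_Suc replicate_append_same[symmetric] presented_group_mult[symmetric] Suc g_def[symmetric])
    then show ?case by simp
  qed (simp add: presented_group_one)
  have ginv: "word_class M_p3_relations [(x, False)] = inv\<^bsub>?P\<^esub> g x" for x
  proof (rule P.inv_equality[symmetric])
    have "word_eq M_p3_relations ([] @ [(x, False), (x, \<not> False)] @ []) ([] @ [])" by (rule word_cancel)
    then show "word_class M_p3_relations [(x, False)] \<otimes>\<^bsub>?P\<^esub> g x = \<one>\<^bsub>?P\<^esub>"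
      by (simp add: g_def presented_group_mult presented_group_one word_class_eq_iff)
    show "word_class M_p3_relations [(x, False)] \<in> carrier ?P" unfolding presented_group_carrier by (rule rangeI)
  qed (rule g)
  have rel: "word_class M_p3_relations l = word_class M_p3_relations r" if "(l, r) \<in> M_p3_relations" for l r
    using word_relation[OF that, of "[]" "[]"] by (simp add: word_class_eq_iff)
  let ?r = "g gen_r" and ?s = "g gen_s"
  have rp: "?r [^]\<^bsub>?P\<^esub> (p\<^sup>2) = \<one>\<^bsub>?P\<^esub>" and sp: "?s [^]\<^bsub>?P\<^esub> p = \<one>\<^bsub>?P\<^esub>"
  proof -
    have "(replicate (p\<^sup>2) (gen_r, True), []) \<in> M_p3_relations" "(replicate p (gen_s, True), []) \<in> M_p3_relations"
      by (simp_all add: M_p3_relations_def)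
    from rel[OF this(1)] rel[OF this(2)]
    show "?r [^]\<^bsub>?P\<^esub> (p\<^sup>2) = \<one>\<^bsub>?P\<^esub>" "?s [^]\<^bsub>?P\<^esub> p = \<one>\<^bsub>?P\<^esub>"
      by (simp_all only: pow presented_group_one)
  qed
  have rs: "?r \<otimes>\<^bsub>?P\<^esub> ?s = ?s \<otimes>\<^bsub>?P\<^esub> ?r [^]\<^bsub>?P\<^esub> (p + 1)"
  proof -
    have "word_class M_p3_relations [(gen_r, False), (gen_s, False), (gen_r, True), (gen_s, True)]
      = word_class M_p3_relations (replicate p (gen_r, True))" by (rule rel) (simp add: M_p3_relations_def)
    moreover have "word_class M_p3_relations [(gen_r, False), (gen_s, False), (gen_r, True), (gen_s, True)]
      = word_class M_p3_relations [(gen_r, False)] \<otimes>\<^bsub>?P\<^esub> (word_class M_p3_relations [(gen_s, False)] \<otimes>\<^bsub>?P\<^esub> (?r \<otimes>\<^bsub>?P\<^esub> ?s))"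
      by (simp add: g_def presented_group_mult)
    ultimately have "inv\<^bsub>?P\<^esub> ?r \<otimes>\<^bsub>?P\<^esub> (inv\<^bsub>?P\<^esub> ?s \<otimes>\<^bsub>?P\<^esub> (?r \<otimes>\<^bsub>?P\<^esub> ?s)) = ?r [^]\<^bsub>?P\<^esub> p"
      by (simp only: ginv pow)
    then have "?r \<otimes>\<^bsub>?P\<^esub> ?s = ?s \<otimes>\<^bsub>?P\<^esub> (?r \<otimes>\<^bsub>?P\<^esub> ?r [^]\<^bsub>?P\<^esub> p)"
      by (simp add: P.inv_solve_left')
    also have "?r \<otimes>\<^bsub>?P\<^esub> ?r [^]\<^bsub>?P\<^esub> p = ?r [^]\<^bsub>?P\<^esub> (p + 1)" by (simp add: P.pow_mult_distrib flip: P.nat_pow_Suc2)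
    finally show ?thesis .
  qed
  have ris: "?r [^]\<^bsub>?P\<^esub> i \<otimes>\<^bsub>?P\<^esub> ?s = ?s \<otimes>\<^bsub>?P\<^esub> ?r [^]\<^bsub>?P\<^esub> ((p + 1) * i)" for i :: nat
  proof (induction i)
    case (Suc i)
    have "?r [^]\<^bsub>?P\<^esub> Suc i \<otimes>\<^bsub>?P\<^esub> ?s = ?r [^]\<^bsub>?P\<^esub> i \<otimes>\<^bsub>?P\<^esub> (?r \<otimes>\<^bsub>?P\<^esub> ?s)" by (simp add: P.m_assoc)
    also have "\<dots> = (?r [^]\<^bsub>?P\<^esub> i \<otimes>\<^bsub>?P\<^esub> ?s) \<otimes>\<^bsub>?P\<^esub> ?r [^]\<^bsub>?P\<^esub> (p + 1)" by (simp only: rs P.m_assoc g P.nat_pow_closed)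
    also have "\<dots> = ?s \<otimes>\<^bsub>?P\<^esub> (?r [^]\<^bsub>?P\<^esub> ((p + 1) * i) \<otimes>\<^bsub>?P\<^esub> ?r [^]\<^bsub>?P\<^esub> (p + 1))" 
      by (simp only: Suc P.m_assoc g P.nat_pow_closed)
    also have "?r [^]\<^bsub>?P\<^esub> ((p + 1) * i) \<otimes>\<^bsub>?P\<^esub> ?r [^]\<^bsub>?P\<^esub> (p + 1) = ?r [^]\<^bsub>?P\<^esub> ((p + 1) * Suc i)"
      using P.nat_pow_mult[OF g, of gen_r "(p + 1) * i" "p + 1"] by (simp only: mult_Suc_right add.commute)
    finally show ?case .
  qed simp
  define K where "K = {?s [^]\<^bsub>?P\<^esub> (j::nat) \<otimes>\<^bsub>?P\<^esub> ?r [^]\<^bsub>?P\<^esub> (i::nat) | j i. True}"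
  have Kr: "k \<otimes>\<^bsub>?P\<^esub> ?r [^]\<^bsub>?P\<^esub> (n::nat) \<in> K" if "k \<in> K" for k n
    using that unfolding K_def by (force simp: P.m_assoc P.nat_pow_mult)
  have Ks1: "k \<otimes>\<^bsub>?P\<^esub> ?s \<in> K" if k: "k \<in> K" for k
  proof -
    obtain j i :: nat where "k = ?s [^]\<^bsub>?P\<^esub> j \<otimes>\<^bsub>?P\<^esub> ?r [^]\<^bsub>?P\<^esub> i" using k by (auto simp: K_def)
    then have "k \<otimes>\<^bsub>?P\<^esub> ?s = ?s [^]\<^bsub>?P\<^esub> j \<otimes>\<^bsub>?P\<^esub> (?r [^]\<^bsub>?P\<^esub> i \<otimes>\<^bsub>?P\<^esub> ?s)" by (simp add: P.m_assoc)
    also have "\<dots> = (?s [^]\<^bsub>?P\<^esub> j \<otimes>\<^bsub>?P\<^esub> ?s) \<otimes>\<^bsub>?P\<^esub> ?r [^]\<^bsub>?P\<^esub> ((p + 1) * i)" by (simp only: ris P.m_assoc g P.nat_pow_closed)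
    also have "?s [^]\<^bsub>?P\<^esub> j \<otimes>\<^bsub>?P\<^esub> ?s = ?s [^]\<^bsub>?P\<^esub> Suc j" by simp
    finally show ?thesis unfolding K_def by blast
  qed
  have KC: "k \<in> carrier ?P" if "k \<in> K" for k using that by (auto simp: K_def)
  have Ks: "k \<otimes>\<^bsub>?P\<^esub> ?s [^]\<^bsub>?P\<^esub> (n::nat) \<in> K" if k: "k \<in> K" for k n
  proof (induction n)
    case (Suc n)
    then show ?case using Ks1[OF Suc] KC[OF k] by (simp add: P.m_assoc)
  qed (use k KC in simp)
  have inv_pow: "inv\<^bsub>?P\<^esub> x = x [^]\<^bsub>?P\<^esub> (n - 1)" if "x \<in> carrier ?P" "x [^]\<^bsub>?P\<^esub> n = \<one>\<^bsub>?P\<^esub>" "0 < n" for x and n :: nat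
  proof (rule P.inv_equality)
    have "x [^]\<^bsub>?P\<^esub> (n - 1) \<otimes>\<^bsub>?P\<^esub> x = x [^]\<^bsub>?P\<^esub> Suc (n - 1)" by simp
    then show "x [^]\<^bsub>?P\<^esub> (n - 1) \<otimes>\<^bsub>?P\<^esub> x = \<one>\<^bsub>?P\<^esub>" using that by simp
  qed (use that in simp_all)
  have all: "word_class M_p3_relations u \<in> K" for u
  proof (induction u rule: rev_induct)
    case Nil
    have "\<one>\<^bsub>?P\<^esub> = ?s [^]\<^bsub>?P\<^esub> (0::nat) \<otimes>\<^bsub>?P\<^esub> ?r [^]\<^bsub>?P\<^esub> (0::nat)" by simp
    then show ?case unfolding K_def presented_group_one[symmetric] by blast
  next
    case (snoc a u)
    obtain x e where a: "a = (x, e)" by force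
    have "\<exists>n::nat. word_class M_p3_relations [a] = ?r [^]\<^bsub>?P\<^esub> n \<or> word_class M_p3_relations [a] = ?s [^]\<^bsub>?P\<^esub> n"
    proof (cases e)
      case True
      then have "word_class M_p3_relations [a] = g x [^]\<^bsub>?P\<^esub> (1::nat)" using g[of x] by (simp add: a g_def)
      then show ?thesis by (cases x) blast+
    next
      case False
      then have "word_class M_p3_relations [a] = inv\<^bsub>?P\<^esub> g x" by (simp add: a ginv)
      then show ?thesis using inv_pow[OF g rp] inv_pow[OF g sp] p by (cases x) auto
    qed
    then have "word_class M_p3_relations u \<otimes>\<^bsub>?P\<^esub> word_class M_p3_relations [a] \<in> K" using Kr[OF snoc] Ks[OF snoc] by auto
    then show ?case by (simp add: presented_group_mult)
  qed
  have red: "x [^]\<^bsub>?P\<^esub> i = x [^]\<^bsub>?P\<^esub> (i mod n)" if "x \<in> carrier ?P" "x [^]\<^bsub>?P\<^esub> n = \<one>\<^bsub>?P\<^esub>" for x and i n :: nat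
  proof -
    have "x [^]\<^bsub>?P\<^esub> i = (x [^]\<^bsub>?P\<^esub> n) [^]\<^bsub>?P\<^esub> (i div n) \<otimes>\<^bsub>?P\<^esub> x [^]\<^bsub>?P\<^esub> (i mod n)"
      using that(1) by (simp add: P.nat_pow_pow P.nat_pow_mult)
    then show ?thesis using that by simp
  qed
  have sub: "carrier ?P \<subseteq> (\<lambda>(j, i). ?s [^]\<^bsub>?P\<^esub> j \<otimes>\<^bsub>?P\<^esub> ?r [^]\<^bsub>?P\<^esub> i) ` ({..<p} \<times> {..<p\<^sup>2})"
  proof
    fix k assume "k \<in> carrier ?P"
    then have "k \<in> K" using all by (auto simp: presented_group_carrier)
    then obtain j i :: nat where "k = ?s [^]\<^bsub>?P\<^esub> j \<otimes>\<^bsub>?P\<^esub> ?r [^]\<^bsub>?P\<^esub> i" by (auto simp: K_def)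
    then have "k = ?s [^]\<^bsub>?P\<^esub> (j mod p) \<otimes>\<^bsub>?P\<^esub> ?r [^]\<^bsub>?P\<^esub> (i mod p\<^sup>2)" 
      using red[OF g rp, of i] red[OF g sp, of j] by simp
    then show "k \<in> (\<lambda>(j, i). ?s [^]\<^bsub>?P\<^esub> j \<otimes>\<^bsub>?P\<^esub> ?r [^]\<^bsub>?P\<^esub> i) ` ({..<p} \<times> {..<p\<^sup>2})"
      using p by (intro rev_image_eqI[of "(j mod p, i mod p\<^sup>2)"]) auto
  qed
  show thesis
  proof (rule that[of ?r ?s])
    show "?r \<in> carrier (M_p3 p)" "?s \<in> carrier (M_p3 p)" by (simp_all only: M_p3_eq g)
    show "carrier (M_p3 p) \<subseteq> (\<lambda>(j, i). ?s [^]\<^bsub>M_p3 p\<^esub> j \<otimes>\<^bsub>M_p3 p\<^esub> ?r [^]\<^bsub>M_p3 p\<^esub> i) ` ({..<p} \<times> {..<p\<^sup>2})"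
      using sub by (simp only: M_p3_eq)
  qed (simp_all only: g_def)
qed

text \<open>
  The normal form \<open>s\<^sup>j r\<^sup>i\<close> bounds the order of \<open>M\<^bsub>p^3\<^esub>\<close> by \<open>p\<^sup>3\<close>, so its surjection onto the model
  is injective.
\<close>

lemma M_p3_iso_model: "M_p3 p \<cong> M_model p"
proof -
  interpret E: group "M_model p" using group_M_model p by simp
  define val where "val x = (case x of gen_r \<Rightarrow> (1 :: int, 0 :: int) | gen_s \<Rightarrow> (0, 1))" for x
  have p2: "1 < p\<^sup>2" using p by (simp add: power2_eq_square) (metis One_nat_def n_less_n_mult_m less_trans zero_less_one p)
  have val: "val x \<in> carrier (M_model p)" for x
    using p p2 by (cases x) (simp_all add: val_def M_model_simps flip: of_nat_power)
  have rep: "foldr (\<lambda>(x, e) y. (if e then val x else inv\<^bsub>M_model p\<^esub> val x) \<otimes>\<^bsub>M_model p\<^esub> y) (replicate n (x, True)) \<one>\<^bsub>M_model p\<^esub>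
     = val x [^]\<^bsub>M_model p\<^esub> n" for n x
  proof (induction n)
    case (Suc n)
    then show ?case using E.nat_pow_Suc2[OF val, of x n] by simp
  qed simp
  let ?E = "M_model p"
  have c: "inv\<^bsub>?E\<^esub> val gen_r \<otimes>\<^bsub>?E\<^esub> (inv\<^bsub>?E\<^esub> val gen_s \<otimes>\<^bsub>?E\<^esub> (val gen_r \<otimes>\<^bsub>?E\<^esub> val gen_s))
      = val gen_r [^]\<^bsub>?E\<^esub> p"
  proof -
    have "val gen_r [^]\<^bsub>?E\<^esub> p \<in> carrier ?E" using val by simp
    moreover have "val gen_r \<otimes>\<^bsub>?E\<^esub> val gen_s = val gen_s \<otimes>\<^bsub>?E\<^esub> (val gen_r \<otimes>\<^bsub>?E\<^esub> val gen_r [^]\<^bsub>?E\<^esub> p)"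
      using p p2 by (simp add: val_def M_model_pow M_model_simps mod_simps)
    ultimately show ?thesis using val by (simp add: E.inv_solve_left flip: E.m_assoc E.inv_mult_group)
  qed
  obtain \<phi> where \<phi>: "\<phi> \<in> hom (M_p3 p) ?E" "\<And>x. \<phi> (word_class M_p3_relations [(x, True)]) = val x"
  proof (rule presented_group_hom_extension[OF E.group_axioms val, of M_p3_relations])
    fix l r assume "(l, r) \<in> M_p3_relations"
    then show "foldr (\<lambda>(x, e) y. (if e then val x else inv\<^bsub>?E\<^esub> val x) \<otimes>\<^bsub>?E\<^esub> y) l \<one>\<^bsub>?E\<^esub>
      = foldr (\<lambda>(x, e) y. (if e then val x else inv\<^bsub>?E\<^esub> val x) \<otimes>\<^bsub>?E\<^esub> y) r \<one>\<^bsub>?E\<^esub>"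
      unfolding M_p3_relations_def
    proof (elim insertE emptyE)
      assume "(l, r) = (replicate (p\<^sup>2) (gen_r, True), [])"
      then have lr: "l = replicate (p\<^sup>2) (gen_r, True)" "r = []" by simp_all
      show ?thesis unfolding lr rep using M_model_pow(1)[OF p, of "p\<^sup>2"] by (simp add: val_def M_model_simps)
    next
      assume "(l, r) = (replicate p (gen_s, True), [])"
      then have lr: "l = replicate p (gen_s, True)" "r = []" by simp_all
      show ?thesis unfolding lr rep using M_model_pow(2)[OF p, of "p"] by (simp add: val_def M_model_simps)
    next
      assume "(l, r) = ([(gen_r, False), (gen_s, False), (gen_r, True), (gen_s, True)], replicate p (gen_r, True))"
      then have lr: "l = [(gen_r, False), (gen_s, False), (gen_r, True), (gen_s, True)]"
        "r = replicate p (gen_r, True)" by simp_all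
      show ?thesis unfolding lr rep using c val by simp
    qed
  qed (simp add: M_p3_eq)
  obtain r s where rs: "r \<in> carrier (M_p3 p)" "s \<in> carrier (M_p3 p)"
    "r = word_class M_p3_relations [(gen_r, True)]" "s = word_class M_p3_relations [(gen_s, True)]"
    "carrier (M_p3 p) \<subseteq> (\<lambda>(j, i). s [^]\<^bsub>M_p3 p\<^esub> j \<otimes>\<^bsub>M_p3 p\<^esub> r [^]\<^bsub>M_p3 p\<^esub> i) ` ({..<p} \<times> {..<p\<^sup>2})"
    by (rule M_p3_generators)
  interpret \<phi>: group_hom "M_p3 p" ?E \<phi>
    by (intro group_hom.intro group_hom_axioms.intro \<phi> E.is_group) (simp only: M_p3_eq P.is_group)
  have surj: "\<phi> ` carrier (M_p3 p) = carrier ?E"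
  proof (intro equalityI subsetI)
    fix x assume "x \<in> carrier ?E"
    then obtain m j where x: "x = (m, j)" "0 \<le> m" "m < int (p\<^sup>2)" "0 \<le> j" "j < int p"
      by (auto simp: M_model_simps)
    have "\<phi> (s [^]\<^bsub>M_p3 p\<^esub> nat j \<otimes>\<^bsub>M_p3 p\<^esub> r [^]\<^bsub>M_p3 p\<^esub> nat m) = (0, 1) [^]\<^bsub>?E\<^esub> nat j \<otimes>\<^bsub>?E\<^esub> (1, 0) [^]\<^bsub>?E\<^esub> nat m"
      using rs(1,2) by (simp add: \<phi>.hom_nat_pow) (simp add: rs(3,4) \<phi>(2) val_def)
    also have "\<dots> = x" using x by (simp add: M_model_pow[OF p] M_model_simps)
    finally show "x \<in> \<phi> ` carrier (M_p3 p)" using rs(1,2) by (metis \<phi>.G.m_closed \<phi>.G.nat_pow_closed imageI)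
  qed auto
  let ?I = "(\<lambda>(j, i). s [^]\<^bsub>M_p3 p\<^esub> j \<otimes>\<^bsub>M_p3 p\<^esub> r [^]\<^bsub>M_p3 p\<^esub> i) ` ({..<p} \<times> {..<p\<^sup>2})"
  have fin: "finite (carrier (M_p3 p))" by (rule finite_subset[OF rs(5)]) simp
  have "card (carrier (M_p3 p)) \<le> card ?I" by (rule card_mono[OF _ rs(5)]) simp
  also have "\<dots> \<le> p * p\<^sup>2" by (rule order.trans[OF card_image_le]) (simp_all add: card_cartesian_product)
  also have "\<dots> = card (carrier ?E)" by (simp add: M_model_simps card_cartesian_product flip: of_nat_power)
  finally have "inj_on \<phi> (carrier (M_p3 p))"
    using fin surj card_image_le[OF fin, of \<phi>] by (intro eq_card_imp_inj_on) auto
  then show ?thesis using surj \<phi>(1) by (auto simp: is_iso_def iso_def bij_betw_def)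
qed

end


section \<open>Homomorphisms into the model\<close>

text \<open>
  A homomorphism to \<open>M_model p\<close> in coordinates. Reducing the condition on \<open>F\<close> modulo \<open>p\<close> shows that
  \<open>F\<close> lifts a character \<open>\<chi>\<close> modulo \<open>p\<close>, and dividing the deviation from additivity by \<open>p\<close> shows that
  such lifts exist exactly when \<open>\<beta>(\<chi>) + \<chi> \<union> \<eta> = 0\<close>.
\<close>

definition twisted_hom :: "('a, 'b) monoid_scheme \<Rightarrow> nat \<Rightarrow> ('a \<Rightarrow> int) \<Rightarrow> ('a \<Rightarrow> int) \<Rightarrow> bool"
  where "twisted_hom G p F \<eta> \<longleftrightarrow> mod_hom G p \<eta> \<and>
    (\<forall>x\<in>carrier G. \<forall>y\<in>carrier G. [F (x \<otimes>\<^bsub>G\<^esub> y) = F x + F y + int p * F x * \<eta> y] (mod int (p\<^sup>2)))"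

context group
begin

lemma mod_hom_mult:
  "mod_hom G n f \<Longrightarrow> x \<in> carrier G \<Longrightarrow> y \<in> carrier G \<Longrightarrow> [f (x \<otimes> y) = f x + f y] (mod int n)"
  by (simp add: mod_hom_def)

lemma mod_hom_one: "mod_hom G n f \<Longrightarrow> [f \<one> = 0] (mod int n)"
proof -
  assume "mod_hom G n f"
  then have "[f (\<one> \<otimes> \<one>) = f \<one> + f \<one>] (mod int n)" unfolding mod_hom_def by blast
  then show ?thesis by (simp add: cong_iff_dvd_diff)
qed

lemma mod_hom_pow:
  assumes "mod_hom G n f" "x \<in> carrier G"
  shows "[f (x [^] (k::nat)) = int k * f x] (mod int n)"
proof (induction k)
  case (Suc k)
  have "[f (x [^] Suc k) = f (x [^] k) + f x] (mod int n)" using assms by (simp add: mod_hom_def)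
  also have "[f (x [^] k) + f x = int k * f x + f x] (mod int n)" by (intro cong_add Suc) simp
  finally show ?case by (simp add: algebra_simps)
qed (use mod_hom_one[OF assms(1)] in simp)

lemma mod_hom_inv:
  assumes "mod_hom G n f" "x \<in> carrier G"
  shows "[f (inv x) = - f x] (mod int n)"
proof -
  have "[f (inv x) + f x = f (inv x \<otimes> x)] (mod int n)"
    by (rule cong_sym[OF mod_hom_mult[OF assms(1) inv_closed[OF assms(2)] assms(2)]])
  also have "[f (inv x \<otimes> x) = 0] (mod int n)" using assms(2) mod_hom_one[OF assms(1)] by simp
  finally show ?thesis by (simp add: cong_iff_dvd_diff)
qed

lemma mod_hom_kernel_subgroup:
  assumes f: "mod_hom G n f"
  shows "subgroup {g \<in> carrier G. [f g = 0] (mod int n)} G"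
proof (rule subgroupI)
  show "{g \<in> carrier G. [f g = 0] (mod int n)} \<noteq> {}" using mod_hom_one[OF f] by blast
  show "inv a \<in> {g \<in> carrier G. [f g = 0] (mod int n)}" if "a \<in> {g \<in> carrier G. [f g = 0] (mod int n)}" for a
  proof -
    have a: "a \<in> carrier G" "[f a = 0] (mod int n)" using that by simp_all
    have "[f (inv a) = - f a] (mod int n)" by (rule mod_hom_inv[OF f a(1)])
    also have "[- f a = - 0] (mod int n)" using a(2) by (simp only: cong_minus_minus_iff)
    finally show ?thesis using a(1) by simp
  qed
  show "a \<otimes> b \<in> {g \<in> carrier G. [f g = 0] (mod int n)}"
    if "a \<in> {g \<in> carrier G. [f g = 0] (mod int n)}" "b \<in> {g \<in> carrier G. [f g = 0] (mod int n)}" for a b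
  proof -
    have "[f (a \<otimes> b) = f a + f b] (mod int n)" using that by (intro mod_hom_mult[OF f]) simp_all
    also have "[f a + f b = 0 + 0] (mod int n)" using that by (intro cong_add) auto
    finally show ?thesis using that by simp
  qed
qed auto

lemma mod_hom_commutator:
  assumes f: "mod_hom G n f" and "x \<in> carrier G" "y \<in> carrier G"
  shows "[f (grp_commutator G x y) = 0] (mod int n)"
proof -
  let ?c = "grp_commutator G x y"
  have c: "?c \<in> carrier G" using assms by (simp add: grp_commutator_closed)
  have "[f (y \<otimes> x \<otimes> ?c) = f (y \<otimes> x) + f ?c] (mod int n)"
    using assms(2,3) c by (intro mod_hom_mult[OF f]) simp_all
  also have "[f (y \<otimes> x) + f ?c = f y + f x + f ?c] (mod int n)"
    by (intro cong_add mod_hom_mult[OF f] assms(2,3) cong_refl)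
  finally have "[f y + f x + f ?c = f (y \<otimes> x \<otimes> ?c)] (mod int n)" by (rule cong_sym)
  also have "y \<otimes> x \<otimes> ?c = x \<otimes> y" by (rule grp_commutator_swap[OF assms(2,3), symmetric])
  also have "[f (x \<otimes> y) = f x + f y] (mod int n)" by (rule mod_hom_mult[OF assms])
  finally show ?thesis by (simp add: cong_iff_dvd_diff)
qed

lemma twisted_hom_mult:
  "twisted_hom G p F \<eta> \<Longrightarrow> x \<in> carrier G \<Longrightarrow> y \<in> carrier G \<Longrightarrow>
    [F (x \<otimes> y) = F x + F y + int p * F x * \<eta> y] (mod int (p\<^sup>2))"
  by (simp add: twisted_hom_def)

lemma twisted_hom_mod_hom:
  assumes "twisted_hom G p F \<eta>"
  shows "mod_hom G p F"
  unfolding mod_hom_def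
proof (intro ballI)
  fix x y assume "x \<in> carrier G" "y \<in> carrier G"
  from cong_p2_imp_p[OF twisted_hom_mult[OF assms this]]
  have "[F (x \<otimes> y) = F x + F y + int p * F x * \<eta> y] (mod int p)" .
  also have "[F x + F y + int p * F x * \<eta> y = F x + F y] (mod int p)" by (simp add: cong_iff_dvd_diff)
  finally show "[F (x \<otimes> y) = F x + F y] (mod int p)" .
qed

lemma twisted_hom_add:
  assumes "twisted_hom G p F \<eta>" "x \<in> carrier G" "y \<in> carrier G" "[F x = 0] (mod int p) \<or> [\<eta> y = 0] (mod int p)"
  shows "[F (x \<otimes> y) = F x + F y] (mod int (p\<^sup>2))"
proof -
  have "[F (x \<otimes> y) = F x + F y + int p * F x * \<eta> y] (mod int (p\<^sup>2))"
    by (rule twisted_hom_mult[OF assms(1-3)])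
  also have "[F x + F y + int p * F x * \<eta> y = F x + F y] (mod int (p\<^sup>2))"
  proof -
    have "int p dvd F x * \<eta> y" using assms(4) by (auto simp: cong_0_iff)
    then show ?thesis by (auto simp: cong_iff_dvd_diff power2_eq_square mult.assoc)
  qed
  finally show ?thesis .
qed

lemma twisted_hom_one: "twisted_hom G p F \<eta> \<Longrightarrow> [F \<one> = 0] (mod int (p\<^sup>2))"
proof -
  assume F: "twisted_hom G p F \<eta>"
  then have "[\<eta> \<one> = 0] (mod int p)" by (intro mod_hom_one) (simp add: twisted_hom_def)
  then have "[F (\<one> \<otimes> \<one>) = F \<one> + F \<one>] (mod int (p\<^sup>2))"
    by (intro twisted_hom_add[OF F]) simp_all
  then show ?thesis by (simp add: cong_iff_dvd_diff)
qed

lemma twisted_hom_pow: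
  assumes p: "Factorial_Ring.prime p" "p \<noteq> 2" and F: "twisted_hom G p F \<eta>" and x: "x \<in> carrier G"
  shows "[F (x [^] (p * l)) = int (p * l) * F x] (mod int (p\<^sup>2))"
proof -
  have Fp: "mod_hom G p F" by (rule twisted_hom_mod_hom[OF F])
  have gen: "[F (x [^] n) = int n * F x + int p * ((\<Sum>i<n. int i) * F x * \<eta> x)] (mod int (p\<^sup>2))" for n
  proof (induction n)
    case (Suc n)
    have "[F (x [^] Suc n) = F (x [^] n) + F x + int p * F (x [^] n) * \<eta> x] (mod int (p\<^sup>2))"
      using twisted_hom_mult[OF F nat_pow_closed[OF x] x] by simp
    also have "[F (x [^] n) + F x + int p * F (x [^] n) * \<eta> x =
        (int n * F x + int p * ((\<Sum>i<n. int i) * F x * \<eta> x)) + F x + int p * (int n * F x) * \<eta> x] (mod int (p\<^sup>2))"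
      by (intro cong_add Suc cong_refl cong_mult_p_mod mod_hom_pow[OF Fp x])
    finally show ?case by (simp add: algebra_simps)
  qed (use twisted_hom_one[OF F] in simp)
  \<comment> \<open>The sum is \<open>p l (p l - 1) / 2\<close>, a multiple of \<open>p\<close> because \<open>p\<close> is odd.\<close>
  have "2 * (\<Sum>i<n. int i) = int n * (int n - 1)" for n by (induction n) (simp_all add: algebra_simps)
  then have "int p dvd 2 * (\<Sum>i<p * l. int i)" by simp
  moreover have "Factorial_Ring.prime (int p)" using p by simp
  moreover have "\<not> int p dvd 2"
    using p(2) zdvd_imp_le[of "int p" 2] prime_ge_2_nat[OF p(1)] by auto
  ultimately have "int p dvd (\<Sum>i<p * l. int i)" using prime_dvd_mult_iff by blast
  then have "[int (p * l) * F x + int p * ((\<Sum>i<p * l. int i) * F x * \<eta> x) = int (p * l) * F x] (mod int (p\<^sup>2))"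
    by (simp add: cong_iff_dvd_diff power2_eq_square)
  with gen[of "p * l"] show ?thesis by (rule cong_trans)
qed

lemma twisted_hom_imp_hom:
  assumes p: "0 < p" and F: "twisted_hom G p F \<eta>"
  shows "(\<lambda>g. (F g mod int (p\<^sup>2), \<eta> g mod int p)) \<in> hom G (M_model p)"
proof (rule homI)
  fix x y assume xy: "x \<in> carrier G" "y \<in> carrier G"
  have "[F (x \<otimes> y) = F x + F y + int p * F x * \<eta> y] (mod int (p\<^sup>2))"
    by (rule twisted_hom_mult[OF F xy])
  also have "[F x + F y + int p * F x * \<eta> y = F x mod int (p\<^sup>2) + F y mod int (p\<^sup>2) +
      int p * (F x mod int (p\<^sup>2)) * (\<eta> y mod int p)] (mod int (p\<^sup>2))"
    by (intro cong_add cong_mult_p_mod cong_sym[OF cong_mod_left_int] cong_p2_imp_p[OF cong_sym[OF cong_mod_left_int]])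
  finally show "(F (x \<otimes> y) mod int (p\<^sup>2), \<eta> (x \<otimes> y) mod int p) =
      (F x mod int (p\<^sup>2), \<eta> x mod int p) \<otimes>\<^bsub>M_model p\<^esub> (F y mod int (p\<^sup>2), \<eta> y mod int p)"
    using F xy by (simp add: M_model_simps cong_def twisted_hom_def mod_hom_def mod_simps)
qed (use p in \<open>simp add: M_model_simps\<close>)

lemma ex_nat_multiple_cong:
  assumes p: "Factorial_Ring.prime p" and u: "\<not> [u = 0] (mod int p)"
  obtains b :: nat where "[int b * u = m] (mod int p)"
proof -
  have "Factorial_Ring.prime (int p)" using p by simp
  then have "coprime u (int p)"
    using u prime_imp_coprime[of "int p" u] by (simp add: cong_0_iff coprime_commute)
  then obtain t where t: "[u * t = 1] (mod int p)" using cong_solve_coprime_int by blast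
  have "int (nat ((t * m) mod int p)) = (t * m) mod int p" using p by (simp add: prime_gt_0_nat)
  then have "[int (nat ((t * m) mod int p)) * u = t * m * u] (mod int p)"
    by (simp add: cong_scalar_right cong_mod_left_int)
  also have "[t * m * u = 1 * m] (mod int p)"
    using cong_mult[OF t cong_refl[of m]] by (simp add: mult_ac)
  finally show thesis by (intro that) (simp only: mult_1)
qed

text \<open>
  The image of \<open>(F, \<eta>)\<close> contains the centre because it contains a \<open>p\<close>-th power \<open>(p F(g\<^sub>0), 0)\<close>. If
  \<open>F\<close> and \<open>\<eta>\<close> are independent modulo \<open>p\<close>, it is everything. Otherwise \<open>\<eta> = c F\<close> modulo \<open>p\<close>, and
  \<open>F - p c F\<^sup>2 / 2\<close> is a homomorphism onto \<open>\<int>/p\<^sup>2\<close> that vanishes exactly where \<open>F\<close> does.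
\<close>

lemma twisted_hom_quotient:
  assumes p: "Factorial_Ring.prime p" "p \<noteq> 2" and F: "twisted_hom G p F \<eta>"
    and g0: "g0 \<in> carrier G" "\<not> [F g0 = 0] (mod int p)"
  obtains N where "N \<lhd> G" "G Mod N \<cong> integer_mod_group (p\<^sup>2) \<or> G Mod N \<cong> M_p3 p"
    "\<And>g. g \<in> N \<Longrightarrow> [F g = 0] (mod int (p\<^sup>2))"
    "\<And>g. g \<in> carrier G \<Longrightarrow> [F g = 0] (mod int (p\<^sup>2)) \<Longrightarrow> [\<eta> g = 0] (mod int p) \<Longrightarrow> g \<in> N"
proof (cases "\<exists>g\<in>carrier G. [F g = 0] (mod int p) \<and> \<not> [\<eta> g = 0] (mod int p)")
  case True
  have p0: "0 < p" "1 < p" using prime_gt_0_nat[OF p(1)] prime_gt_1_nat[OF p(1)] by auto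
  have Fp: "mod_hom G p F" by (rule twisted_hom_mod_hom[OF F])
  have \<eta>p: "mod_hom G p \<eta>" using F by (simp add: twisted_hom_def)
  from True obtain g1 where g1: "g1 \<in> carrier G" "[F g1 = 0] (mod int p)" "\<not> [\<eta> g1 = 0] (mod int p)" by blast
  define \<Phi> where "\<Phi> g = (F g mod int (p\<^sup>2), \<eta> g mod int p)" for g
  have \<Phi>: "\<Phi> \<in> hom G (M_model p)"
    using twisted_hom_imp_hom[OF p0(1) F] by (simp add: \<Phi>_def[abs_def])
  interpret \<Phi>: group_hom G "M_model p" \<Phi>
    by (intro group_hom.intro group_hom_axioms.intro \<Phi> is_group group_M_model p0)
  have "\<Phi> ` carrier G = carrier (M_model p)"
  proof (intro equalityI subsetI)
    fix x assume "x \<in> carrier (M_model p)"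
    then obtain m j where x: "x = (m, j)" "0 \<le> m" "m < int (p\<^sup>2)" "0 \<le> j" "j < int p"
      by (auto simp: M_model_simps)
    obtain b where b: "[int b * F g0 = m] (mod int p)" using ex_nat_multiple_cong[OF p(1) g0(2)] .
    obtain a where a: "[int a * \<eta> g1 = j - int b * \<eta> g0] (mod int p)" using ex_nat_multiple_cong[OF p(1) g1(3)] .
    define g where "g = g1 [^] a \<otimes> g0 [^] b"
    have g: "g \<in> carrier G" using g0 g1 by (simp add: g_def)
    have comb: "[f g = int a * f g1 + int b * f g0] (mod int p)" if "mod_hom G p f" for f
    proof -
      have "[f g = f (g1 [^] a) + f (g0 [^] b)] (mod int p)" using that g0 g1 by (simp add: g_def mod_hom_def)
      also have "[f (g1 [^] a) + f (g0 [^] b) = int a * f g1 + int b * f g0] (mod int p)"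
        by (intro cong_add mod_hom_pow that g0 g1)
      finally show ?thesis .
    qed
    have \<eta>g: "[\<eta> g = j] (mod int p)"
    proof -
      have "[int a * \<eta> g1 + int b * \<eta> g0 = (j - int b * \<eta> g0) + int b * \<eta> g0] (mod int p)"
        by (intro cong_add a cong_refl)
      with comb[OF \<eta>p] show ?thesis using cong_trans by fastforce
    qed
    have "[F g = m] (mod int p)"
    proof -
      have "[int a * F g1 + int b * F g0 = int a * 0 + m] (mod int p)"
        by (intro cong_add cong_mult b g1 cong_refl)
      with comb[OF Fp] show ?thesis using cong_trans by fastforce
    qed
    then obtain e where e: "F g = m + int p * e"
      using cong_iff_lin[of m "F g" "int p"] by (auto simp: cong_sym_eq)
    obtain l where l: "[int l * F g0 = - e] (mod int p)" using ex_nat_multiple_cong[OF p(1) g0(2)] .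
    define h where "h = g0 [^] (p * l)"
    have h: "h \<in> carrier G" using g0 by (simp add: h_def)
    \<comment> \<open>\<open>g\<close> is right modulo \<open>p\<close>; the central factor \<open>h\<close> corrects \<open>F\<close> modulo \<open>p\<^sup>2\<close>.\<close>
    have \<eta>h: "[\<eta> h = 0] (mod int p)"
    proof -
      have "[\<eta> h = int (p * l) * \<eta> g0] (mod int p)" unfolding h_def by (rule mod_hom_pow[OF \<eta>p g0(1)])
      also have "[int (p * l) * \<eta> g0 = 0] (mod int p)" by (simp add: cong_0_iff)
      finally show ?thesis .
    qed
    have "[F (g \<otimes> h) = F g + F h] (mod int (p\<^sup>2))" using twisted_hom_add[OF F g h] \<eta>h by blast
    also have "[F g + F h = F g + int (p * l) * F g0] (mod int (p\<^sup>2))"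
      unfolding h_def by (intro cong_add twisted_hom_pow[OF p F g0(1)]) simp
    also have "[F g + int (p * l) * F g0 = F g + int p * (- e)] (mod int (p\<^sup>2))"
      using cong_mult_p[OF l] by (intro cong_add) (simp_all add: mult.assoc)
    finally have "[F (g \<otimes> h) = m] (mod int (p\<^sup>2))" by (simp add: e)
    moreover have "[\<eta> (g \<otimes> h) = j] (mod int p)"
    proof -
      have "[\<eta> (g \<otimes> h) = \<eta> g + \<eta> h] (mod int p)" using \<eta>p g h by (simp add: mod_hom_def)
      also have "[\<eta> g + \<eta> h = j + 0] (mod int p)" by (intro cong_add \<eta>g \<eta>h)
      finally show ?thesis by simp
    qed
    ultimately have "\<Phi> (g \<otimes> h) = x" using x by (simp add: \<Phi>_def cong_def)
    then show "x \<in> \<Phi> ` carrier G" using g h by blast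
  qed (use \<Phi>.hom_closed in blast)
  then have "G Mod kernel G (M_model p) \<Phi> \<cong> M_model p" by (rule \<Phi>.FactGroup_iso)
  then have iso: "G Mod kernel G (M_model p) \<Phi> \<cong> M_p3 p"
    using iso_trans group.iso_sym[OF _ M_p3_iso_model[OF p0(2)]] group_presented_group
    by (metis M_p3_def)
  show thesis
  proof (rule that)
    show "kernel G (M_model p) \<Phi> \<lhd> G" by (rule \<Phi>.normal_kernel)
    show "[F g = 0] (mod int (p\<^sup>2))" if "g \<in> kernel G (M_model p) \<Phi>" for g
      using that by (simp add: kernel_def \<Phi>_def M_model_simps cong_def)
    show "g \<in> kernel G (M_model p) \<Phi>" if "g \<in> carrier G" "[F g = 0] (mod int (p\<^sup>2))" "[\<eta> g = 0] (mod int p)" for g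
      using that by (simp add: kernel_def \<Phi>_def M_model_simps cong_def)
  qed (use iso in blast)
next
  case False
  have p0: "0 < p" "1 < p" using prime_gt_0_nat[OF p(1)] prime_gt_1_nat[OF p(1)] by auto
  have odd: "odd p" using p prime_odd_nat[of p] prime_ge_2_nat[of p] by auto
  have Fp: "mod_hom G p F" by (rule twisted_hom_mod_hom[OF F])
  have \<eta>p: "mod_hom G p \<eta>" using F by (simp add: twisted_hom_def)
  obtain t where t: "[int t * F g0 = - 1] (mod int p)" using ex_nat_multiple_cong[OF p(1) g0(2)] .
  \<comment> \<open>\<open>c\<close> is \<open>\<eta>(g\<^sub>0) / F(g\<^sub>0)\<close> and \<open>d\<close> below is \<open>1/2\<close>, both modulo \<open>p\<close>.\<close>
  define c where "c = - int t * \<eta> g0"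
  have \<eta>c: "[\<eta> g = c * F g] (mod int p)" if g: "g \<in> carrier G" for g
  proof -
    obtain i where i: "[int i * F g0 = - F g] (mod int p)" using ex_nat_multiple_cong[OF p(1) g0(2)] .
    have comb: "[f (g \<otimes> g0 [^] i) = f g + int i * f g0] (mod int p)" if "mod_hom G p f" for f
    proof -
      have "[f (g \<otimes> g0 [^] i) = f g + f (g0 [^] i)] (mod int p)" using that g g0 by (simp add: mod_hom_def)
      also have "[f g + f (g0 [^] i) = f g + int i * f g0] (mod int p)"
        by (intro cong_add mod_hom_pow that g0 cong_refl)
      finally show ?thesis .
    qed
    have "[F g + int i * F g0 = F g + - F g] (mod int p)" by (intro cong_add i cong_refl)
    with comb[OF Fp] have "[F (g \<otimes> g0 [^] i) = 0] (mod int p)" using cong_trans by fastforce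
    with False have "[\<eta> (g \<otimes> g0 [^] i) = 0] (mod int p)" using g g0 by blast
    with comb[OF \<eta>p] have "[\<eta> g + int i * \<eta> g0 = 0] (mod int p)" using cong_trans cong_sym by blast
    then have "[\<eta> g = - int i * \<eta> g0] (mod int p)" by (simp add: cong_iff_dvd_diff)
    also have "[- int i * \<eta> g0 = int i * (int t * F g0) * \<eta> g0] (mod int p)"
      using cong_sym[OF cong_mult[OF cong_mult[OF cong_refl[of "int i"] t] cong_refl[of "\<eta> g0"]]] by simp
    also have "int i * (int t * F g0) * \<eta> g0 = int t * (int i * F g0) * \<eta> g0" by simp
    also have "[int t * (int i * F g0) * \<eta> g0 = int t * (- F g) * \<eta> g0] (mod int p)"
      by (intro cong_mult i cong_refl)
    finally show ?thesis by (simp add: c_def algebra_simps)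
  qed
  define d where "d = int ((p + 1) div 2)"
  have d: "[2 * d = 1] (mod int p)"
  proof -
    have "2 * d = int p + 1" using odd by (simp add: d_def flip: of_nat_Suc) presburger
    then show ?thesis by (simp add: cong_iff_dvd_diff)
  qed
  define h where "h g = F g - int p * (c * d * (F g)\<^sup>2)" for g
  have h: "mod_hom G (p\<^sup>2) h"
    unfolding mod_hom_def
  proof (intro ballI)
    fix x y assume xy: "x \<in> carrier G" "y \<in> carrier G"
    have "[F (x \<otimes> y) = F x + F y + int p * F x * \<eta> y] (mod int (p\<^sup>2))"
      by (rule twisted_hom_mult[OF F xy])
    also have "[F x + F y + int p * F x * \<eta> y = F x + F y + int p * F x * (c * F y)] (mod int (p\<^sup>2))"
      by (intro cong_add cong_refl cong_mult_p_mod \<eta>c xy)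
    finally have 1: "[F (x \<otimes> y) = F x + F y + int p * F x * (c * F y)] (mod int (p\<^sup>2))" .
    have "[F (x \<otimes> y) = F x + F y] (mod int p)" using Fp xy by (simp add: mod_hom_def)
    then have "[c * d * (F (x \<otimes> y))\<^sup>2 = c * d * (F x + F y)\<^sup>2] (mod int p)"
      by (intro cong_mult cong_refl cong_pow)
    also have "c * d * (F x + F y)\<^sup>2 = c * d * (F x)\<^sup>2 + c * d * (F y)\<^sup>2 + 2 * d * (c * F x * F y)"
      by (simp add: power2_eq_square algebra_simps)
    also have "[c * d * (F x)\<^sup>2 + c * d * (F y)\<^sup>2 + 2 * d * (c * F x * F y) =
        c * d * (F x)\<^sup>2 + c * d * (F y)\<^sup>2 + 1 * (c * F x * F y)] (mod int p)"
      by (intro cong_add cong_refl cong_mult d)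
    finally have "[h (x \<otimes> y) = F x + F y + int p * F x * (c * F y) -
        int p * (c * d * (F x)\<^sup>2 + c * d * (F y)\<^sup>2 + 1 * (c * F x * F y))] (mod int (p\<^sup>2))"
      unfolding h_def by (intro cong_diff 1 cong_mult_p)
    then show "[h (x \<otimes> y) = h x + h y] (mod int (p\<^sup>2))" by (simp add: h_def algebra_simps)
  qed
  let ?Z = "integer_mod_group (p\<^sup>2)"
  define \<Phi> where "\<Phi> g = h g mod int (p\<^sup>2)" for g
  have \<Phi>: "\<Phi> \<in> hom G ?Z"
    using h p0 by (intro homI) (auto simp: \<Phi>_def carrier_integer_mod_group mod_hom_def cong_def mod_simps)
  interpret \<Phi>: group_hom G ?Z \<Phi>
    by (intro group_hom.intro group_hom_axioms.intro \<Phi> is_group group_integer_mod_group)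
  have "\<Phi> ` carrier G = carrier ?Z"
  proof (intro equalityI subsetI)
    fix x assume "x \<in> carrier ?Z"
    then have x: "0 \<le> x" "x < int (p\<^sup>2)" using p0 by (simp_all add: carrier_integer_mod_group)
    have "[h g0 = F g0] (mod int p)" by (simp add: h_def cong_iff_dvd_diff)
    then have "\<not> int p dvd h g0" using g0(2) by (meson cong_0_iff cong_sym cong_trans)
    moreover have "Factorial_Ring.prime (int p)" using p by simp
    ultimately have "coprime (h g0) (int (p\<^sup>2))"
      using prime_imp_coprime[of "int p" "h g0"] by (simp add: coprime_commute)
    then obtain t where t: "[h g0 * t = 1] (mod int (p\<^sup>2))" using cong_solve_coprime_int by blast
    define n where "n = nat ((t * x) mod int (p\<^sup>2))"
    have n: "[int n = t * x] (mod int (p\<^sup>2))" using p0 by (simp add: n_def cong_mod_left_int)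
    have "[h (g0 [^] n) = int n * h g0] (mod int (p\<^sup>2))" by (rule mod_hom_pow[OF h g0(1)])
    also have "[int n * h g0 = t * x * h g0] (mod int (p\<^sup>2))" by (intro cong_mult n cong_refl)
    also have "t * x * h g0 = h g0 * t * x" by simp
    also have "[h g0 * t * x = 1 * x] (mod int (p\<^sup>2))" by (intro cong_mult t cong_refl)
    finally have "\<Phi> (g0 [^] n) = x" using x by (simp add: \<Phi>_def cong_def)
    then show "x \<in> \<Phi> ` carrier G" using g0 by blast
  qed (use \<Phi>.hom_closed in blast)
  then have iso: "G Mod kernel G ?Z \<Phi> \<cong> ?Z" by (rule \<Phi>.FactGroup_iso)
  have ker: "int (p\<^sup>2) dvd h g \<longleftrightarrow> int (p\<^sup>2) dvd F g" for g
  proof -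
    have *: "int (p\<^sup>2) dvd int p * (c * d * (F g)\<^sup>2)" if "int p dvd F g"
      using that by (auto simp: power2_eq_square)
    have "int p dvd F g" if "int (p\<^sup>2) dvd h g"
    proof -
      have "int p dvd h g" using that by (simp add: power2_eq_square dvd_mult_left)
      then have "int p dvd h g + int p * (c * d * (F g)\<^sup>2)" by simp
      then show ?thesis by (simp add: h_def)
    qed
    moreover have "int p dvd F g" if "int (p\<^sup>2) dvd F g" using that by (simp add: power2_eq_square dvd_mult_left)
    ultimately show ?thesis using * by (metis dvd_diff diff_add_cancel dvd_add h_def)
  qed
  show thesis
  proof (rule that)
    show "kernel G ?Z \<Phi> \<lhd> G" by (rule \<Phi>.normal_kernel)
    show "[F g = 0] (mod int (p\<^sup>2))" if "g \<in> kernel G ?Z \<Phi>" for g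
      using that ker[of g] by (simp add: kernel_def \<Phi>_def mod_eq_0_iff_dvd cong_0_iff)
    show "g \<in> kernel G ?Z \<Phi>" if "g \<in> carrier G" "[F g = 0] (mod int (p\<^sup>2))" for g
      using that ker[of g] by (simp add: kernel_def \<Phi>_def mod_eq_0_iff_dvd cong_0_iff)
  qed (use iso in blast)
qed

text \<open>Conversely, every quotient in the list embeds in the model: \<open>\<int>/p\<^sup>2\<close> as the pairs \<open>(m, 0)\<close>.\<close>

lemma quotient_twisted_hom:
  assumes p: "1 < p" and N: "N \<lhd> G"
    and q: "trivial_group (G Mod N) \<or> G Mod N \<cong> integer_mod_group (p\<^sup>2) \<or> G Mod N \<cong> M_p3 p"
  obtains F \<eta> where "twisted_hom G p F \<eta>"
    "\<And>g. g \<in> carrier G \<Longrightarrow> g \<in> N \<longleftrightarrow> [F g = 0] (mod int (p\<^sup>2)) \<and> [\<eta> g = 0] (mod int p)"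
    "\<And>n g. n \<in> N \<Longrightarrow> g \<in> carrier G \<Longrightarrow> F (n \<otimes> g) = F g \<and> \<eta> (n \<otimes> g) = \<eta> g"
proof -
  interpret N: normal N G by (rule N)
  let ?E = "M_model p"
  have E: "group ?E" using group_M_model p by simp
  interpret Q: group "G Mod N" by (rule N.factorgroup_is_group)
  have "\<exists>i. i \<in> hom (G Mod N) ?E \<and> inj_on i (carrier (G Mod N))"
    using q
  proof (elim disjE)
    assume "trivial_group (G Mod N)"
    then obtain a where "carrier (G Mod N) = {a}" using Q.trivial_group by blast
    then show ?thesis using E
      by (intro exI[of _ "\<lambda>_. \<one>\<^bsub>?E\<^esub>"]) (auto simp: hom_def group.is_monoid)
  next
    assume "G Mod N \<cong> integer_mod_group (p\<^sup>2)"
    then obtain h where h: "h \<in> hom (G Mod N) (integer_mod_group (p\<^sup>2))" "inj_on h (carrier (G Mod N))"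
      by (auto simp: is_iso_def iso_def bij_betw_def)
    have "(\<lambda>x. (h x, 0 :: int)) \<in> hom (G Mod N) ?E"
      using h(1) p by (auto simp: hom_def Pi_iff carrier_integer_mod_group M_model_simps)
    moreover have "inj_on (\<lambda>x. (h x, 0 :: int)) (carrier (G Mod N))" using h(2) by (simp add: inj_on_def)
    ultimately show ?thesis by blast
  next
    assume "G Mod N \<cong> M_p3 p"
    then have "G Mod N \<cong> ?E" using M_p3_iso_model[OF p] iso_trans by blast
    then show ?thesis by (auto simp: is_iso_def iso_def bij_betw_def)
  qed
  then obtain i where i: "i \<in> hom (G Mod N) ?E" "inj_on i (carrier (G Mod N))" by blast
  define \<Phi> where "\<Phi> g = i (N #> g)" for g
  have \<Phi>: "\<Phi> \<in> hom G ?E"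
  proof (rule homI)
    note pr = N.r_coset_hom_Mod
    show "\<Phi> x \<in> carrier ?E" if "x \<in> carrier G" for x
      unfolding \<Phi>_def by (rule hom_in_carrier[OF i(1) hom_in_carrier[OF pr that]])
    show "\<Phi> (x \<otimes> y) = \<Phi> x \<otimes>\<^bsub>?E\<^esub> \<Phi> y" if "x \<in> carrier G" "y \<in> carrier G" for x y
      unfolding \<Phi>_def hom_mult[OF pr that]
      by (rule hom_mult[OF i(1) hom_in_carrier[OF pr that(1)] hom_in_carrier[OF pr that(2)]])
  qed
  interpret \<Phi>: group_hom G ?E \<Phi>
    by (intro group_hom.intro group_hom_axioms.intro \<Phi> is_group E)
  have cl: "\<Phi> g \<in> {0..<int (p\<^sup>2)} \<times> {0..<int p}" if "g \<in> carrier G" for g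
    using \<Phi>.hom_closed[OF that] by (simp add: M_model_simps)
  have mult: "\<Phi> (x \<otimes> y) = ((fst (\<Phi> x) + fst (\<Phi> y) + int p * fst (\<Phi> x) * snd (\<Phi> y)) mod int (p\<^sup>2),
      (snd (\<Phi> x) + snd (\<Phi> y)) mod int p)" if "x \<in> carrier G" "y \<in> carrier G" for x y
    using \<Phi>.hom_mult[OF that] M_model_simps(2)[of p "fst (\<Phi> x)" "snd (\<Phi> x)" "fst (\<Phi> y)" "snd (\<Phi> y)"] by simp
  have ker: "g \<in> N \<longleftrightarrow> \<Phi> g = (0, 0)" if g: "g \<in> carrier G" for g
  proof -
    have "g \<in> N \<longleftrightarrow> N #> g = N"
      using coset_join1[OF _ g N.subgroup_axioms] coset_join2[OF g N.subgroup_axioms] by blast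
    also have "\<dots> \<longleftrightarrow> i (N #> g) = i N"
      using inj_on_eq_iff[OF i(2) hom_in_carrier[OF N.r_coset_hom_Mod g] Q.one_closed] by simp
    also have "i N = (0, 0)"
      using hom_one[OF i(1) Q.is_group E] by (simp add: M_model_simps)
    finally show ?thesis by (simp add: \<Phi>_def)
  qed
  show thesis
  proof (rule that)
    show "twisted_hom G p (\<lambda>g. fst (\<Phi> g)) (\<lambda>g. snd (\<Phi> g))"
      unfolding twisted_hom_def mod_hom_def
      by (intro conjI ballI) (simp_all only: mult fst_conv snd_conv cong_mod_left_int)
    show "g \<in> N \<longleftrightarrow> [fst (\<Phi> g) = 0] (mod int (p\<^sup>2)) \<and> [snd (\<Phi> g) = 0] (mod int p)" if "g \<in> carrier G" for g
      using cl[OF that] ker[OF that] by (auto simp: cong_def prod_eq_iff mem_Times_iff)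
    show "fst (\<Phi> (n \<otimes> g)) = fst (\<Phi> g) \<and> snd (\<Phi> (n \<otimes> g)) = snd (\<Phi> g)" if n: "n \<in> N" "g \<in> carrier G" for n g
    proof -
      have "N #> (n \<otimes> g) = N #> n #> g" using n by (simp add: coset_mult_assoc N.subset)
      also have "N #> n = N" using n by (simp add: N.rcos_const)
      finally show ?thesis by (simp add: \<Phi>_def)
    qed
  qed
qed

end


section \<open>Cohomology classes of degree two as obstructions\<close>

context profinite_group
begin

abbreviation locally_constant :: "('a \<Rightarrow> 'c) \<Rightarrow> bool"
  where "locally_constant f \<equiv> continuous_map T (discrete_topology UNIV) f"

lemma locally_constant_compose2:
  assumes "locally_constant f" "locally_constant f'"
  shows "locally_constant (\<lambda>g. k (f g) (f' g))"
proof -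
  have "continuous_map T (discrete_topology (UNIV \<times> UNIV)) (\<lambda>g. (f g, f' g))"
    using assms unfolding prod_topology_discrete_topology by (simp add: continuous_map_paired)
  from continuous_map_discrete_post[OF this, of "\<lambda>(x, y). k x y" UNIV] show ?thesis by simp
qed

lemma locally_constant_compose: "locally_constant f \<Longrightarrow> locally_constant (\<lambda>g. k (f g))"
  using continuous_map_discrete_post[of T UNIV f k UNIV] by simp

lemma cochains1_locally_constant: "f \<in> cochains1 G T A \<Longrightarrow> locally_constant f"
  using continuous_map_discrete_post[of T "carrier A" f "\<lambda>x. x" UNIV] by (simp add: cochains1_def)

lemma locally_constant_mod_cochain:
  assumes "0 < n" "locally_constant f"
  shows "(\<lambda>g\<in>carrier G. f g mod int n) \<in> cochains1 G T (integer_mod_group n)"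
proof -
  have "continuous_map T (discrete_topology (carrier (integer_mod_group n))) (\<lambda>g. f g mod int n)"
    using assms by (intro continuous_map_discrete_post[OF assms(2)]) (simp add: mod_imgI)
  then have "continuous_map T (discrete_topology (carrier (integer_mod_group n))) (\<lambda>g\<in>carrier G. f g mod int n)"
    by (rule continuous_map_eq) (simp add: topspace_eq)
  then show ?thesis using assms(1) by (auto simp: cochains1_def mod_imgI)
qed

lemma cocycles1_iff:
  assumes n: "0 < n"
  shows "\<psi> \<in> cocycles1 G T (integer_mod_group n) \<longleftrightarrow> \<psi> \<in> cochains1 G T (integer_mod_group n) \<and> mod_hom G n \<psi>"
proof -
  have "coboundary1 G (integer_mod_group n) \<psi> (g, h) = 0 \<longleftrightarrow> [\<psi> (g \<otimes> h) = \<psi> g + \<psi> h] (mod int n)"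
    if "\<psi> \<in> cochains1 G T (integer_mod_group n)" "g \<in> carrier G" "h \<in> carrier G" for g h
  proof -
    have "coboundary1 G (integer_mod_group n) \<psi> (g, h) = (\<psi> h - \<psi> (g \<otimes> h) + \<psi> g) mod int n"
      by (rule coboundary1_mod[OF n that])
    also have "\<dots> = 0 \<longleftrightarrow> int n dvd \<psi> h - \<psi> (g \<otimes> h) + \<psi> g" by (simp add: mod_eq_0_iff_dvd)
    also have "\<dots> \<longleftrightarrow> int n dvd - (\<psi> h - \<psi> (g \<otimes> h) + \<psi> g)" by (simp only: dvd_minus_iff)
    also have "- (\<psi> h - \<psi> (g \<otimes> h) + \<psi> g) = \<psi> (g \<otimes> h) - (\<psi> g + \<psi> h)" by simp
    finally show ?thesis by (simp add: cong_iff_dvd_diff)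
  qed
  then show ?thesis by (auto simp: cocycles1_def mod_hom_def)
qed

lemma locally_constant_mod_hom_cocycle:
  assumes n: "0 < n" and f: "locally_constant f" "mod_hom G n f"
  shows "(\<lambda>g\<in>carrier G. f g mod int n) \<in> cocycles1 G T (integer_mod_group n)"
proof -
  have "mod_hom G n (\<lambda>g\<in>carrier G. f g mod int n)"
    using f(2) by (simp add: mod_hom_def cong_def mod_simps)
  then show ?thesis using locally_constant_mod_cochain[OF n f(1)] by (simp add: cocycles1_iff[OF n])
qed

text \<open>
  The condition says that \<open>c\<close> is the coboundary of \<open>f\<close>. Cochains are integer-valued maps read modulo \<open>n\<close>
  here, so that they can be added, multiplied and divided by \<open>p\<close> without reducing representatives.
\<close>

definition trivializes :: "nat \<Rightarrow> ('a \<Rightarrow> int) \<Rightarrow> ('a \<Rightarrow> 'a \<Rightarrow> int) \<Rightarrow> bool"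
  where "trivializes n f c \<longleftrightarrow> locally_constant f \<and>
    (\<forall>g\<in>carrier G. \<forall>h\<in>carrier G. [c g h = f g + f h - f (g \<otimes> h)] (mod int n))"

lemma trivializes_cong:
  assumes "trivializes n f c" "\<And>g h. g \<in> carrier G \<Longrightarrow> h \<in> carrier G \<Longrightarrow> [c' g h = c g h] (mod int n)"
  shows "trivializes n f c'"
  using assms unfolding trivializes_def by (meson cong_trans)

lemma trivializes_diff_mod_hom:
  assumes "trivializes n f c" "trivializes n f' c"
  shows "mod_hom G n (\<lambda>g. f g - f' g)"
  unfolding mod_hom_def
proof (intro ballI)
  fix x y assume xy: "x \<in> carrier G" "y \<in> carrier G"
  have "[f x + f y - f (x \<otimes> y) = c x y] (mod int n)"
    using assms(1) xy unfolding trivializes_def by (blast intro: cong_sym)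
  also have "[c x y = f' x + f' y - f' (x \<otimes> y)] (mod int n)"
    using assms(2) xy unfolding trivializes_def by blast
  finally have "int n dvd - (f x + f y - f (x \<otimes> y) - (f' x + f' y - f' (x \<otimes> y)))"
    by (simp only: cong_iff_dvd_diff dvd_minus_iff)
  then show "[f (x \<otimes> y) - f' (x \<otimes> y) = f x - f' x + (f y - f' y)] (mod int n)"
    by (simp add: cong_iff_dvd_diff algebra_simps)
qed

lemma class2_eq_one_iff:
  assumes n: "0 < n" and c: "c \<in> cocycles2 G T (integer_mod_group n)"
  shows "class2 G T (integer_mod_group n) c = \<one>\<^bsub>H2 G T (integer_mod_group n)\<^esub> \<longleftrightarrow>
    (\<exists>f. trivializes n f (curry c))"
proof -
  let ?Z = "integer_mod_group n"
  have Z: "comm_group ?Z" by simp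
  interpret C: comm_group "cocycle2_group G T ?Z" by (rule comm_group_cocycle2_group[OF Z])
  have cc: "c \<in> carrier (cocycle2_group G T ?Z)" using c by (simp add: cocycle2_group_def)
  have "class2 G T ?Z c = \<one>\<^bsub>H2 G T ?Z\<^esub> \<longleftrightarrow> c \<in> coboundaries2 G T ?Z"
    unfolding class2_def H2_def one_FactGroup
    using C.coset_join1[OF _ cc subgroup_coboundaries2[OF Z]]
      C.coset_join2[OF cc subgroup_coboundaries2[OF Z]] by blast
  also have "\<dots> \<longleftrightarrow> (\<exists>f. trivializes n f (curry c))"
  proof
    assume "c \<in> coboundaries2 G T ?Z"
    then obtain f where f: "f \<in> cochains1 G T ?Z" "c = coboundary1 G ?Z f" by (auto simp: coboundaries2_def)
    have "[curry c g h = f g + f h - f (g \<otimes> h)] (mod int n)" if "g \<in> carrier G" "h \<in> carrier G" for g h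
      using coboundary1_mod[OF n f(1) that] by (simp add: f(2) cong_def algebra_simps)
    then have "trivializes n f (curry c)"
      using cochains1_locally_constant[OF f(1)] by (simp add: trivializes_def)
    then show "\<exists>f. trivializes n f (curry c)" by (intro exI[of _ f])
  next
    assume "\<exists>f. trivializes n f (curry c)"
    then obtain f where f: "locally_constant f"
      "\<And>g h. g \<in> carrier G \<Longrightarrow> h \<in> carrier G \<Longrightarrow> [c (g, h) = f g + f h - f (g \<otimes> h)] (mod int n)"
      by (auto simp: trivializes_def)
    let ?f = "\<lambda>g\<in>carrier G. f g mod int n"
    have f': "?f \<in> cochains1 G T ?Z" by (rule locally_constant_mod_cochain[OF n f(1)])
    have "c = coboundary1 G ?Z ?f"
    proof (rule extensionalityI)
      show "c \<in> extensional (carrier G \<times> carrier G)"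
        using c by (auto simp: cocycles2_def cochains2_def PiE_def)
      show "coboundary1 G ?Z ?f \<in> extensional (carrier G \<times> carrier G)" by (simp add: coboundary1_def)
      fix x assume "x \<in> carrier G \<times> carrier G"
      then obtain g h where x: "x = (g, h)" "g \<in> carrier G" "h \<in> carrier G" by auto
      have "c (g, h) \<in> carrier ?Z"
        using c x cochains2_in[OF Z, of c g h] by (simp add: cocycles2_def)
      then have "c (g, h) = c (g, h) mod int n" using n by (simp add: carrier_integer_mod_group)
      also have "\<dots> = (f h - f (g \<otimes> h) + f g) mod int n"
        using f(2)[OF x(2,3)] by (simp add: cong_def algebra_simps)
      also have "\<dots> = coboundary1 G ?Z ?f (g, h)"
        using x by (simp add: coboundary1_mod[OF n f'] mod_aux3)
      finally show "c x = coboundary1 G ?Z ?f x" by (simp add: x(1))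
    qed
    with f' show "c \<in> coboundaries2 G T ?Z" by (auto simp: coboundaries2_def)
  qed
  finally show ?thesis .
qed

lemma class2_hom:
  "comm_group A \<Longrightarrow> class2 G T A \<in> hom (cocycle2_group G T A) (H2 G T A)"
  using normal.r_coset_hom_Mod[OF normal_coboundaries2] unfolding H2_def by (simp add: class2_def[abs_def])

lemma cup_eq_one_iff:
  assumes "0 < n" "\<psi> \<in> cocycles1 G T (integer_mod_group n)" "\<psi>' \<in> cocycles1 G T (integer_mod_group n)"
  shows "cup G T n \<psi> \<psi>' = \<one>\<^bsub>H2 G T (integer_mod_group n)\<^esub> \<longleftrightarrow> (\<exists>f. trivializes n f (\<lambda>g h. \<psi> g * \<psi>' h))"
  unfolding cup_def class2_eq_one_iff[OF assms(1) cup_cocycle[OF assms]]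
  by (intro ex_cong1 iffI; erule trivializes_cong) (simp_all add: cong_def)

text \<open>
  Let \<open>\<phi>\<close> lift \<open>\<psi>\<close> to \<open>\<int>/p\<^sup>2\<close> as in the definition of the Bockstein map, and let \<open>f\<close> trivialize the
  vanishing class \<open>\<psi> \<union> \<eta> + \<beta>(\<psi>)\<close>. Then \<open>\<phi> - p f\<close> is the first coordinate of a homomorphism into the
  model.
\<close>

lemma twisted_hom_of_bockstein:
  assumes p: "0 < p" and \<psi>: "\<psi> \<in> cocycles1 G T (integer_mod_group p)" and \<eta>: "\<eta> \<in> cocycles1 G T (integer_mod_group p)"
    and van: "cup G T p \<psi> \<eta> \<otimes>\<^bsub>H2 G T (integer_mod_group p)\<^esub> bockstein G T p \<psi> = \<one>\<^bsub>H2 G T (integer_mod_group p)\<^esub>"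
  obtains F where "twisted_hom G p F \<eta>" "locally_constant F" "\<And>g. g \<in> carrier G \<Longrightarrow> [F g = \<psi> g] (mod int p)"
proof -
  let ?Z = "integer_mod_group p" and ?Y = "integer_mod_group (p\<^sup>2)"
  have Z: "comm_group ?Z" by simp
  interpret C: comm_group "cocycle2_group G T ?Z" by (rule comm_group_cocycle2_group[OF Z])
  have car: "carrier (cocycle2_group G T ?Z) = cocycles2 G T ?Z" by (simp add: cocycle2_group_def)
  obtain \<phi> c where \<phi>: "\<phi> \<in> cochains1 G T ?Y" "c \<in> cocycles2 G T ?Z"
      "\<And>g. g \<in> carrier G \<Longrightarrow> \<phi> g mod int p = \<psi> g"
      "\<And>x. x \<in> carrier G \<times> carrier G \<Longrightarrow> coboundary1 G ?Y \<phi> x = int p * c x"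
    using bockstein_exists[OF p \<psi>] by blast
  let ?u = "\<lambda>(g, h) \<in> carrier G \<times> carrier G. (\<psi> g * \<eta> h) mod int p"
  have u: "?u \<in> cocycles2 G T ?Z" by (rule cup_cocycle[OF p \<psi> \<eta>])
  have "class2 G T ?Z (?u \<otimes>\<^bsub>cocycle2_group G T ?Z\<^esub> c) = \<one>\<^bsub>H2 G T ?Z\<^esub>"
    using van hom_mult[OF class2_hom[OF Z], of ?u c] u \<phi>(2) bockstein_eqI[OF p \<phi>] by (simp only: car cup_def)
  moreover have "?u \<otimes>\<^bsub>cocycle2_group G T ?Z\<^esub> c \<in> cocycles2 G T ?Z"
    using C.m_closed[of ?u c] u \<phi>(2) by (simp only: car)
  ultimately obtain f where "trivializes p f (curry (?u \<otimes>\<^bsub>cocycle2_group G T ?Z\<^esub> c))"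
    using class2_eq_one_iff[OF p] by blast
  then have f: "locally_constant f"
    "\<And>g h. g \<in> carrier G \<Longrightarrow> h \<in> carrier G \<Longrightarrow> [\<psi> g * \<eta> h + c (g, h) = f g + f h - f (g \<otimes> h)] (mod int p)"
    by (simp_all add: trivializes_def cocycle2_group_def cong_def mod_simps)
  define F where "F g = \<phi> g - int p * f g" for g
  have F\<psi>: "[F g = \<psi> g] (mod int p)" if "g \<in> carrier G" for g
  proof -
    have "[F g = \<phi> g] (mod int p)" by (simp add: F_def cong_iff_dvd_diff)
    also have "[\<phi> g = \<psi> g] (mod int p)" using \<phi>(3)[OF that] by (metis cong_mod_left_int cong_sym)
    finally show ?thesis .
  qed
  show thesis
  proof (rule that)
    have "[F (g \<otimes> h) = F g + F h + int p * F g * \<eta> h] (mod int (p\<^sup>2))" if gh: "g \<in> carrier G" "h \<in> carrier G" for g h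
    proof -
      have "[\<phi> g + \<phi> h - \<phi> (g \<otimes> h) = int p * c (g, h)] (mod int (p\<^sup>2))"
        using coboundary1_mod[OF _ \<phi>(1) gh] \<phi>(4)[of "(g, h)"] gh p
        by (metis (no_types, lifting) SigmaI add.commute add_diff_eq cong_mod_left_int cong_sym diff_add_eq pos2 zero_less_power)
      from cong_add[OF this cong_mult_p[OF f(2)[OF gh]]]
      have "[F (g \<otimes> h) = F g + F h + int p * \<psi> g * \<eta> h] (mod int (p\<^sup>2))"
        by (subst cong_sym_eq) (simp add: F_def cong_iff_dvd_diff algebra_simps)
      also have "[F g + F h + int p * \<psi> g * \<eta> h = F g + F h + int p * F g * \<eta> h] (mod int (p\<^sup>2))"
        by (intro cong_add cong_refl cong_mult_p_mod cong_sym[OF F\<psi>] gh)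
      finally show ?thesis .
    qed
    moreover have "mod_hom G p \<eta>" using \<eta> by (simp add: cocycles1_iff[OF p])
    ultimately show "twisted_hom G p F \<eta>" by (simp add: twisted_hom_def)
    show "locally_constant F"
      unfolding F_def using cochains1_locally_constant[OF \<phi>(1)] f(1) by (rule locally_constant_compose2)
  qed (rule F\<psi>)
qed

end


section \<open>The kernel of the cup product\<close>

context profinite_group
begin

lemma cocycle2_group_mult_apply:
  "x \<in> carrier G \<times> carrier G \<Longrightarrow>
    (c \<otimes>\<^bsub>cocycle2_group G T (integer_mod_group n)\<^esub> d) x = (c x + d x) mod int n"
  by (simp add: cocycle2_group_def)

lemma cocycle2_group_one_apply:
  "x \<in> carrier G \<times> carrier G \<Longrightarrow> \<one>\<^bsub>cocycle2_group G T (integer_mod_group n)\<^esub> x = 0"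
  by (simp add: cocycle2_group_def)

lemma carrier_cocycle2_group: "carrier (cocycle2_group G T A) = cocycles2 G T A"
  by (simp add: cocycle2_group_def)

lemma carrier_H1: "carrier (H1 G T A) = cocycles1 G T A"
  by (simp add: H1_def)

lemma subgroup_trivialized_vanishing_at:
  assumes n: "0 < n"
  shows "subgroup {c \<in> cocycles2 G T (integer_mod_group n).
      \<exists>f. trivializes n f (curry c) \<and> [f \<sigma> = 0] (mod int n)} (cocycle2_group G T (integer_mod_group n))"
    (is "subgroup ?D ?C")
proof -
  interpret C: comm_group ?C by (rule comm_group_cocycle2_group) simp
  show ?thesis
  proof (rule C.subgroupI)
    show "?D \<subseteq> carrier ?C" by (auto simp: carrier_cocycle2_group)
    have "\<one>\<^bsub>?C\<^esub> \<in> cocycles2 G T (integer_mod_group n)" using C.one_closed by (simp only: carrier_cocycle2_group)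
    moreover have "trivializes n (\<lambda>_. 0) (curry \<one>\<^bsub>?C\<^esub>)"
      by (simp add: trivializes_def cocycle2_group_one_apply)
    ultimately have "\<one>\<^bsub>?C\<^esub> \<in> ?D" by auto
    then show "?D \<noteq> {}" by blast
  next
    fix c assume c: "c \<in> ?D"
    then have cC: "c \<in> carrier ?C" by (simp add: carrier_cocycle2_group)
    from c obtain f where f: "trivializes n f (curry c)" "[f \<sigma> = 0] (mod int n)" by blast
    have "trivializes n (\<lambda>g. - f g) (curry (inv\<^bsub>?C\<^esub> c))"
      unfolding trivializes_def
    proof (intro conjI ballI)
      show "locally_constant (\<lambda>g. - f g)"
        using f(1) by (intro locally_constant_compose[of f uminus]) (simp add: trivializes_def)
      fix g h assume gh: "g \<in> carrier G" "h \<in> carrier G"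
      have "(c \<otimes>\<^bsub>?C\<^esub> inv\<^bsub>?C\<^esub> c) (g, h) = 0"
        unfolding C.r_inv[OF cC] using gh by (simp add: cocycle2_group_one_apply)
      then have "int n dvd c (g, h) + (inv\<^bsub>?C\<^esub> c) (g, h)"
        using gh by (simp add: cocycle2_group_mult_apply mod_eq_0_iff_dvd)
      moreover have "int n dvd c (g, h) - (f g + f h - f (g \<otimes> h))"
        using f(1) gh by (simp add: trivializes_def cong_iff_dvd_diff)
      ultimately have "int n dvd (c (g, h) + (inv\<^bsub>?C\<^esub> c) (g, h)) - (c (g, h) - (f g + f h - f (g \<otimes> h)))"
        by (rule dvd_diff)
      then show "[curry (inv\<^bsub>?C\<^esub> c) g h = - f g + - f h - - f (g \<otimes> h)] (mod int n)"
        by (simp add: cong_iff_dvd_diff algebra_simps)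
    qed
    moreover have "[- f \<sigma> = 0] (mod int n)" using f(2) by (simp add: cong_0_iff)
    moreover have "inv\<^bsub>?C\<^esub> c \<in> cocycles2 G T (integer_mod_group n)"
      using C.inv_closed[OF cC] by (simp only: carrier_cocycle2_group)
    ultimately show "inv\<^bsub>?C\<^esub> c \<in> ?D" by blast
  next
    fix c d assume cd: "c \<in> ?D" "d \<in> ?D"
    then have cC: "c \<in> carrier ?C" "d \<in> carrier ?C" by (simp_all add: carrier_cocycle2_group)
    obtain f where f: "trivializes n f (curry c)" "[f \<sigma> = 0] (mod int n)" using cd by blast
    obtain e where e: "trivializes n e (curry d)" "[e \<sigma> = 0] (mod int n)" using cd by blast
    have "trivializes n (\<lambda>g. f g + e g) (curry (c \<otimes>\<^bsub>?C\<^esub> d))"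
      unfolding trivializes_def
    proof (intro conjI ballI)
      show "locally_constant (\<lambda>g. f g + e g)"
        using f(1) e(1) by (intro locally_constant_compose2[of f e "(+)"]) (simp_all add: trivializes_def)
      fix g h assume gh: "g \<in> carrier G" "h \<in> carrier G"
      have "[c (g, h) + d (g, h) = (f g + f h - f (g \<otimes> h)) + (e g + e h - e (g \<otimes> h))] (mod int n)"
        using f(1) e(1) gh by (intro cong_add) (simp_all add: trivializes_def)
      then show "[curry (c \<otimes>\<^bsub>?C\<^esub> d) g h = f g + e g + (f h + e h) - (f (g \<otimes> h) + e (g \<otimes> h))] (mod int n)"
        using gh by (simp add: cocycle2_group_mult_apply cong_def algebra_simps)
    qed
    moreover have "[f \<sigma> + e \<sigma> = 0] (mod int n)" using cong_add[OF f(2) e(2)] by simp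
    moreover have "c \<otimes>\<^bsub>?C\<^esub> d \<in> cocycles2 G T (integer_mod_group n)"
      using C.m_closed[OF cC] by (simp only: carrier_cocycle2_group)
    ultimately show "c \<otimes>\<^bsub>?C\<^esub> d \<in> ?D" by blast
  qed
qed

text \<open>
  The cup product is already bilinear on cocycles, so it lifts to a homomorphism from the tensor
  square to the group of 2-cocycles. If the kernel of the cup product on cohomology is generated by
  pure tensors, every 2-cocycle coming from the kernel is therefore a sum of cocycles
  \<open>\<psi>(g) \<psi>'(h)\<close> that are coboundaries individually, and their trivializations add up to one of the whole.
  Any other trivialization differs from that one by a character.
\<close>

lemma trivialization_vanishes_at:
  fixes n :: nat and \<sigma>
  defines "A \<equiv> integer_mod_group n" and "H \<equiv> H1 G T (integer_mod_group n)"
  assumes n: "0 < n" and \<sigma>: "\<sigma> \<in> carrier G"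
    and S: "S \<subseteq> {pure_tensor H H \<psi> \<psi>' | \<psi> \<psi>'. \<psi> \<in> carrier H \<and> \<psi>' \<in> carrier H}"
    and ker: "kernel (tensor_group H H) (H2 G T A) (tensor_lift H H (H2 G T A) (cup G T n))
      = generate (tensor_group H H) S"
    and pure: "\<And>\<psi> \<psi>' f. \<psi> \<in> carrier H \<Longrightarrow> \<psi>' \<in> carrier H \<Longrightarrow> trivializes n f (\<lambda>g h. \<psi> g * \<psi>' h)
      \<Longrightarrow> [f \<sigma> = 0] (mod int n)"
    and char: "\<And>\<theta>. mod_hom G n \<theta> \<Longrightarrow> locally_constant \<theta> \<Longrightarrow> [\<theta> \<sigma> = 0] (mod int n)"
    and ts: "\<And>u v. (u, v) \<in> set ts \<Longrightarrow> mod_hom G n u \<and> locally_constant u \<and> mod_hom G n v \<and> locally_constant v"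
    and f: "trivializes n f (\<lambda>g h. \<Sum>(u, v)\<leftarrow>ts. u g * v h)"
  shows "[f \<sigma> = 0] (mod int n)"
proof -
  let ?TG = "tensor_group H H" and ?C = "cocycle2_group G T A"
  have A: "comm_group A" by (simp add: A_def)
  have HA: "H = H1 G T A" by (simp add: H_def A_def)
  have H: "group H" unfolding HA by (rule group_H1[OF A])
  have carH: "carrier H = cocycles1 G T (integer_mod_group n)" by (simp add: H_def carrier_H1)
  interpret C: comm_group ?C by (rule comm_group_cocycle2_group[OF A])
  interpret TG: group ?TG
    unfolding tensor_group_def by (rule normal.factorgroup_is_group[OF normal_tensor_kernel[OF H H]])
  interpret H2: comm_group "H2 G T A" by (rule comm_group_H2[OF A])
  define u where "u \<psi> \<psi>' = (\<lambda>(g, h) \<in> carrier G \<times> carrier G. (\<psi> g * \<psi>' h) mod int n)" for \<psi> \<psi>' :: "'a \<Rightarrow> int"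
  have uC: "u \<psi> \<psi>' \<in> cocycles2 G T A" if "\<psi> \<in> carrier H" "\<psi>' \<in> carrier H" for \<psi> \<psi>'
    using cup_cocycle[OF n] that unfolding carH u_def A_def by blast
  have cup_u: "cup G T n \<psi> \<psi>' = class2 G T A (u \<psi> \<psi>')" for \<psi> \<psi>' by (simp add: cup_def u_def A_def)
  have pureT: "pure_tensor H H \<psi> \<psi>' \<in> carrier ?TG" if "\<psi> \<in> carrier H" "\<psi>' \<in> carrier H" for \<psi> \<psi>'
    using that by (auto simp: pure_tensor_def tensor_group_def carrier_FactGroup)
  obtain R where R: "R \<in> hom ?TG ?C"
    "\<And>\<psi> \<psi>'. \<psi> \<in> carrier H \<Longrightarrow> \<psi>' \<in> carrier H \<Longrightarrow> R (pure_tensor H H \<psi> \<psi>') = u \<psi> \<psi>'"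
  proof -
    have "\<exists>!h. h \<in> hom ?TG ?C \<and> h \<in> extensional (carrier ?TG) \<and>
      (\<forall>a \<in> carrier H. \<forall>b \<in> carrier H. h (pure_tensor H H a b) = u a b)"
    proof (rule tensor_lift_ex1[OF H H C.comm_group_axioms])
      show "u a b \<in> carrier ?C" if "a \<in> carrier H" "b \<in> carrier H" for a b
        using uC[OF that] by (simp add: carrier_cocycle2_group)
      show "u (a \<otimes>\<^bsub>H\<^esub> a') b = u a b \<otimes>\<^bsub>?C\<^esub> u a' b" if "a \<in> carrier H" "a' \<in> carrier H" "b \<in> carrier H" for a a' b
        by (auto simp: u_def H_def H1_def A_def cocycle2_group_def mod_simps distrib_right)
      show "u a (b \<otimes>\<^bsub>H\<^esub> b') = u a b \<otimes>\<^bsub>?C\<^esub> u a b'" if "a \<in> carrier H" "b \<in> carrier H" "b' \<in> carrier H" for a b b'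
        by (auto simp: u_def H_def H1_def A_def cocycle2_group_def mod_simps distrib_left)
    qed
    then show thesis using that by blast
  qed
  let ?L = "tensor_lift H H (H2 G T A) (cup G T n)"
  have L: "?L \<in> hom ?TG (H2 G T A)"
    "\<And>\<psi> \<psi>'. \<psi> \<in> carrier H \<Longrightarrow> \<psi>' \<in> carrier H \<Longrightarrow> ?L (pure_tensor H H \<psi> \<psi>') = cup G T n \<psi> \<psi>'"
    using theI'[OF cup_tensor_lift_ex1[OF n]] unfolding tensor_lift_def A_def H_def by blast+
  interpret R: group_hom ?TG ?C R by (intro group_hom.intro group_hom_axioms.intro R TG.is_group C.is_group)
  interpret L: group_hom ?TG "H2 G T A" ?L by (intro group_hom.intro group_hom_axioms.intro L TG.is_group H2.is_group)
  interpret cl: group_hom ?C "H2 G T A" "class2 G T A"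
    by (intro group_hom.intro group_hom_axioms.intro class2_hom A C.is_group H2.is_group)
  have "\<exists>t\<in>carrier ?TG. ?L t = class2 G T A (R t) \<and>
    (\<forall>g\<in>carrier G. \<forall>h\<in>carrier G. [R t (g, h) = (\<Sum>(u, v)\<leftarrow>ts. u g * v h)] (mod int n))"
    using ts
  proof (induction ts)
    case Nil
    show ?case
      using R.hom_one L.hom_one cl.hom_one by (intro bexI[of _ "\<one>\<^bsub>?TG\<^esub>"]) (simp_all add: cocycle2_group_one_apply A_def)
  next
    case (Cons a ts)
    obtain w v where a: "a = (w, v)" by force
    obtain t where t: "t \<in> carrier ?TG" "?L t = class2 G T A (R t)"
      "\<And>g h. g \<in> carrier G \<Longrightarrow> h \<in> carrier G \<Longrightarrow> [R t (g, h) = (\<Sum>(u, v)\<leftarrow>ts. u g * v h)] (mod int n)"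
      using Cons.IH[OF Cons.prems[OF list.set_intros(2)]] by blast
    let ?w = "\<lambda>g\<in>carrier G. w g mod int n" and ?v = "\<lambda>g\<in>carrier G. v g mod int n"
    have wv: "?w \<in> carrier H" "?v \<in> carrier H"
      using Cons.prems[of w v] locally_constant_mod_hom_cocycle[OF n] by (simp_all add: a carH)
    let ?t = "pure_tensor H H ?w ?v \<otimes>\<^bsub>?TG\<^esub> t"
    have uc: "u ?w ?v \<in> carrier ?C" unfolding carrier_cocycle2_group by (rule uC[OF wv])
    have "?L ?t = class2 G T A (R ?t)"
      by (simp only: L.hom_mult[OF pureT[OF wv] t(1)] R.hom_mult[OF pureT[OF wv] t(1)] L(2)[OF wv] R(2)[OF wv]
          cup_u t(2) cl.hom_mult[OF uc R.hom_closed[OF t(1)]])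
    moreover have "[R ?t (g, h) = (\<Sum>(u, v)\<leftarrow>a # ts. u g * v h)] (mod int n)" if gh: "g \<in> carrier G" "h \<in> carrier G" for g h
    proof -
      have "R ?t (g, h) = ((?w g * ?v h) mod int n + R t (g, h)) mod int n"
        using t(1) pureT[OF wv] gh by (simp add: R(2)[OF wv]) (simp add: A_def cocycle2_group_mult_apply u_def)
      also have "\<dots> = (w g * v h + R t (g, h)) mod int n" using gh by (simp add: mod_simps)
      finally have "[R ?t (g, h) = w g * v h + R t (g, h)] (mod int n)" by (simp add: cong_mod_left_int)
      also have "[w g * v h + R t (g, h) = w g * v h + (\<Sum>(u, v)\<leftarrow>ts. u g * v h)] (mod int n)"
        by (intro cong_add cong_refl t(3) gh)
      finally show ?thesis by (simp add: a)
    qed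
    ultimately show ?case using t(1) pureT[OF wv] by (intro bexI[of _ ?t]) auto
  qed
  then obtain t where t: "t \<in> carrier ?TG" "?L t = class2 G T A (R t)"
    "\<And>g h. g \<in> carrier G \<Longrightarrow> h \<in> carrier G \<Longrightarrow> [R t (g, h) = (\<Sum>(u, v)\<leftarrow>ts. u g * v h)] (mod int n)" by blast
  have Rt: "trivializes n f (curry (R t))"
    using f by (rule trivializes_cong) (simp add: t(3))
  have RtC: "R t \<in> cocycles2 G T A" using R.hom_closed[OF t(1)] by (simp only: carrier_cocycle2_group)
  have "class2 G T A (R t) = \<one>\<^bsub>H2 G T A\<^esub>"
    using class2_eq_one_iff[OF n RtC[unfolded A_def]] Rt unfolding A_def by blast
  then have tker: "t \<in> generate ?TG S" using t ker by (auto simp: kernel_def)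
  let ?D = "{c \<in> cocycles2 G T A. \<exists>f. trivializes n f (curry c) \<and> [f \<sigma> = 0] (mod int n)}"
  have D: "subgroup ?D ?C" unfolding A_def by (rule subgroup_trivialized_vanishing_at[OF n])
  have ST: "S \<subseteq> carrier ?TG" using S pureT by blast
  have "R ` S \<subseteq> ?D"
  proof
    fix c assume "c \<in> R ` S"
    then obtain s where s: "s \<in> S" "c = R s" by blast
    with S obtain \<psi> \<psi>' where \<psi>: "\<psi> \<in> carrier H" "\<psi>' \<in> carrier H" "s = pure_tensor H H \<psi> \<psi>'" by blast
    have "s \<in> generate ?TG S" using s(1) by (rule generate.incl)
    then have "?L s = \<one>\<^bsub>H2 G T A\<^esub>" unfolding ker[symmetric] by (simp add: kernel_def)
    then have "cup G T n \<psi> \<psi>' = \<one>\<^bsub>H2 G T A\<^esub>" by (simp add: \<psi>(3) L(2)[OF \<psi>(1,2)])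
    then obtain e where e: "trivializes n e (\<lambda>g h. \<psi> g * \<psi>' h)"
      using cup_eq_one_iff[OF n \<psi>(1,2)[unfolded carH]] unfolding A_def by blast
    have "trivializes n e (curry c)"
      using e by (rule trivializes_cong) (simp add: s(2) \<psi>(3) R(2)[OF \<psi>(1,2)] u_def cong_mod_left_int)
    moreover have "[e \<sigma> = 0] (mod int n)" by (rule pure[OF \<psi>(1,2) e])
    moreover have "c \<in> cocycles2 G T A" using uC[OF \<psi>(1,2)] by (simp add: s(2) \<psi>(3) R(2)[OF \<psi>(1,2)])
    ultimately show "c \<in> ?D" by blast
  qed
  then have "generate ?C (R ` S) \<subseteq> ?D" by (rule C.generate_subgroup_incl[OF _ D])
  then have "R t \<in> ?D" using tker R.generate_img[OF ST] by blast
  then obtain e where e: "trivializes n e (curry (R t))" "[e \<sigma> = 0] (mod int n)" by blast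
  have "[f \<sigma> - e \<sigma> = 0] (mod int n)"
    by (rule char[OF trivializes_diff_mod_hom[OF Rt e(1)]], rule locally_constant_compose2[of f e "(-)"])
      (use Rt e(1) in \<open>simp_all add: trivializes_def\<close>)
  from cong_add[OF this e(2)] show ?thesis by simp
qed

end


section \<open>The descending \<open>p\<close>-central series\<close>

context profinite_group
begin

lemma subgroup_containing_open_open:
  assumes "subgroup N G" "openin T K" "K \<subseteq> N" "\<one> \<in> K"
  shows "openin T N"
proof -
  have NG: "N \<subseteq> carrier G" using assms(1) by (rule subgroup.subset)
  have "N = (\<Union>n\<in>N. K #> n)"
  proof (intro equalityI subsetI)
    fix n assume "n \<in> N"
    moreover from this have "n = \<one> \<otimes> n" using NG by auto
    ultimately show "n \<in> (\<Union>n\<in>N. K #> n)" using assms(4) unfolding r_coset_def by blast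
  next
    fix x assume "x \<in> (\<Union>n\<in>N. K #> n)"
    then obtain n k where "n \<in> N" "k \<in> K" "x = k \<otimes> n" by (auto simp: r_coset_def)
    then show "x \<in> N" using assms(1,3) by (auto intro: subgroup.m_closed)
  qed
  also have "openin T \<dots>" by (intro openin_Union) (use NG openin_r_coset[OF assms(2)] in auto)
  finally show ?thesis .
qed

lemma closed_generate_incl: "S \<subseteq> closed_generate G T S"
  by (auto simp: closed_generate_def)

lemma closed_generate_least:
  "subgroup K G \<Longrightarrow> closedin T K \<Longrightarrow> S \<subseteq> K \<Longrightarrow> closed_generate G T S \<subseteq> K"
  by (auto simp: closed_generate_def)

lemma
  assumes "S \<subseteq> carrier G"
  shows subgroup_closed_generate: "subgroup (closed_generate G T S) G"
    and closedin_closed_generate: "closedin T (closed_generate G T S)"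
proof -
  have ne: "carrier G \<in> {K. subgroup K G \<and> closedin T K \<and> S \<subseteq> K}"
    using assms subgroup_self closedin_topspace[of T] by (simp add: topspace_eq)
  show "subgroup (closed_generate G T S) G"
    unfolding closed_generate_def using ne by (intro subgroups_Inter) auto
  show "closedin T (closed_generate G T S)"
    unfolding closed_generate_def using ne by (intro closedin_Inter) auto
qed

lemma p_central_step_generators:
  assumes "H \<subseteq> carrier G"
  shows "{h [^] (p::nat) | h. h \<in> H} \<union> {grp_commutator G h g | h g. h \<in> H \<and> g \<in> carrier G} \<subseteq> carrier G"
  using assms by (auto simp: grp_commutator_closed subset_iff)

lemma
  assumes "H \<subseteq> carrier G"
  shows subgroup_p_central_step: "subgroup (p_central_step G T p H) G"
    and closedin_p_central_step: "closedin T (p_central_step G T p H)"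
  unfolding p_central_step_def
  by (intro subgroup_closed_generate closedin_closed_generate p_central_step_generators assms)+

lemma
  shows pow_in_p_central_step: "h \<in> H \<Longrightarrow> h [^] p \<in> p_central_step G T p H"
    and commutator_in_p_central_step:
      "h \<in> H \<Longrightarrow> g \<in> carrier G \<Longrightarrow> grp_commutator G h g \<in> p_central_step G T p H"
  unfolding p_central_step_def by (rule subsetD[OF closed_generate_incl], blast)+

lemma p_central_step_mono:
  assumes "H \<subseteq> H'" "H' \<subseteq> carrier G"
  shows "p_central_step G T p H \<subseteq> p_central_step G T p H'"
proof -
  have "{h [^] p | h. h \<in> H} \<union> {grp_commutator G h g | h g. h \<in> H \<and> g \<in> carrier G}
    \<subseteq> p_central_step G T p H'"
    using assms(1) pow_in_p_central_step[of _ H' p] commutator_in_p_central_step[of _ H' _ p] by blast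
  then show ?thesis
    unfolding p_central_step_def[of G T p H]
    by (intro closed_generate_least subgroup_p_central_step closedin_p_central_step assms(2))
qed

lemma p_central_step_least:
  assumes "subgroup K G" "closedin T K"
    and "\<And>h. h \<in> H \<Longrightarrow> h [^] p \<in> K" "\<And>h g. h \<in> H \<Longrightarrow> g \<in> carrier G \<Longrightarrow> grp_commutator G h g \<in> K"
  shows "p_central_step G T p H \<subseteq> K"
  unfolding p_central_step_def
  by (rule closed_generate_least[OF assms(1,2)]) (use assms(3,4) in blast)

text \<open>A conjugate \<open>x h x\<^bsup>-1\<^esup>\<close> differs from \<open>h\<close> by the commutator \<open>[h, x\<^bsup>-1\<^esup>]\<close>, which lies in the next term.\<close>

lemma normal_p_central_step:
  assumes H: "H \<subseteq> carrier G" and K: "p_central_step G T p H \<subseteq> H"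
  shows "p_central_step G T p H \<lhd> G"
  unfolding normal_inv_iff
proof (intro conjI ballI)
  let ?K = "p_central_step G T p H"
  show sK: "subgroup ?K G" by (rule subgroup_p_central_step[OF H])
  fix x h assume x: "x \<in> carrier G" and h: "h \<in> ?K"
  have hG: "h \<in> carrier G" using h H K by blast
  have c: "grp_commutator G h (inv x) \<in> ?K"
    using h K x by (intro commutator_in_p_central_step) auto
  have "h \<otimes> grp_commutator G h (inv x) = x \<otimes> h \<otimes> inv x"
    using x hG by (simp add: grp_commutator_def m_assoc[symmetric])
  then show "x \<otimes> h \<otimes> inv x \<in> ?K" using subgroup.m_closed[OF sK h c] by simp
qed

text \<open>
  In a quotient that embeds in the model, \<open>p\<close>-th powers and commutators lie in the central subgroup
  of the pairs \<open>(p a, 0)\<close>, which has exponent \<open>p\<close>.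
\<close>

lemma p_central_series_3_le_quotient_kernel:
  assumes p: "Factorial_Ring.prime p" "p \<noteq> 2" and N: "N \<lhd> G" "openin T N"
    and q: "trivial_group (G Mod N) \<or> G Mod N \<cong> integer_mod_group (p\<^sup>2) \<or> G Mod N \<cong> M_p3 p"
  shows "p_central_step G T p (p_central_step G T p (carrier G)) \<subseteq> N"
proof -
  have sN: "subgroup N G" using N(1) by (rule normal_imp_subgroup)
  have p1: "1 < p" using prime_gt_1_nat[OF p(1)] .
  obtain F \<eta> where F: "twisted_hom G p F \<eta>"
    "\<And>g. g \<in> carrier G \<Longrightarrow> g \<in> N \<longleftrightarrow> [F g = 0] (mod int (p\<^sup>2)) \<and> [\<eta> g = 0] (mod int p)"
    "\<And>n g. n \<in> N \<Longrightarrow> g \<in> carrier G \<Longrightarrow> F (n \<otimes> g) = F g \<and> \<eta> (n \<otimes> g) = \<eta> g"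
    using quotient_twisted_hom[OF p1 N(1) q] by blast
  have Fp: "mod_hom G p F" by (rule twisted_hom_mod_hom[OF F(1)])
  have \<eta>p: "mod_hom G p \<eta>" using F(1) by (simp add: twisted_hom_def)
  let ?K = "{g \<in> carrier G. [F g = 0] (mod int p)} \<inter> {g \<in> carrier G. [\<eta> g = 0] (mod int p)}"
  have sK: "subgroup ?K G" by (intro subgroups_Inter_pair mod_hom_kernel_subgroup Fp \<eta>p)
  have NK: "N \<subseteq> ?K" using F(2) subgroup.subset[OF sN] cong_p2_imp_p by blast
  have cK: "closedin T ?K"
    by (rule open_subgroup_closedin[OF sK subgroup_containing_open_open[OF sK N(2) NK subgroup.one_closed[OF sN]]])
  have pow0: "[int p * a = 0] (mod int p)" for a by (simp add: cong_0_iff)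
  have \<eta>pow: "[\<eta> (h [^] p) = 0] (mod int p)" if "h \<in> carrier G" for h
    by (rule cong_trans[OF mod_hom_pow[OF \<eta>p that] pow0])
  have G2: "p_central_step G T p (carrier G) \<subseteq> ?K"
  proof (rule p_central_step_least[OF sK cK])
    fix h assume h: "h \<in> carrier G"
    have "[F (h [^] p) = 0] (mod int p)" by (rule cong_trans[OF mod_hom_pow[OF Fp h] pow0])
    then show "h [^] p \<in> ?K" using \<eta>pow[OF h] h by simp
  next
    fix h g assume "h \<in> carrier G" "g \<in> carrier G"
    then show "grp_commutator G h g \<in> ?K"
      by (simp add: mod_hom_commutator[OF Fp] mod_hom_commutator[OF \<eta>p] grp_commutator_closed)
  qed
  show ?thesis
  proof (rule p_central_step_least[OF sN open_subgroup_closedin[OF sN N(2)]])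
    fix h assume "h \<in> p_central_step G T p (carrier G)"
    with G2 have h: "h \<in> carrier G" "[F h = 0] (mod int p)" "[\<eta> h = 0] (mod int p)" by blast+
    have "[F (h [^] (p * 1)) = int (p * 1) * F h] (mod int (p\<^sup>2))" by (rule twisted_hom_pow[OF p F(1) h(1)])
    then have "[F (h [^] p) = int p * F h] (mod int (p\<^sup>2))" by simp
    also have "[int p * F h = int p * 0] (mod int (p\<^sup>2))" by (rule cong_mult_p[OF h(2)])
    finally show "h [^] p \<in> N" using F(2)[of "h [^] p"] h(1) \<eta>pow by simp
    fix g assume g: "g \<in> carrier G"
    let ?c = "grp_commutator G h g"
    have c: "?c \<in> carrier G" using h g by (simp add: grp_commutator_closed)
    have "[F (g \<otimes> h \<otimes> ?c) = F (g \<otimes> h) + F ?c] (mod int (p\<^sup>2))"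
      by (rule twisted_hom_add[OF F(1)]) (use g h c mod_hom_commutator[OF \<eta>p h(1) g] in simp_all)
    also have "[F (g \<otimes> h) + F ?c = (F g + F h) + F ?c] (mod int (p\<^sup>2))"
      by (intro cong_add twisted_hom_add[OF F(1)] cong_refl) (use g h in simp_all)
    finally have 1: "[F (g \<otimes> h \<otimes> ?c) = F g + F h + F ?c] (mod int (p\<^sup>2))" .
    have "[F (h \<otimes> g) = F h + F g] (mod int (p\<^sup>2))"
      by (rule twisted_hom_add[OF F(1)]) (use g h in simp_all)
    then have "[F h + F g = F (g \<otimes> h \<otimes> ?c)] (mod int (p\<^sup>2))"
      unfolding grp_commutator_swap[OF h(1) g, symmetric] by (rule cong_sym)
    from cong_trans[OF this 1] have "[F ?c = 0] (mod int (p\<^sup>2))"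
      by (simp add: cong_iff_dvd_diff)
    then show "?c \<in> N" using F(2)[OF c] mod_hom_commutator[OF \<eta>p h(1) g] by simp
  qed
qed

end


section \<open>Elements that no quotient of the list detects\<close>

locale undetected_element = profinite_group +
  fixes p :: nat and \<sigma>
  assumes prime_p: "Factorial_Ring.prime p" and odd_p: "p \<noteq> 2" and \<sigma>: "\<sigma> \<in> carrier G"
    and grt: "galois_relation_type G T p"
    and undetected: "\<And>N. N \<lhd> G \<Longrightarrow> openin T N \<Longrightarrow>
      G Mod N \<cong> integer_mod_group (p\<^sup>2) \<or> G Mod N \<cong> M_p3 p \<Longrightarrow> \<sigma> \<in> N"
begin

lemma p_pos: "0 < p"
  using prime_gt_0_nat[OF prime_p] .

abbreviation Z where "Z \<equiv> integer_mod_group p"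

lemma twisted_hom_vanishes_if_nonzero_mod_p:
  assumes F: "twisted_hom G p F \<eta>" "locally_constant F" "locally_constant \<eta>"
    and g0: "g0 \<in> carrier G" "\<not> [F g0 = 0] (mod int p)"
  shows "[F \<sigma> = 0] (mod int (p\<^sup>2))"
proof -
  obtain N where N: "N \<lhd> G" "G Mod N \<cong> integer_mod_group (p\<^sup>2) \<or> G Mod N \<cong> M_p3 p"
    "\<And>g. g \<in> N \<Longrightarrow> [F g = 0] (mod int (p\<^sup>2))"
    "\<And>g. g \<in> carrier G \<Longrightarrow> [F g = 0] (mod int (p\<^sup>2)) \<Longrightarrow> [\<eta> g = 0] (mod int p) \<Longrightarrow> g \<in> N"
    using twisted_hom_quotient[OF prime_p odd_p F(1) g0] by blast
  let ?K = "{g \<in> topspace T. F g \<in> {x. [x = 0] (mod int (p\<^sup>2))}} \<inter>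
    {g \<in> topspace T. \<eta> g \<in> {x. [x = 0] (mod int p)}}"
  have "openin T ?K"
    by (intro openin_Int openin_continuous_map_preimage[OF F(2)] openin_continuous_map_preimage[OF F(3)])
      simp_all
  moreover have "?K \<subseteq> N" using N(4) by (auto simp: topspace_eq)
  moreover have "[\<eta> \<one> = 0] (mod int p)" using F(1) by (intro mod_hom_one) (simp add: twisted_hom_def)
  then have "\<one> \<in> ?K" using twisted_hom_one[OF F(1)] by (simp add: topspace_eq)
  ultimately have "openin T N"
    by (intro subgroup_containing_open_open[OF normal_imp_subgroup[OF N(1)]])
  then have "\<sigma> \<in> N" by (rule undetected[OF N(1) _ N(2)])
  then show ?thesis by (rule N(3))
qed

lemma bockstein_twist:
  "\<exists>\<xi>\<in>cocycles1 G T Z. \<forall>\<psi>\<in>cocycles1 G T Z.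
    \<exists>F. twisted_hom G p F \<xi> \<and> locally_constant F \<and> (\<forall>g\<in>carrier G. [F g = \<psi> g] (mod int p))"
proof -
  obtain \<xi> where \<xi>: "\<xi> \<in> cocycles1 G T Z" "\<And>\<psi>. \<psi> \<in> cocycles1 G T Z \<Longrightarrow>
      cup G T p \<psi> \<xi> \<otimes>\<^bsub>H2 G T Z\<^esub> bockstein G T p \<psi> = \<one>\<^bsub>H2 G T Z\<^esub>"
    using grt[unfolded galois_relation_type_def Let_def carrier_H1, THEN conjunct2] by (elim bexE) blast
  show ?thesis
  proof (intro bexI[OF _ \<xi>(1)] ballI)
    fix \<psi> assume \<psi>: "\<psi> \<in> cocycles1 G T Z"
    show "\<exists>F. twisted_hom G p F \<xi> \<and> locally_constant F \<and> (\<forall>g\<in>carrier G. [F g = \<psi> g] (mod int p))"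
      by (rule twisted_hom_of_bockstein[OF p_pos \<psi> \<xi>(1) \<xi>(2)[OF \<psi>]]) (intro exI conjI ballI)
  qed
qed

lemma cocycle_locally_constant: "\<psi> \<in> cocycles1 G T Z \<Longrightarrow> locally_constant \<psi>"
  using cochains1_locally_constant cocycles1_iff[OF p_pos] by blast

text \<open>A character with a value other than \<open>0\<close> at \<open>\<sigma>\<close> would have a lift for \<open>\<xi>\<close> that does not vanish there.\<close>

lemma character_vanishes:
  assumes "mod_hom G p f" "locally_constant f"
  shows "[f \<sigma> = 0] (mod int p)"
proof (rule ccontr)
  assume no: "\<not> ?thesis"
  let ?\<psi> = "\<lambda>g\<in>carrier G. f g mod int p"
  have \<psi>: "?\<psi> \<in> cocycles1 G T Z" by (rule locally_constant_mod_hom_cocycle[OF p_pos assms(2,1)])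
  obtain \<xi> where \<xi>: "\<xi> \<in> cocycles1 G T Z"
    "\<forall>\<psi>\<in>cocycles1 G T Z.
      \<exists>F. twisted_hom G p F \<xi> \<and> locally_constant F \<and> (\<forall>g\<in>carrier G. [F g = \<psi> g] (mod int p))"
    using bockstein_twist by (rule bexE)
  obtain F where F: "twisted_hom G p F \<xi>" "locally_constant F" "\<And>g. g \<in> carrier G \<Longrightarrow> [F g = ?\<psi> g] (mod int p)"
    using bspec[OF \<xi>(2) \<psi>] by blast
  have "[F \<sigma> = f \<sigma>] (mod int p)" using F(3)[OF \<sigma>] \<sigma> by (simp add: cong_def)
  then have "\<not> [F \<sigma> = 0] (mod int p)" using no by (meson cong_sym cong_trans)
  moreover from this have "[F \<sigma> = 0] (mod int (p\<^sup>2))"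
    by (intro twisted_hom_vanishes_if_nonzero_mod_p[OF F(1,2) cocycle_locally_constant[OF \<xi>(1)] \<sigma>])
  ultimately show False using cong_p2_imp_p by blast
qed

text \<open>If \<open>F\<close> vanishes modulo \<open>p\<close>, it is \<open>p\<close> times a character.\<close>

lemma twisted_hom_vanishes:
  assumes F: "twisted_hom G p F \<eta>" "locally_constant F" "locally_constant \<eta>"
  shows "[F \<sigma> = 0] (mod int (p\<^sup>2))"
proof (cases "\<exists>g0\<in>carrier G. \<not> [F g0 = 0] (mod int p)")
  case True
  then show ?thesis using twisted_hom_vanishes_if_nonzero_mod_p[OF F] by blast
next
  case False
  then have dvd: "int p * (F g div int p) = F g" if "g \<in> carrier G" for g
    using that by (simp add: cong_0_iff)
  have "mod_hom G p (\<lambda>g. F g div int p)"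
    unfolding mod_hom_def
  proof (intro ballI)
    fix x y assume xy: "x \<in> carrier G" "y \<in> carrier G"
    have "[F (x \<otimes> y) = F x + F y] (mod int (p\<^sup>2))"
      using False xy by (intro twisted_hom_add[OF F(1)]) auto
    then have "[int p * (F (x \<otimes> y) div int p) = int p * (F x div int p) + int p * (F y div int p)] (mod int (p\<^sup>2))"
      by (simp only: dvd[OF xy(1)] dvd[OF xy(2)] dvd[OF m_closed[OF xy]])
    then show "[F (x \<otimes> y) div int p = F x div int p + F y div int p] (mod int p)"
      using p_pos by (simp add: cong_iff_dvd_diff power2_eq_square flip: distrib_left right_diff_distrib)
  qed
  then have "[F \<sigma> div int p = 0] (mod int p)"
    using locally_constant_compose[OF F(2), of "\<lambda>x. x div int p"] by (rule character_vanishes)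
  from cong_mult_p[OF this] show ?thesis by (simp add: dvd[OF \<sigma>])
qed

text \<open>
  If \<open>\<psi> \<union> \<psi>' = 0\<close>, then \<open>\<beta>(\<psi>) + \<psi> \<union> \<xi>\<close> and \<open>\<beta>(\<psi>) + \<psi> \<union> (\<xi> + \<psi>')\<close> both vanish, and \<open>p\<close> times the
  trivialization of \<open>\<psi> \<union> \<psi>'\<close> is the difference of the corresponding two lifts. In this way quotients
  isomorphic to \<open>M\<^bsub>p^3\<^esub>\<close> take over the role of those of order \<open>p\<^sup>3\<close> and exponent \<open>p\<close>.
\<close>

lemma cup_trivialization_vanishes:
  assumes \<psi>: "\<psi> \<in> cocycles1 G T Z" "\<psi>' \<in> cocycles1 G T Z" and f: "trivializes p f (\<lambda>g h. \<psi> g * \<psi>' h)"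
  shows "[f \<sigma> = 0] (mod int p)"
proof -
  obtain \<xi> where \<xi>: "\<xi> \<in> cocycles1 G T Z"
    "\<forall>\<psi>\<in>cocycles1 G T Z.
      \<exists>F. twisted_hom G p F \<xi> \<and> locally_constant F \<and> (\<forall>g\<in>carrier G. [F g = \<psi> g] (mod int p))"
    using bockstein_twist by (rule bexE)
  obtain F where F: "twisted_hom G p F \<xi>" "locally_constant F" "\<And>g. g \<in> carrier G \<Longrightarrow> [F g = \<psi> g] (mod int p)"
    using bspec[OF \<xi>(2) \<psi>(1)] by blast
  have lf: "locally_constant f" using f by (simp add: trivializes_def)
  let ?F = "\<lambda>g. F g - int p * f g" and ?\<eta> = "\<lambda>g. \<xi> g + \<psi>' g"
  have "twisted_hom G p ?F ?\<eta>"
    unfolding twisted_hom_def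
  proof (intro conjI ballI)
    have hom: "mod_hom G p \<xi>" "mod_hom G p \<psi>'" using \<xi>(1) \<psi>(2) by (simp_all add: cocycles1_iff[OF p_pos])
    show "mod_hom G p ?\<eta>"
      unfolding mod_hom_def
    proof (intro ballI)
      fix x y assume xy: "x \<in> carrier G" "y \<in> carrier G"
      from cong_add[OF mod_hom_mult[OF hom(1) xy] mod_hom_mult[OF hom(2) xy]]
      show "[\<xi> (x \<otimes> y) + \<psi>' (x \<otimes> y) = \<xi> x + \<psi>' x + (\<xi> y + \<psi>' y)] (mod int p)" by (simp add: add_ac)
    qed
    fix x y assume xy: "x \<in> carrier G" "y \<in> carrier G"
    have "[F x * \<psi>' y = \<psi> x * \<psi>' y] (mod int p)" by (intro cong_mult F(3) xy cong_refl)
    also have "[\<psi> x * \<psi>' y = f x + f y - f (x \<otimes> y)] (mod int p)" using f xy by (simp add: trivializes_def)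
    finally have 1: "[F x * \<psi>' y = f x + f y - f (x \<otimes> y)] (mod int p)" .
    have 2: "[?F x = F x] (mod int p)" by (simp add: cong_iff_dvd_diff)
    have "[?F x + ?F y + int p * ?F x * ?\<eta> y = ?F x + ?F y + int p * F x * ?\<eta> y] (mod int (p\<^sup>2))"
      by (intro cong_add cong_refl cong_mult_p_mod 2)
    also have "?F x + ?F y + int p * F x * ?\<eta> y =
        F x + F y + int p * F x * \<xi> y - int p * (f x + f y) + int p * (F x * \<psi>' y)"
      by (simp add: algebra_simps)
    also have "[\<dots> = F (x \<otimes> y) - int p * (f x + f y) + int p * (f x + f y - f (x \<otimes> y))] (mod int (p\<^sup>2))"
      by (intro cong_add cong_diff cong_refl cong_mult_p 1 cong_sym[OF twisted_hom_mult[OF F(1) xy]])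
    also have "F (x \<otimes> y) - int p * (f x + f y) + int p * (f x + f y - f (x \<otimes> y)) = ?F (x \<otimes> y)"
      by (simp add: algebra_simps)
    finally show "[?F (x \<otimes> y) = ?F x + ?F y + int p * ?F x * ?\<eta> y] (mod int (p\<^sup>2))" by (rule cong_sym)
  qed
  moreover have "locally_constant ?F"
    by (rule locally_constant_compose2[OF F(2) lf, of "\<lambda>x y. x - int p * y"])
  moreover have "locally_constant ?\<eta>"
    by (rule locally_constant_compose2[OF cocycle_locally_constant[OF \<xi>(1)] cocycle_locally_constant[OF \<psi>(2)]])
  ultimately have "[?F \<sigma> = 0] (mod int (p\<^sup>2))" by (rule twisted_hom_vanishes)
  moreover have "[F \<sigma> = 0] (mod int (p\<^sup>2))"
    by (rule twisted_hom_vanishes[OF F(1,2) cocycle_locally_constant[OF \<xi>(1)]])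
  ultimately have "[F \<sigma> - ?F \<sigma> = 0 - 0] (mod int (p\<^sup>2))" by (rule cong_diff[rotated])
  then show ?thesis using p_pos by (simp add: cong_0_iff power2_eq_square)
qed

text \<open>
  A finite quotient in which \<open>\<sigma>\<close> is a nontrivial element of a central subgroup of exponent \<open>p\<close> with
  elementary abelian quotient carries a map \<open>F\<close> with \<open>F(\<sigma>) = p\<close> whose deviation from additivity is \<open>p\<close>
  times a sum of products of characters. Comparing \<open>F\<close> with the lift of \<open>F\<close> modulo \<open>p\<close> that the
  Bockstein condition provides exhibits an element of the kernel of the cup product whose
  trivialization is not \<open>0\<close> at \<open>\<sigma>\<close>.
\<close>

lemma central_quotient_kernel:
  assumes Q: "central_class2 Q p N" "finite (carrier Q)" and \<pi>: "\<pi> \<in> hom G Q" "locally_constant \<pi>"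
    and \<sigma>N: "\<pi> \<sigma> \<in> N"
  shows "\<pi> \<sigma> = \<one>\<^bsub>Q\<^esub>"
proof (rule ccontr)
  assume no: "\<pi> \<sigma> \<noteq> \<one>\<^bsub>Q\<^esub>"
  interpret Q: central_class2 Q p N by (rule Q(1))
  have \<pi>G: "\<pi> g \<in> carrier Q" if "g \<in> carrier G" for g using hom_in_carrier[OF \<pi>(1) that] .
  obtain F b where F: "\<And>x y. x \<in> carrier Q \<Longrightarrow> y \<in> carrier Q \<Longrightarrow>
      [F (x \<otimes>\<^bsub>Q\<^esub> y) = F x + F y + int p * b x y] (mod int (p\<^sup>2))"
    and b: "\<And>y. y \<in> carrier Q \<Longrightarrow> mod_hom Q p (\<lambda>x. b x y)" "\<And>x. x \<in> carrier Q \<Longrightarrow> mod_hom Q p (b x)"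
    and F\<sigma>: "[F (\<pi> \<sigma>) = int p] (mod int (p\<^sup>2))"
  proof (rule Q.exists_bilinear_deviation[OF Q(2) \<sigma>N no])
    fix F b
    assume "\<And>x y. x \<in> carrier Q \<Longrightarrow> y \<in> carrier Q \<Longrightarrow>
        [F (x \<otimes>\<^bsub>Q\<^esub> y) = F x + F y + int p * b x y] (mod int (p\<^sup>2))"
      "\<And>y. y \<in> carrier Q \<Longrightarrow> mod_hom Q p (\<lambda>x. b x y)" "\<And>x. x \<in> carrier Q \<Longrightarrow> mod_hom Q p (b x)"
      "[F (\<pi> \<sigma>) = int p] (mod int (p\<^sup>2))"
    then show thesis by (rule that)
  qed
  obtain ts where ts: "\<forall>(u, v) \<in> set ts. mod_hom Q p u \<and> mod_hom Q p v"
    "\<And>x y. x \<in> carrier Q \<Longrightarrow> y \<in> carrier Q \<Longrightarrow> [b x y = (\<Sum>(u, v)\<leftarrow>ts. u x * v y)] (mod int p)"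
    using Q.bilinear_eq_sum_of_products[OF Q(2) prime_p b] by blast
  define F0 where "F0 g = F (\<pi> g)" for g
  define ts0 where "ts0 = map (\<lambda>(u, v). (\<lambda>g. u (\<pi> g), \<lambda>g. v (\<pi> g))) ts"
  have lF0: "locally_constant F0" unfolding F0_def by (rule locally_constant_compose[OF \<pi>(2)])
  have inflate: "mod_hom G p (\<lambda>g. u (\<pi> g))" if "mod_hom Q p u" for u
    using that \<pi>G by (simp add: mod_hom_def hom_mult[OF \<pi>(1)])
  have ts0: "mod_hom G p u \<and> locally_constant u \<and> mod_hom G p v \<and> locally_constant v" if uv0: "(u, v) \<in> set ts0" for u v
  proof -
    obtain u' v' where uv: "(u', v') \<in> set ts" "u = (\<lambda>g. u' (\<pi> g))" "v = (\<lambda>g. v' (\<pi> g))"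
      using uv0 by (auto simp: ts0_def)
    then have "mod_hom Q p u'" "mod_hom Q p v'" using ts(1) by auto
    then show ?thesis unfolding uv(2,3) by (intro conjI inflate locally_constant_compose[OF \<pi>(2)])
  qed
  have sum0: "(\<Sum>(u, v)\<leftarrow>ts0. u g * v h) = (\<Sum>(u, v)\<leftarrow>ts. u (\<pi> g) * v (\<pi> h))" for g h
    unfolding ts0_def by (simp add: o_def case_prod_unfold)
  have F0: "[F0 (g \<otimes> h) = F0 g + F0 h + int p * (\<Sum>(u, v)\<leftarrow>ts0. u g * v h)] (mod int (p\<^sup>2))"
    if gh: "g \<in> carrier G" "h \<in> carrier G" for g h
  proof -
    have "[F0 (g \<otimes> h) = F0 g + F0 h + int p * b (\<pi> g) (\<pi> h)] (mod int (p\<^sup>2))"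
      unfolding F0_def hom_mult[OF \<pi>(1) gh] by (rule F[OF \<pi>G[OF gh(1)] \<pi>G[OF gh(2)]])
    also have "[F0 g + F0 h + int p * b (\<pi> g) (\<pi> h) =
        F0 g + F0 h + int p * (\<Sum>(u, v)\<leftarrow>ts0. u g * v h)] (mod int (p\<^sup>2))"
      unfolding sum0 by (intro cong_add cong_refl cong_mult_p ts(2) \<pi>G gh)
    finally show ?thesis .
  qed
  have F0p: "mod_hom G p F0"
    unfolding mod_hom_def
  proof (intro ballI)
    fix x y assume "x \<in> carrier G" "y \<in> carrier G"
    from cong_p2_imp_p[OF F0[OF this]]
    have "[F0 (x \<otimes> y) = F0 x + F0 y + int p * (\<Sum>(u, v)\<leftarrow>ts0. u x * v y)] (mod int p)" .
    also have "[F0 x + F0 y + int p * (\<Sum>(u, v)\<leftarrow>ts0. u x * v y) = F0 x + F0 y] (mod int p)"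
      by (simp add: cong_iff_dvd_diff)
    finally show "[F0 (x \<otimes> y) = F0 x + F0 y] (mod int p)" .
  qed
  obtain \<xi> where \<xi>: "\<xi> \<in> cocycles1 G T Z"
    "\<forall>\<psi>\<in>cocycles1 G T Z.
      \<exists>F. twisted_hom G p F \<xi> \<and> locally_constant F \<and> (\<forall>g\<in>carrier G. [F g = \<psi> g] (mod int p))"
    using bockstein_twist by (rule bexE)
  obtain F1 where F1: "twisted_hom G p F1 \<xi>" "locally_constant F1"
    "\<And>g. g \<in> carrier G \<Longrightarrow> [F1 g = (\<lambda>g\<in>carrier G. F0 g mod int p) g] (mod int p)"
    using bspec[OF \<xi>(2) locally_constant_mod_hom_cocycle[OF p_pos lF0 F0p]] by blast
  have F10: "[F1 g = F0 g] (mod int p)" if "g \<in> carrier G" for g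
    using F1(3)[OF that] that by (simp add: cong_def)
  define f where "f g = (F1 g - F0 g) div int p" for g
  have pf: "int p * f g = F1 g - F0 g" if "g \<in> carrier G" for g
    using F10[OF that] by (simp add: f_def cong_iff_dvd_diff)
  let ?ts = "(\<lambda>g. - F0 g, \<xi>) # ts0"
  have "trivializes p f (\<lambda>g h. \<Sum>(u, v)\<leftarrow>?ts. u g * v h)"
    unfolding trivializes_def
  proof (intro conjI ballI)
    show "locally_constant f"
      unfolding f_def by (rule locally_constant_compose2[OF F1(2) lF0])
    fix g h assume gh: "g \<in> carrier G" "h \<in> carrier G"
    let ?s = "\<Sum>(u, v)\<leftarrow>ts0. u g * v h"
    have "[F1 (g \<otimes> h) - F0 (g \<otimes> h) =
        (F1 g + F1 h + int p * F1 g * \<xi> h) - (F0 g + F0 h + int p * ?s)] (mod int (p\<^sup>2))"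
      by (intro cong_diff twisted_hom_mult[OF F1(1)] F0 gh)
    also have "[(F1 g + F1 h + int p * F1 g * \<xi> h) - (F0 g + F0 h + int p * ?s) =
        (F1 g + F1 h + int p * F0 g * \<xi> h) - (F0 g + F0 h + int p * ?s)] (mod int (p\<^sup>2))"
      by (intro cong_diff cong_add cong_refl cong_mult_p_mod F10 gh)
    also have "(F1 g + F1 h + int p * F0 g * \<xi> h) - (F0 g + F0 h + int p * ?s) =
        (F1 g - F0 g) + (F1 h - F0 h) + int p * (F0 g * \<xi> h - ?s)" by (simp add: algebra_simps)
    finally have "[int p * f (g \<otimes> h) = int p * f g + int p * f h + int p * (F0 g * \<xi> h - ?s)] (mod int (p\<^sup>2))"
      unfolding pf[OF gh(1)] pf[OF gh(2)] pf[OF m_closed[OF gh]] .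
    then have "int p * int p dvd int p * (f (g \<otimes> h) - (f g + f h + (F0 g * \<xi> h - ?s)))"
      by (simp only: cong_iff_dvd_diff power2_eq_square of_nat_mult flip: distrib_left right_diff_distrib)
    then have "int p dvd f (g \<otimes> h) - (f g + f h + (F0 g * \<xi> h - ?s))" using p_pos by simp
    moreover have "f (g \<otimes> h) - (f g + f h + (F0 g * \<xi> h - ?s)) =
        (\<Sum>(u, v)\<leftarrow>?ts. u g * v h) - (f g + f h - f (g \<otimes> h))" by simp
    ultimately show "[(\<Sum>(u, v)\<leftarrow>?ts. u g * v h) = f g + f h - f (g \<otimes> h)] (mod int p)"
      by (simp only: cong_iff_dvd_diff)
  qed
  note triv = this
  have \<xi>p: "mod_hom G p \<xi>" using \<xi>(1) by (simp add: cocycles1_iff[OF p_pos])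
  have neg: "mod_hom G p (\<lambda>g. - F0 g)"
    unfolding mod_hom_def
  proof (intro ballI)
    fix x y assume "x \<in> carrier G" "y \<in> carrier G"
    from mod_hom_mult[OF F0p this] have "[- F0 (x \<otimes> y) = - (F0 x + F0 y)] (mod int p)"
      by (simp only: cong_minus_minus_iff)
    then show "[- F0 (x \<otimes> y) = - F0 x + - F0 y] (mod int p)" by simp
  qed
  have ts1: "mod_hom G p u \<and> locally_constant u \<and> mod_hom G p v \<and> locally_constant v" if "(u, v) \<in> set ?ts" for u v
    using that ts0 neg \<xi>p locally_constant_compose[OF lF0, of uminus] cocycle_locally_constant[OF \<xi>(1)]
    by (auto simp only: list.set insert_iff prod.inject)
  obtain S where S: "S \<subseteq> {pure_tensor (H1 G T Z) (H1 G T Z) \<psi> \<psi>' | \<psi> \<psi>'. \<psi> \<in> carrier (H1 G T Z) \<and> \<psi>' \<in> carrier (H1 G T Z)}"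
    "kernel (tensor_group (H1 G T Z) (H1 G T Z)) (H2 G T Z)
        (tensor_lift (H1 G T Z) (H1 G T Z) (H2 G T Z) (cup G T p))
      = generate (tensor_group (H1 G T Z) (H1 G T Z)) S"
    using grt[unfolded galois_relation_type_def Let_def, THEN conjunct1] by (elim exE conjE) (rule that)
  have "[f \<sigma> = 0] (mod int p)"
  proof (rule trivialization_vanishes_at[OF p_pos \<sigma> S, where ts = ?ts])
    fix \<psi> \<psi>' e
    assume "\<psi> \<in> carrier (H1 G T Z)" "\<psi>' \<in> carrier (H1 G T Z)" "trivializes p e (\<lambda>g h. \<psi> g * \<psi>' h)"
    then show "[e \<sigma> = 0] (mod int p)" unfolding carrier_H1 by (rule cup_trivialization_vanishes)
  qed (rule character_vanishes ts1 triv; assumption)+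
  from cong_mult_p[OF this] have "[F1 \<sigma> - F0 \<sigma> = 0] (mod int (p\<^sup>2))" by (simp add: pf[OF \<sigma>])
  moreover have "[F1 \<sigma> = 0] (mod int (p\<^sup>2))"
    by (rule twisted_hom_vanishes[OF F1(1,2) cocycle_locally_constant[OF \<xi>(1)]])
  ultimately have "[F1 \<sigma> - (F1 \<sigma> - F0 \<sigma>) = 0 - 0] (mod int (p\<^sup>2))" by (intro cong_diff)
  then have "[F0 \<sigma> = 0] (mod int (p\<^sup>2))" by simp
  then have "[int p = 0] (mod int (p\<^sup>2))" using F\<sigma> unfolding F0_def by (metis cong_sym cong_trans)
  then have "int p * int p dvd int p * 1" by (simp add: cong_0_iff power2_eq_square)
  then have "int p dvd 1" using p_pos by (simp only: dvd_mult_cancel_left) simp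
  then show False using prime_gt_1_nat[OF prime_p] by simp
qed

text \<open>
  An element outside the closed subgroup \<open>p_central_step G T p H\<close> stays outside it modulo some open
  normal subgroup, and in that finite quotient the image of \<open>H\<close> is central of exponent \<open>p\<close>. With
  \<open>H = G\<close> this puts \<open>\<sigma>\<close> into \<open>G\<^bsup>(2)\<^esup>\<close>, and with \<open>H = G\<^bsup>(2)\<^esup>\<close> into \<open>G\<^bsup>(3)\<^esup>\<close>.
\<close>

lemma in_p_central_step:
  assumes H: "subgroup H G" "p_central_step G T p H \<subseteq> H" "p_central_step G T p (carrier G) \<subseteq> H"
    and \<sigma>H: "\<sigma> \<in> H"
  shows "\<sigma> \<in> p_central_step G T p H"
proof (rule ccontr)
  let ?K = "p_central_step G T p H"
  assume no: "\<sigma> \<notin> ?K"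
  have HG: "H \<subseteq> carrier G" using H(1) by (rule subgroup.subset)
  have nK: "?K \<lhd> G" by (rule normal_p_central_step[OF HG H(2)])
  obtain V where V: "V \<lhd> G" "openin T V" "\<And>k v. k \<in> ?K \<Longrightarrow> v \<in> V \<Longrightarrow> k \<otimes> v \<noteq> \<sigma>"
  proof (rule open_normal_separation[OF closedin_p_central_step[OF HG] \<sigma> no])
    fix V assume "V \<lhd> G" "openin T V" "\<And>k v. k \<in> ?K \<Longrightarrow> v \<in> V \<Longrightarrow> k \<otimes> v \<noteq> \<sigma>"
    then show thesis by (rule that)
  qed
  define U where "U = ?K <#> V"
  have nU: "U \<lhd> G" unfolding U_def by (rule normal_subgroup_set_mult_closed[OF nK V(1)])
  interpret U: normal U G by (rule nU)
  have oneK: "\<one> \<in> ?K" and oneV: "\<one> \<in> V"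
    using nK V(1) by (auto intro: subgroup.one_closed normal_imp_subgroup)
  have VG: "V \<subseteq> carrier G" using V(1) by (intro subgroup.subset normal_imp_subgroup)
  have KU: "?K \<subseteq> U"
  proof
    fix k assume k: "k \<in> ?K"
    then have "k = k \<otimes> \<one>" using H(2) HG by auto
    then show "k \<in> U" using k oneV unfolding U_def set_mult_def by blast
  qed
  have VU: "V \<subseteq> U"
  proof
    fix v assume v: "v \<in> V"
    then have "v = \<one> \<otimes> v" using VG by auto
    then show "v \<in> U" using v oneK unfolding U_def set_mult_def by blast
  qed
  have \<sigma>U: "\<sigma> \<notin> U" using V(3) unfolding U_def set_mult_def by blast
  have oU: "openin T U" by (rule subgroup_containing_open_open[OF U.subgroup_axioms V(2) VU oneV])
  let ?Q = "G Mod U"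
  define \<pi> where "\<pi> g = U #> g" for g
  interpret Q: group ?Q by (rule U.factorgroup_is_group)
  have \<pi>: "\<pi> \<in> hom G ?Q" unfolding \<pi>_def[abs_def] by (rule U.r_coset_hom_Mod)
  interpret \<pi>: group_hom G ?Q \<pi> by (intro group_hom.intro group_hom_axioms.intro \<pi> is_group Q.is_group)
  have surj: "\<exists>g\<in>carrier G. x = \<pi> g" if "x \<in> carrier ?Q" for x
    using that by (auto simp: carrier_FactGroup \<pi>_def)
  have \<pi>1: "\<pi> g = \<one>\<^bsub>?Q\<^esub> \<longleftrightarrow> g \<in> U" if "g \<in> carrier G" for g
    unfolding \<pi>_def one_FactGroup
    using coset_join1[OF _ that U.subgroup_axioms] coset_join2[OF that U.subgroup_axioms] by blast
  have fin: "finite (carrier ?Q)"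
    using open_subgroup_finite_index[OF U.subgroup_axioms oU] by (simp add: FactGroup_def)
  have \<pi>comm: "grp_commutator ?Q (\<pi> x) (\<pi> y) = \<pi> (grp_commutator G x y)" if "x \<in> carrier G" "y \<in> carrier G" for x y
    using that unfolding grp_commutator_def by simp
  have "central_class2 ?Q p (\<pi> ` H)"
  proof (intro central_class2.intro central_class2_axioms.intro)
    show "group ?Q" by (rule Q.is_group)
    show "Factorial_Ring.prime p" by (rule prime_p)
    show "p \<noteq> 2" by (rule odd_p)
    show "subgroup (\<pi> ` H) ?Q" by (rule \<pi>.subgroup_img_is_subgroup[OF H(1)])
  next
    fix n x assume "n \<in> \<pi> ` H" "x \<in> carrier ?Q"
    then obtain h g where hg: "h \<in> H" "n = \<pi> h" "g \<in> carrier G" "x = \<pi> g" using surj by blast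
    have h: "h \<in> carrier G" using hg(1) HG by blast
    have c: "grp_commutator G h g \<in> U" using commutator_in_p_central_step[OF hg(1,3)] KU by blast
    have cG: "grp_commutator G h g \<in> carrier G" using h hg(3) by (rule grp_commutator_closed)
    have "n \<otimes>\<^bsub>?Q\<^esub> x = \<pi> (h \<otimes> g)" unfolding hg(2,4) by (rule \<pi>.hom_mult[OF h hg(3), symmetric])
    also have "h \<otimes> g = g \<otimes> h \<otimes> grp_commutator G h g" by (rule grp_commutator_swap[OF h hg(3)])
    also have "\<pi> (g \<otimes> h \<otimes> grp_commutator G h g) = \<pi> g \<otimes>\<^bsub>?Q\<^esub> \<pi> h \<otimes>\<^bsub>?Q\<^esub> \<pi> (grp_commutator G h g)"
      using \<pi>.hom_mult[OF m_closed[OF hg(3) h] cG] \<pi>.hom_mult[OF hg(3) h] by simp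
    also have "\<pi> (grp_commutator G h g) = \<one>\<^bsub>?Q\<^esub>" using \<pi>1[OF cG] c by blast
    also have "\<pi> g \<otimes>\<^bsub>?Q\<^esub> \<pi> h \<otimes>\<^bsub>?Q\<^esub> \<one>\<^bsub>?Q\<^esub> = x \<otimes>\<^bsub>?Q\<^esub> n"
      unfolding hg(2,4) by (rule Q.r_one[OF Q.m_closed[OF \<pi>.hom_closed[OF hg(3)] \<pi>.hom_closed[OF h]]])
    finally show "n \<otimes>\<^bsub>?Q\<^esub> x = x \<otimes>\<^bsub>?Q\<^esub> n" .
  next
    fix n assume "n \<in> \<pi> ` H"
    then obtain h where h: "h \<in> H" "n = \<pi> h" by blast
    have hG: "h \<in> carrier G" using h(1) HG by blast
    have "h [^] p \<in> U" using pow_in_p_central_step[OF h(1)] KU by blast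
    then have "\<pi> (h [^] p) = \<one>\<^bsub>?Q\<^esub>" using \<pi>1[OF nat_pow_closed[OF hG]] by blast
    then show "n [^]\<^bsub>?Q\<^esub> p = \<one>\<^bsub>?Q\<^esub>" by (simp only: h(2) \<pi>.hom_nat_pow[OF hG])
  next
    fix x assume "x \<in> carrier ?Q"
    then obtain g where g: "g \<in> carrier G" "x = \<pi> g" using surj by blast
    have "g [^] p \<in> H" using pow_in_p_central_step[OF g(1)] H(3) by blast
    then have "\<pi> (g [^] p) \<in> \<pi> ` H" by (rule imageI)
    then show "x [^]\<^bsub>?Q\<^esub> p \<in> \<pi> ` H" by (simp only: g(2) \<pi>.hom_nat_pow[OF g(1)])
  next
    fix x y assume "x \<in> carrier ?Q" "y \<in> carrier ?Q"
    then obtain g h where gh: "g \<in> carrier G" "x = \<pi> g" "h \<in> carrier G" "y = \<pi> h" using surj by blast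
    have "grp_commutator G g h \<in> H" using commutator_in_p_central_step[OF gh(1,3)] H(3) by blast
    then have "\<pi> (grp_commutator G g h) \<in> \<pi> ` H" by (rule imageI)
    then show "grp_commutator ?Q x y \<in> \<pi> ` H" by (simp only: gh(2,4) \<pi>comm[OF gh(1,3)])
  qed
  moreover have "locally_constant \<pi>"
  proof (rule continuous_map_constant_on_cosets[OF U.subgroup_axioms oU])
    fix n g assume n: "n \<in> U" and g: "g \<in> carrier G"
    have "U #> (n \<otimes> g) = U #> n #> g" using n g by (simp add: coset_mult_assoc U.subset)
    also have "U #> n = U" using n by (simp add: U.rcos_const)
    finally show "\<pi> (n \<otimes> g) = \<pi> g" by (simp add: \<pi>_def)
  qed
  ultimately have "\<pi> \<sigma> = \<one>\<^bsub>?Q\<^esub>"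
    using fin \<pi> imageI[OF \<sigma>H, of \<pi>] by (intro central_quotient_kernel[of ?Q "\<pi> ` H" \<pi>])
  then show False using \<pi>1[OF \<sigma>] \<sigma>U by blast
qed

lemma in_p_central_series_3: "\<sigma> \<in> p_central_step G T p (p_central_step G T p (carrier G))"
proof -
  let ?G2 = "p_central_step G T p (carrier G)"
  have G2: "subgroup ?G2 G" by (rule subgroup_p_central_step) simp
  then have sub: "?G2 \<subseteq> carrier G" by (rule subgroup.subset)
  have "\<sigma> \<in> ?G2" by (rule in_p_central_step[OF subgroup_self sub sub \<sigma>])
  moreover have "p_central_step G T p ?G2 \<subseteq> ?G2" by (rule p_central_step_mono[OF sub order.refl])
  ultimately show ?thesis by (intro in_p_central_step[OF G2]) auto
qed

end

theorem corollary11p2: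
  fixes G :: "('a, 'b) monoid_scheme" and T :: "'a topology" and p :: nat
  assumes "Factorial_Ring.prime p" and "p \<noteq> 2"
    and "profinite_group G T"
    and "galois_relation_type G T p"
  shows "p_central_series G T p 3 =
    \<Inter>{N. N \<lhd> G \<and> openin T N \<and>
        (trivial_group (G Mod N) \<or> G Mod N \<cong> integer_mod_group (p\<^sup>2) \<or> G Mod N \<cong> M_p3 p)}"
    (is "_ = \<Inter>?\<N>")
proof -
  interpret profinite_group G T by fact
  have series: "p_central_series G T p 3 = p_central_step G T p (p_central_step G T p (carrier G))"
    by (simp add: p_central_series_def eval_nat_numeral)
  show ?thesis
    unfolding series
  proof (intro equalityI subsetI)
    fix \<sigma> assume "\<sigma> \<in> p_central_step G T p (p_central_step G T p (carrier G))"
    then show "\<sigma> \<in> \<Inter>?\<N>"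
      using p_central_series_3_le_quotient_kernel[OF assms(1,2)] by blast
  next
    fix \<sigma> assume \<sigma>: "\<sigma> \<in> \<Inter>?\<N>"
    have "carrier G \<in> ?\<N>"
    proof -
      have "carrier G \<lhd> G" by (simp add: normal_inv_iff subgroup_self)
      moreover have "openin T (carrier G)" using openin_topspace[of T] by (simp add: topspace_eq)
      moreover have "trivial_group (G Mod carrier G)"
      proof -
        interpret Q: group "G Mod carrier G"
          using \<open>carrier G \<lhd> G\<close> by (rule normal.factorgroup_is_group)
        have "carrier G #>\<^bsub>G\<^esub> x = carrier G" if "x \<in> carrier G" for x
          using coset_join2[OF that subgroup_self that] .
        then have "carrier (G Mod carrier G) \<subseteq> {\<one>\<^bsub>G Mod carrier G\<^esub>}"
          by (auto simp: carrier_FactGroup)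
        then show ?thesis by (simp only: Q.trivial_group_subset)
      qed
      ultimately show ?thesis by blast
    qed
    with \<sigma> have "\<sigma> \<in> carrier G" by blast
    with \<sigma> interpret undetected_element G T p \<sigma>
      by unfold_locales (use assms in blast)+
    show "\<sigma> \<in> p_central_step G T p (p_central_step G T p (carrier G))"
      by (rule in_p_central_series_3)
  qed
qed

end
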